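(* There are no continuous measure-expansive flows with non-trivial recurrence on closed surfaces. That is, if $X$ is a closed surface (with a metric compatible with its topology) and $\phi$ is a continuous flow of $X$ having a non-trivial recurrence, then $\phi$ is not measure-expansive.
   Context: A closed surface is a compact connected boundaryless manifold of dimension two. Let $(X,d)$ be a metric space. A flow of $X$ is a map $\phi:\mathbb{R}\times X\to X$, written $\phi_t(x)=\phi(t,x)$, with $\phi_0(x)=x$ and $\phi(t,\phi(s,x))=\phi(t+s,x)$ for all $s,t\in\mathbb{R}$, $x\in X$; it is continuous if it is continuous as a map $\mathbb{R}\times X\to X$. The orbit of $x$ is $\phi_{\mathbb{R}}(x)=\{\phi_t(x):t\in\mathbb{R}\}$. A periodic point is a point $x$ for which there is a minimal $t>0$ with $\phi_t(x)=x$. A non-trivial recurrence of $\phi$ is a non-periodic point $x_0$ which is recurrent, i.e. $x_0\in\omega(x_0)$, where $\omega(x)=\{y\in X: y=\lim_{n\to\infty}\phi_{t_n}(x)\text{ for some sequence }t_n\to\infty\}$. Let $\mathcal{B}$ be the set of continuous maps $h:\mathbb{R}\to\mathbb{R}$ with $h(0)=0$. For $\delta>0$ and $x\in X$, $\Gamma_\delta(x)$ is the set of $y\in X$ for which there is $h\in\mathcal{B}$ with $d(\phi_t(x),\phi_{h(t)}(y))\le\delta$ for all $t\in\mathbb{R}$. A Borel measure is a non-negative $\sigma$-additive map on the Borel $\sigma$-algebra of $X$. For an arbitrary subset $B\subset X$ one writes $\mu(B)=0$ if $\mu(A)=0$ for every Borel set $A\subset B$. A Borel measure $\mu$ is expansive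 for $\phi$ if there is $\delta>0$ such that $\mu(\Gamma_\delta(x))=0$ for every $x\in X$. $\mu$ vanishes along the orbits of $\phi$ if $\mu(\phi_{\mathbb{R}}(x))=0$ for every $x\in X$. The flow $\phi$ is measure-expansive if every Borel measure vanishing along the orbits of $\phi$ is expansive for $\phi$. *)

theory Defs
  imports "HOL-Analysis.Analysis"
begin

text \<open>
  The metric space is a subset \<open>X\<close> of a type of class \<open>metric_space\<close>, with the metric
  \<open>dist\<close>. Values of a flow outside \<open>X\<close> are irrelevant.
\<close>

definition closed_surface :: "'a::metric_space set \<Rightarrow> bool" where
  "closed_surface X \<longleftrightarrow>
     X \<noteq> {} \<and> compact X \<and> connected X \<and>
     (\<forall>x\<in>X. \<exists>U (V :: (real ^ 2) set).
        openin (top_of_set X) U \<and> x \<in> U \<and> open V \<and> U homeomorphic V)"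

definition flow_on :: "'a set \<Rightarrow> (real \<Rightarrow> 'a \<Rightarrow> 'a) \<Rightarrow> bool" where
  "flow_on X \<phi> \<longleftrightarrow>
     (\<forall>t. \<forall>x\<in>X. \<phi> t x \<in> X) \<and>
     (\<forall>x\<in>X. \<phi> 0 x = x) \<and>
     (\<forall>s t. \<forall>x\<in>X. \<phi> t (\<phi> s x) = \<phi> (t + s) x)"

definition continuous_flow_on :: "'a::metric_space set \<Rightarrow> (real \<Rightarrow> 'a \<Rightarrow> 'a) \<Rightarrow> bool" where
  "continuous_flow_on X \<phi> \<longleftrightarrow>
     flow_on X \<phi> \<and> continuous_on (UNIV \<times> X) (\<lambda>(t, x). \<phi> t x)"

definition flow_orbit :: "(real \<Rightarrow> 'a \<Rightarrow> 'a) \<Rightarrow> 'a \<Rightarrow> 'a set" where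
  "flow_orbit \<phi> x = range (\<lambda>t. \<phi> t x)"

text \<open>
  For a fixed point of a flow there is no minimal \<open>t > 0\<close> with \<open>\<phi> t x = x\<close>, so fixed points
  are not periodic points in this sense.
\<close>

definition periodic_point :: "(real \<Rightarrow> 'a \<Rightarrow> 'a) \<Rightarrow> 'a \<Rightarrow> bool" where
  "periodic_point \<phi> x \<longleftrightarrow>
     (\<exists>t>0. \<phi> t x = x \<and> (\<forall>s. 0 < s \<and> s < t \<longrightarrow> \<phi> s x \<noteq> x))"

definition omega_limit :: "'a::metric_space set \<Rightarrow> (real \<Rightarrow> 'a \<Rightarrow> 'a) \<Rightarrow> 'a \<Rightarrow> 'a set" where
  "omega_limit X \<phi> x =
     {y \<in> X. \<exists>t :: nat \<Rightarrow> real. filterlim t at_top sequentially \<and>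
        (\<lambda>n. \<phi> (t n) x) \<longlonglongrightarrow> y}"

definition nontrivial_recurrence ::
    "'a::metric_space set \<Rightarrow> (real \<Rightarrow> 'a \<Rightarrow> 'a) \<Rightarrow> 'a \<Rightarrow> bool" where
  "nontrivial_recurrence X \<phi> x \<longleftrightarrow>
     x \<in> X \<and> \<not> periodic_point \<phi> x \<and> x \<in> omega_limit X \<phi> x"

text \<open>The reparametrizations \<open>h\<close> need not be monotone or surjective.\<close>

definition reparams :: "(real \<Rightarrow> real) set" where
  "reparams = {h. continuous_on UNIV h \<and> h 0 = 0}"

definition Gamma_set ::
    "'a::metric_space set \<Rightarrow> (real \<Rightarrow> 'a \<Rightarrow> 'a) \<Rightarrow> real \<Rightarrow> 'a \<Rightarrow> 'a set" where
  "Gamma_set X \<phi> \<delta> x =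
     {y \<in> X. \<exists>h\<in>reparams. \<forall>t. dist (\<phi> t x) (\<phi> (h t) y) \<le> \<delta>}"

text \<open>
  \<open>restrict_space borel X\<close> carries the Borel \<open>\<sigma>\<close>-algebra of the subspace \<open>X\<close>. The measure
  may be zero, and it may take the value \<open>\<infinity>\<close>.
\<close>

definition borel_measure_on :: "'a::metric_space set \<Rightarrow> 'a measure \<Rightarrow> bool" where
  "borel_measure_on X \<mu> \<longleftrightarrow> sets \<mu> = sets (restrict_space borel X)"

text \<open>
  Inner nullity of an arbitrary, possibly non-measurable set. For non-measurable \<open>B\<close> this is
  weaker than being contained in a null set, and \<open>emeasure \<mu> B\<close> would be \<open>0\<close> by default.
\<close>

definition vanishes_on :: "'a measure \<Rightarrow> 'a set \<Rightarrow> bool" where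
  "vanishes_on \<mu> B \<longleftrightarrow> (\<forall>A\<in>sets \<mu>. A \<subseteq> B \<longrightarrow> emeasure \<mu> A = 0)"

definition expansive_measure ::
    "'a::metric_space set \<Rightarrow> (real \<Rightarrow> 'a \<Rightarrow> 'a) \<Rightarrow> 'a measure \<Rightarrow> bool" where
  "expansive_measure X \<phi> \<mu> \<longleftrightarrow>
     (\<exists>\<delta>>0. \<forall>x\<in>X. vanishes_on \<mu> (Gamma_set X \<phi> \<delta> x))"

definition vanishes_along_orbits ::
    "'a set \<Rightarrow> (real \<Rightarrow> 'a \<Rightarrow> 'a) \<Rightarrow> 'a measure \<Rightarrow> bool" where
  "vanishes_along_orbits X \<phi> \<mu> \<longleftrightarrow> (\<forall>x\<in>X. vanishes_on \<mu> (flow_orbit \<phi> x))"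

definition measure_expansive ::
    "'a::metric_space set \<Rightarrow> (real \<Rightarrow> 'a \<Rightarrow> 'a) \<Rightarrow> bool" where
  "measure_expansive X \<phi> \<longleftrightarrow>
     (\<forall>\<mu>. borel_measure_on X \<mu> \<and> vanishes_along_orbits X \<phi> \<mu> \<longrightarrow> expansive_measure X \<phi> \<mu>)"

end

theory Submission
  imports Defs
begin

text \<open>
  Give a Borel set mass \<open>0\<close> if countably many orbits cover it and mass \<open>\<infinity>\<close> otherwise. This is a
  Borel measure that vanishes along the orbits (\<open>thin_measure\<close>), so it suffices to find, for
  every \<open>\<delta> > 0\<close>, a point \<open>x\<close> and a compact subset of \<open>\<Gamma>\<^sub>\<delta>(x)\<close> that countably many orbits do not
  cover.

  At a fixed point \<open>p\<close> the reparametrization \<open>h = 0\<close> shows that \<open>\<Gamma>\<^sub>\<delta>(p)\<close> is a whole \<open>\<delta>\<close>-ball. An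
  orbit is a countable union of arcs, arcs in a surface have empty interior by invariance of
  domain, and Baire's theorem says that countably many of them do not fill a ball
  (\<open>not_measure_expansive_if_fixed_point\<close>).

  Without fixed points every point lies in the middle of a flow box whose cross-section is an arc
  (\<open>flow_box_exists\<close>), and finitely many boxes cover the surface. Assume that for some \<open>\<delta>\<close> countably
  many orbits cover every compact subset of every \<open>\<Gamma>\<^sub>\<delta>(x)\<close>. Carry a short interval of a cross-section
  along the orbit of one of its end points. If the images stayed short for all positive and
  negative times, the interval would lie in \<open>\<Gamma>\<^sub>\<delta>\<close> of that end point; but an orbit meets a
  cross-section in a countable set, so the interval is not covered by countably many orbits.
  Hence every interval, however short, is carried by the flow, forwards or backwards, to an
  interval of a fixed length \<open>\<kappa>\<close> (\<open>intervals_stretch\<close>).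

  Let \<open>x\<close> be recurrent and not periodic, lying on a cross-section, and let \<open>K\<close> be the closure of its
  orbit. Either \<open>K\<close> misses points of the cross-section arbitrarily close to \<open>x\<close> on its right, or
  \<open>K\<close> contains an interval of the cross-section.

  In the first case \<open>x\<close> is a limit of end points of gaps of \<open>K\<close>. On the middle halves of the
  cross-sections only finitely many gaps have length at least \<open>\<kappa>\<close>. Shorter and shorter intervals at one end of a gap are all stretched to that length,
  so the orbit of the end point passes through the end point of one of these gaps at two different
  times. All end points of gaps therefore lie on finitely many periodic orbits, whose union is
  closed and contains \<open>x\<close> (\<open>periodic_if_accumulated_by_gaps\<close>).

  In the second case intervals inside \<open>K\<close> are stretched over and over, each time across a cell of a
  fixed finite grid. Some cell recurs: a proper subinterval of it is carried by the flow onto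
  the whole cell (\<open>self_covering_interval\<close>). The inverse of this map sends the cell into itself, so
  it or its square is increasing and has monotone, convergent iterates. The orbit of \<open>x\<close> is
  dense in \<open>K\<close> and meets the cell. If the inverse map follows the flow forwards, its iterates show
  that the orbit of \<open>x\<close> is asymptotic to a periodic orbit. If it follows the flow backwards, the
  returns of the orbit to the cell after long times place a point of the orbit in the intersection
  of the images of all iterates, where the map is invertible, and the same argument applies to
  the inverse of the map (\<open>self_return_periodic\<close>). A recurrent point with a periodic orbit as
  limit set is periodic, a contradiction.
\<close>

section \<open>Matching two sequences of times\<close>

text \<open>The graph of \<open>h\<close> joins the points \<open>(a n, b n)\<close> by segments. Because \<open>h\<close> vanishes on the negative
  axis, a reparametrization of the whole line is the sum of one such function and of the
  reflection of another.\<close>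

lemma piecewise_linear_exists:
  fixes a b :: "nat \<Rightarrow> real"
  assumes a: "a 0 = 0" "\<And>n. a (Suc n) - a n \<ge> 1/2" and b: "b 0 = 0"
  obtains h where "continuous_on UNIV h" "\<And>t. t \<le> 0 \<Longrightarrow> h t = 0"
    "\<And>t. t \<ge> 0 \<Longrightarrow> \<exists>n. \<exists>\<theta>\<in>{0..1}. t = a n + \<theta> * (a (Suc n) - a n) \<and> h t = b n + \<theta> * (b (Suc n) - b n)"
proof -
  \<comment> \<open>a ramp that rises from \<open>0\<close> to \<open>1\<close> between the times \<open>a n\<close> and \<open>a (Suc n)\<close>\<close>
  define w where "w n t = max 0 (min 1 ((t - a n) / (a (Suc n) - a n)))" for n t
  have pos: "a (Suc n) - a n > 0" for n using a(2)[of n] by linarith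
  have mono: "a m \<le> a n" if "m \<le> n" for m n
    by (rule lift_Suc_mono_le[OF _ that]) (use pos in \<open>simp add: less_imp_le\<close>)
  have big: "a n \<ge> real n / 2" for n
  proof (induction n)
    case (Suc n) then show ?case using a(2)[of n] by (simp add: field_simps)
  qed (use a in simp)
  have w0: "w n t = 0" if "t \<le> a n" for n t
    using divide_nonpos_pos[OF _ pos[of n], of "t - a n"] that by (simp add: w_def)
  have w1: "w n t = 1" if "a (Suc n) \<le> t" for n t
    using that pos[of n] by (simp add: w_def le_divide_eq max_def min_def)
  define H where "H N t = (\<Sum>n<N. (b (Suc n) - b n) * w n t)" for N t
  have cH: "continuous_on S (H N)" for S N
    unfolding H_def w_def using pos
    by (intro continuous_intros) (auto simp: less_imp_neq[THEN not_sym])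
  have H_eq: "H M t = H N t" if "t \<le> a N" "N \<le> M" for M N t
  proof -
    have "(\<Sum>n\<in>{..<M}. (b (Suc n) - b n) * w n t) = (\<Sum>n\<in>{..<N}. (b (Suc n) - b n) * w n t)"
      by (rule sum.mono_neutral_right) (use that mono in \<open>auto intro!: w0 intro: order_trans\<close>)
    then show ?thesis by (simp add: H_def)
  qed
  define m where "m t = nat \<lceil>2 * t\<rceil>" for t :: real
  have m: "t \<le> a (m t)" for t using big[of "m t"] unfolding m_def by linarith
  define h where "h t = H (m t) t" for t
  have h_eq: "h t = H N t" if "t \<le> a N" for t N
    unfolding h_def using H_eq[OF m, of t "max N (m t)"] H_eq[OF that, of "max N (m t)"] by simp
  have "continuous_on UNIV h"
    unfolding continuous_on_eq_continuous_at[OF open_UNIV]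
  proof
    fix t :: real
    define N where "N = Suc (m t)"
    have t: "t < a N" using m[of t] pos[of "m t"] by (simp add: N_def)
    have "continuous_on {..<a N} h"
      by (rule continuous_on_eq[OF cH[of _ N]]) (use h_eq[symmetric] in auto)
    then show "isCont h t" using t by (simp add: continuous_on_eq_continuous_at)
  qed
  moreover have "h t = 0" if "t \<le> 0" for t
    using h_eq[of t 0] that a by (simp add: H_def)
  moreover have "\<exists>n. \<exists>\<theta>\<in>{0..1}. t = a n + \<theta> * (a (Suc n) - a n) \<and> h t = b n + \<theta> * (b (Suc n) - b n)"
    if t: "t \<ge> 0" for t
  proof -
    define N where "N = (LEAST n. t \<le> a n)"
    have N: "t \<le> a N" unfolding N_def by (rule LeastI[of _ "m t"]) (rule m)
    have below: "a n < t" if "n < N" for n using not_less_Least[of n "\<lambda>n. t \<le> a n"] that by (simp add: N_def)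
    show ?thesis
    proof (cases N)
      case 0
      then have "t = 0" using N a t by simp
      moreover have "h 0 = 0" using h_eq[of 0 0] a by (simp add: H_def)
      ultimately show ?thesis using a b by (intro exI[of _ 0] bexI[of _ 0]) auto
    next
      case (Suc n)
      define \<theta> where "\<theta> = (t - a n) / (a (Suc n) - a n)"
      have an: "a n < t" "t \<le> a (Suc n)" using below[of n] N Suc by auto
      then have th: "0 \<le> \<theta>" "\<theta> \<le> 1" using pos[of n] by (simp_all add: \<theta>_def)
      then have wn: "w n t = \<theta>" by (simp add: w_def \<theta>_def)
      have "(\<Sum>k<n. (b (Suc k) - b k) * w k t) = (\<Sum>k<n. b (Suc k) - b k)"
      proof (rule sum.cong[OF refl])
        fix k assume "k \<in> {..<n}"
        then have "a (Suc k) \<le> t" using an mono[of "Suc k" n] by auto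
        then show "(b (Suc k) - b k) * w k t = b (Suc k) - b k" using w1 by simp
      qed
      also have "\<dots> = b n" using sum_lessThan_telescope[of b n] b by simp
      finally have "h t = b n + \<theta> * (b (Suc n) - b n)"
        using h_eq[OF N] wn by (simp add: H_def Suc algebra_simps)
      moreover have "t = a n + \<theta> * (a (Suc n) - a n)" using pos[of n] by (simp add: \<theta>_def)
      ultimately show ?thesis using th by (intro exI[of _ n] bexI[of _ \<theta>]) auto
    qed
  qed
  ultimately show ?thesis by (rule that)
qed

lemma between_partial_sums:
  fixes S :: "nat \<Rightarrow> real"
  assumes "S 0 \<le> t" "t < S N" obtains k where "S k \<le> t" "t < S (Suc k)"
proof -
  define n where "n = (LEAST n. t < S n)"
  have n: "t < S n" unfolding n_def by (rule LeastI[of _ N]) (rule assms)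
  have "n \<noteq> 0" using n assms(1) by (intro notI) simp
  then obtain k where k: "n = Suc k" using not0_implies_Suc by blast
  have "\<not> t < S k" using not_less_Least[of k "\<lambda>n. t < S n"] k by (simp add: n_def)
  then show ?thesis using that[of k] n k by simp
qed

section \<open>Flows and periods\<close>

locale surface_flow =
  fixes X :: "'a::metric_space set" and \<phi> :: "real \<Rightarrow> 'a \<Rightarrow> 'a"
  assumes surface: "closed_surface X" and flow: "continuous_flow_on X \<phi>"
begin

lemma compact_X: "compact X"
  using surface unfolding closed_surface_def by auto

lemma flow_in [simp, intro]: "x \<in> X \<Longrightarrow> \<phi> t x \<in> X"
  and flow_0 [simp]: "x \<in> X \<Longrightarrow> \<phi> 0 x = x"
  and flow_flow [simp]: "x \<in> X \<Longrightarrow> \<phi> t (\<phi> s x) = \<phi> (t + s) x"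
  using flow unfolding continuous_flow_on_def flow_on_def by auto

lemma flow_shift_eq:
  assumes "x \<in> X" "y \<in> X" "\<phi> s x = \<phi> t y"
  shows "\<phi> (s + u) x = \<phi> (t + u) y"
  using assms by (metis add.commute flow_flow)

lemma continuous_on_flow [continuous_intros]:
  assumes "continuous_on S f" "continuous_on S g" "g ` S \<subseteq> X"
  shows "continuous_on S (\<lambda>s. \<phi> (f s) (g s))"
proof -
  have c: "continuous_on (UNIV \<times> X) (\<lambda>(t, x). \<phi> t x)"
    using flow unfolding continuous_flow_on_def by auto
  have "continuous_on S ((\<lambda>(t, x). \<phi> t x) \<circ> (\<lambda>s. (f s, g s)))"
    by (rule continuous_on_compose)
       (use assms in \<open>auto intro!: continuous_intros continuous_on_subset[OF c]\<close>)
  then show ?thesis by (simp add: o_def)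
qed

lemma tendsto_flow [tendsto_intros]:
  assumes t: "(t \<longlongrightarrow> t0) F" and x: "(x \<longlongrightarrow> x0) F" and "\<And>n. x n \<in> X" "x0 \<in> X"
  shows "((\<lambda>n. \<phi> (t n) (x n)) \<longlongrightarrow> \<phi> t0 x0) F"
proof -
  have c: "continuous_on (UNIV \<times> X) (\<lambda>(t, x). \<phi> t x)"
    using flow unfolding continuous_flow_on_def by auto
  have "((\<lambda>n. (t n, x n)) \<longlongrightarrow> (t0, x0)) F" by (intro tendsto_intros t x)
  from continuous_on_tendsto_compose[OF c this] assms show ?thesis by auto
qed

definition fixed :: "'a \<Rightarrow> bool"
  where "fixed p \<longleftrightarrow> p \<in> X \<and> (\<forall>t. \<phi> t p = p)"

lemma period_multiple:
  assumes "x \<in> X" "\<phi> t x = x" shows "\<phi> (real n * t) x = x"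
proof (induction n)
  case (Suc n)
  have "\<phi> (real (Suc n) * t) x = \<phi> t (\<phi> (real n * t) x)"
    using assms(1) by (simp add: algebra_simps)
  with Suc assms show ?case by simp
qed (use assms in simp)

lemma period_uminus:
  assumes "x \<in> X" "\<phi> t x = x" shows "\<phi> (- t) x = x"
  using flow_flow[OF assms(1), of "-t" t] assms by simp

text \<open>The multiples of arbitrarily small periods are dense in the line, and the flow is continuous.\<close>

lemma fixed_if_small_periods:
  assumes x: "x \<in> X" and small: "\<And>e. e > 0 \<Longrightarrow> \<exists>t. 0 < t \<and> t < e \<and> \<phi> t x = x"
  shows "fixed x"
proof -
  have "\<phi> s x = x" if "s \<ge> 0" for s
  proof -
    have "\<forall>n. \<exists>t. 0 < t \<and> t < inverse (real (Suc n)) \<and> \<phi> t x = x"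
      using small by simp
    then obtain t where t: "\<And>n. 0 < t n" "\<And>n. t n < inverse (real (Suc n))" "\<And>n. \<phi> (t n) x = x"
      by metis
    have t0: "t \<longlonglongrightarrow> 0"
      by (rule tendsto_sandwich[OF _ _ tendsto_const LIMSEQ_inverse_real_of_nat])
         (use t in \<open>auto intro!: always_eventually less_imp_le\<close>)
    \<comment> \<open>the largest multiple of the period \<open>t n\<close> below \<open>s\<close>\<close>
    define r where "r n = real (nat \<lfloor>s / t n\<rfloor>) * t n" for n
    have r: "\<phi> (r n) x = x" for n
      unfolding r_def by (rule period_multiple) (use x t in auto)
    have b: "s - t n \<le> r n" "r n \<le> s" for n
    proof -
      have e: "real (nat \<lfloor>s / t n\<rfloor>) = of_int \<lfloor>s / t n\<rfloor>"
        using that t(1)[of n] by simp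
      have "s / t n - 1 \<le> of_int \<lfloor>s / t n\<rfloor>" "of_int \<lfloor>s / t n\<rfloor> \<le> s / t n" by linarith+
      then have "(s / t n - 1) * t n \<le> r n" "r n \<le> (s / t n) * t n"
        using t(1)[of n] unfolding r_def e by (auto intro!: mult_right_mono simp del: times_divide_eq_left)
      moreover have "(s / t n - 1) * t n = s - t n" "s / t n * t n = s"
        using t(1)[of n] by (simp_all add: left_diff_distrib)
      ultimately show "s - t n \<le> r n" "r n \<le> s" by simp_all
    qed
    have "(\<lambda>n. s - t n) \<longlonglongrightarrow> s" using tendsto_diff[OF tendsto_const t0, of s] by simp
    then have rl: "r \<longlonglongrightarrow> s"
      by (rule tendsto_sandwich[OF _ _ _ tendsto_const, rotated 2])
         (use b in \<open>auto intro!: always_eventually\<close>)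
    have "(\<lambda>n. \<phi> (r n) x) \<longlonglongrightarrow> \<phi> s x"
      by (intro tendsto_flow rl tendsto_const) (use x in auto)
    then show ?thesis using r by (simp add: LIMSEQ_const_iff)
  qed
  then have "\<phi> s x = x" for s
    using period_uminus[OF x, of "-s"] by (cases "s \<ge> 0") auto
  then show ?thesis using x by (auto simp: fixed_def)
qed

text \<open>The positive periods form a closed set, and those of a point that is not fixed stay away from \<open>0\<close>,
  so there is a least one.\<close>

lemma periodic_point_if_period:
  assumes x: "x \<in> X" and nf: "\<not> fixed x" and p: "\<phi> t x = x" "t \<noteq> 0"
  shows "periodic_point \<phi> x"
proof -
  define P where "P = {t. t > 0 \<and> \<phi> t x = x}"
  have ne: "P \<noteq> {}"
    using p period_uminus[OF x p(1)] unfolding P_def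
    by (cases "t > 0") (auto intro: exI[of _ "-t"])
  have bdd: "bdd_below P" by (rule bdd_belowI[of _ 0]) (auto simp: P_def)
  obtain e where e: "e > 0" "\<And>t. \<phi> t x = x \<Longrightarrow> 0 < t \<Longrightarrow> t \<ge> e"
    using fixed_if_small_periods[OF x] nf by (meson not_less)
  have "P = {t \<in> {e..}. \<phi> t x = x}" using e by (auto simp: P_def)
  moreover have "closed {t \<in> {e..}. \<phi> t x = x}"
    by (rule continuous_closed_preimage_constant) (use x in \<open>auto intro!: continuous_intros\<close>)
  ultimately have "closed P" by simp
  then have "Inf P \<in> P" using closed_contains_Inf[OF ne bdd] by simp
  moreover have "s \<notin> P" if "s < Inf P" for s
    using cInf_lower[OF _ bdd, of s] that by auto
  ultimately show ?thesis unfolding periodic_point_def P_def by auto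
qed

section \<open>A measure with infinite mass on all sets that are not thin\<close>

text \<open>The null sets of the measure below; they form a \<open>\<sigma>\<close>-ideal that contains the orbits.\<close>

definition orbit_thin :: "'a set \<Rightarrow> bool"
  where "orbit_thin A \<longleftrightarrow> (\<exists>D\<subseteq>X. countable D \<and> A \<subseteq> (\<Union>x\<in>D. flow_orbit \<phi> x))"

definition thin_measure :: "'a measure"
  where "thin_measure = measure_of X (sets (restrict_space borel X))
           (\<lambda>A. if orbit_thin A then 0 else \<infinity>)"

lemma orbit_thin_subset: "orbit_thin B \<Longrightarrow> A \<subseteq> B \<Longrightarrow> orbit_thin A"
  unfolding orbit_thin_def by (meson order_trans)

lemma orbit_thin_UN:
  assumes "countable I" "\<And>i. i \<in> I \<Longrightarrow> orbit_thin (A i)" shows "orbit_thin (\<Union>i\<in>I. A i)"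
proof -
  obtain D where D: "\<And>i. i \<in> I \<Longrightarrow> D i \<subseteq> X \<and> countable (D i) \<and> A i \<subseteq> (\<Union>x\<in>D i. flow_orbit \<phi> x)"
    using assms(2) unfolding orbit_thin_def by metis
  show ?thesis unfolding orbit_thin_def
    by (rule exI[of _ "\<Union>i\<in>I. D i"]) (use D assms(1) in \<open>fastforce intro: countable_UN\<close>)
qed

lemma sets_thin_measure: "sets thin_measure = sets (restrict_space borel X)"
  unfolding thin_measure_def
  by (metis sets.sets_measure_of_eq space_restrict_space2 sets.top space_restrict_space
      inf_top_right space_borel Int_commute)

text \<open>Countable additivity only says here that a countable union is thin if and only if all its parts are.\<close>

lemma emeasure_thin_measure:
  assumes "A \<in> sets (restrict_space borel X)"
  shows "emeasure thin_measure A = (if orbit_thin A then 0 else \<infinity>)"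
proof -
  let ?M = "restrict_space borel X"
  let ?\<mu> = "\<lambda>A. if orbit_thin A then 0 else (\<infinity>::ennreal)"
  have sp: "space ?M = X" by (simp add: space_restrict_space)
  have sa: "sigma_algebra X (sets ?M)" using sets.sigma_algebra_axioms[of ?M] sp by simp
  have pos: "positive (sets ?M) ?\<mu>" unfolding positive_def orbit_thin_def by auto
  have "countably_additive (sets ?M) ?\<mu>"
    unfolding countably_additive_def
  proof (intro allI impI)
    fix A :: "nat \<Rightarrow> 'a set"
    show "(\<Sum>i. ?\<mu> (A i)) = ?\<mu> (\<Union>i. A i)"
    proof (cases "\<forall>i. orbit_thin (A i)")
      case True
      then show ?thesis using orbit_thin_UN[of UNIV A] by auto
    next
      case False
      then obtain i where i: "\<not> orbit_thin (A i)" by auto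
      then have "\<not> orbit_thin (\<Union>i. A i)" using orbit_thin_subset[of "\<Union>i. A i" "A i"] by blast
      moreover have "?\<mu> (A i) \<le> (\<Sum>i. ?\<mu> (A i))"
        using sum_le_suminf[of "\<lambda>i. ?\<mu> (A i)" "{i}"] by simp
      ultimately show ?thesis using i by (simp add: top_unique)
    qed
  qed
  then show ?thesis unfolding thin_measure_def
    using emeasure_measure_of_sigma[OF sa pos] assms by blast
qed

text \<open>The sets \<open>\<Gamma>\<^sub>\<delta>(x)\<close> need not be Borel, so the witnesses are compact subsets of them.\<close>

lemma not_measure_expansiveI:
  assumes "\<And>\<delta>. \<delta> > 0 \<Longrightarrow> \<exists>x\<in>X. \<exists>A\<subseteq>Gamma_set X \<phi> \<delta> x. compact A \<and> \<not> orbit_thin A"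
  shows "\<not> measure_expansive X \<phi>"
proof
  assume me: "measure_expansive X \<phi>"
  have "vanishes_along_orbits X \<phi> thin_measure"
    unfolding vanishes_along_orbits_def vanishes_on_def sets_thin_measure
  proof (intro ballI impI)
    fix x A assume "x \<in> X" "A \<in> sets (restrict_space borel X)" "A \<subseteq> flow_orbit \<phi> x"
    moreover from this have "orbit_thin A"
      unfolding orbit_thin_def by (intro exI[of _ "{x}"]) auto
    ultimately show "emeasure thin_measure A = 0" by (simp add: emeasure_thin_measure)
  qed
  moreover have "borel_measure_on X thin_measure"
    by (simp add: borel_measure_on_def sets_thin_measure)
  ultimately have "expansive_measure X \<phi> thin_measure"
    using me by (auto simp: measure_expansive_def)
  then obtain \<delta> where \<delta>: "\<delta> > 0" "\<And>x. x \<in> X \<Longrightarrow> vanishes_on thin_measure (Gamma_set X \<phi> \<delta> x)"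
    unfolding expansive_measure_def by auto
  obtain x A where xA: "x \<in> X" "A \<subseteq> Gamma_set X \<phi> \<delta> x" "compact A" "\<not> orbit_thin A"
    using assms[OF \<delta>(1)] by auto
  have "A \<in> sets (restrict_space borel X)"
  proof -
    have "A \<in> sets borel" using xA(3) by (simp add: borel_closed compact_imp_closed)
    moreover have "A \<subseteq> X" using xA(2) by (auto simp: Gamma_set_def)
    moreover have "X \<in> sets borel" using compact_X by (simp add: borel_closed compact_imp_closed)
    ultimately show ?thesis by (simp add: sets_restrict_space_iff)
  qed
  then have "emeasure thin_measure A = 0" "emeasure thin_measure A = \<infinity>"
    using \<delta>(2)[OF xA(1)] xA emeasure_thin_measure
    unfolding vanishes_on_def sets_thin_measure by auto
  then show False by simp
qed

section \<open>Invariance of domain on a surface\<close>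

lemma surface_chart:
  assumes "x \<in> X"
  obtains U V \<psi> \<psi>' where "openin (top_of_set X) U" "x \<in> U" "open (V :: (real^2) set)"
    "homeomorphism U V \<psi> \<psi>'"
  using surface assms unfolding closed_surface_def homeomorphic_def by blast

text \<open>Composing with charts reduces this and the next lemma to Brouwer's theorem in the plane.\<close>

lemma invariance_of_domain_into_surface:
  fixes f :: "real \<times> real \<Rightarrow> 'a"
  assumes W: "open W" and f: "continuous_on W f" "inj_on f W" "f ` W \<subseteq> X"
  shows "openin (top_of_set X) (f ` W)"
proof (subst openin_subopen, intro ballI)
  fix y assume "y \<in> f ` W"
  then obtain w where w: "w \<in> W" "y = f w" by auto
  then have "y \<in> X" using f(3) by auto
  then obtain U V \<psi> \<psi>' where U: "openin (top_of_set X) U" "y \<in> U" "open (V :: (real^2) set)"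
    "homeomorphism U V \<psi> \<psi>'" by (rule surface_chart)
  define W' where "W' = W \<inter> f -` U"
  have "openin (top_of_set W) W'"
    unfolding W'_def by (rule continuous_openin_preimage[OF f(1) _ U(1)]) (use f(3) in auto)
  then have oW': "open W'" using W openin_open_trans by blast
  have fW': "f ` W' \<subseteq> U" by (auto simp: W'_def)
  have "continuous_on W' (\<psi> \<circ> f)"
    by (rule continuous_on_compose)
       (use f(1) U(4) fW' in \<open>auto simp: W'_def homeomorphism_def intro: continuous_on_subset\<close>)
  moreover have "inj_on (\<psi> \<circ> f) W'"
  proof (rule comp_inj_on)
    show "inj_on f W'" using f(2) by (auto simp: W'_def intro: inj_on_subset)
    show "inj_on \<psi> (f ` W')"
      using fW' U(4) by (intro inj_on_inverseI[of _ \<psi>']) (auto simp: homeomorphism_def)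
  qed
  ultimately have "open ((\<psi> \<circ> f) ` W')"
    using invariance_of_domain_gen[of W' "\<psi> \<circ> f"] oW' by simp
  then have "openin (top_of_set V) (\<psi> ` f ` W')"
    using U(4) fW' by (auto simp: openin_open image_comp homeomorphism_def
        intro!: exI[of _ "(\<psi> \<circ> f) ` W'"])
  then have "openin (top_of_set U) (U \<inter> \<psi> -` (\<psi> ` f ` W'))"
    by (rule continuous_openin_preimage[rotated 2]) (use U(4) in \<open>auto simp: homeomorphism_def\<close>)
  moreover have "U \<inter> \<psi> -` (\<psi> ` f ` W') = f ` W'"
  proof
    show "U \<inter> \<psi> -` (\<psi> ` f ` W') \<subseteq> f ` W'"
    proof
      fix a assume "a \<in> U \<inter> \<psi> -` (\<psi> ` f ` W')"
      then obtain b where "a \<in> U" "b \<in> f ` W'" "\<psi> a = \<psi> b" by blast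
      then show "a \<in> f ` W'" using homeomorphism_apply1[OF U(4)] fW' by (metis subsetD)
    qed
  qed (use fW' in blast)
  ultimately have "openin (top_of_set X) (f ` W')" using U(1) openin_trans by metis
  then show "\<exists>T. openin (top_of_set X) T \<and> y \<in> T \<and> T \<subseteq> f ` W"
    using w U(2) by (intro exI[of _ "f ` W'"]) (auto simp: W'_def)
qed

lemma invariance_of_domain_from_surface:
  fixes g :: "'a \<Rightarrow> real \<times> real"
  assumes O: "openin (top_of_set X) O'" and g: "continuous_on O' g" "inj_on g O'"
  shows "open (g ` O')"
proof (subst open_subopen, intro ballI)
  fix z assume "z \<in> g ` O'"
  then obtain y where y: "y \<in> O'" "z = g y" by auto
  then have "y \<in> X" using O openin_imp_subset by blast
  then obtain U V \<psi> \<psi>' where U: "openin (top_of_set X) U" "y \<in> U" "open (V :: (real^2) set)"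
    "homeomorphism U V \<psi> \<psi>'" by (rule surface_chart)
  define N where "N = U \<inter> O'"
  have "openin (top_of_set U) N"
    unfolding N_def using O U(1) by (meson openin_Int openin_imp_subset openin_subset_trans inf_le1)
  then have "openin (top_of_set V) (\<psi> ` N)"
    using U(4) by (metis homeomorphism_imp_open_map)
  then have o: "open (\<psi> ` N)" using U(3) openin_open_trans by blast
  have "\<psi>' ` \<psi> ` N = id ` N"
    unfolding image_image by (rule image_cong) (use U(4) in \<open>auto simp: N_def homeomorphism_def\<close>)
  then have eq: "\<psi>' ` \<psi> ` N = N" by simp
  have "continuous_on (\<psi> ` N) (g \<circ> \<psi>')"
  proof (rule continuous_on_compose)
    have "\<psi> ` N \<subseteq> V" using U(4) by (auto simp: N_def homeomorphism_def)
    then show "continuous_on (\<psi> ` N) \<psi>'" using U(4) continuous_on_subset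
      by (auto simp: homeomorphism_def)
    show "continuous_on (\<psi>' ` \<psi> ` N) g"
      unfolding eq using g(1) by (rule continuous_on_subset) (auto simp: N_def)
  qed
  moreover have "inj_on (g \<circ> \<psi>') (\<psi> ` N)"
    using U(4) g(2) by (auto simp: N_def inj_on_def homeomorphism_def)
  ultimately have "open ((g \<circ> \<psi>') ` \<psi> ` N)"
    using invariance_of_domain_gen[of "\<psi> ` N" "g \<circ> \<psi>'"] o by simp
  then have "open (g ` N)" using eq by (metis image_comp)
  then show "\<exists>T. open T \<and> z \<in> T \<and> T \<subseteq> g ` O'"
    using y U(2) by (intro exI[of _ "g ` N"]) (auto simp: N_def)
qed

lemma surface_locally_path_connected:
  assumes O: "openin (top_of_set X) O'" and x: "x \<in> O'"
  obtains D where "openin (top_of_set X) D" "x \<in> D" "D \<subseteq> O'" "path_connected D"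
proof -
  have "x \<in> X" using O x openin_imp_subset by blast
  then obtain U V \<psi> \<psi>' where U: "openin (top_of_set X) U" "x \<in> U" "open (V :: (real^2) set)"
    "homeomorphism U V \<psi> \<psi>'" by (rule surface_chart)
  have "openin (top_of_set U) (U \<inter> O')"
    using O U(1) by (meson openin_Int openin_imp_subset openin_subset_trans inf_le1)
  then have "openin (top_of_set V) (\<psi> ` (U \<inter> O'))"
    using U(4) by (metis homeomorphism_imp_open_map)
  then have "open (\<psi> ` (U \<inter> O'))" using U(3) openin_open_trans by blast
  moreover have "\<psi> x \<in> \<psi> ` (U \<inter> O')" using x U by auto
  ultimately obtain r where r: "r > 0" "ball (\<psi> x) r \<subseteq> \<psi> ` (U \<inter> O')"
    using openE by blast
  define D where "D = \<psi>' ` ball (\<psi> x) r"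
  have rV: "ball (\<psi> x) r \<subseteq> V" using r U(4) by (auto simp: homeomorphism_def)
  have "openin (top_of_set V) (ball (\<psi> x) r)" using rV by (simp add: openin_open_eq U(3))
  then have "openin (top_of_set U) D" unfolding D_def
    using U(4) homeomorphism_imp_open_map homeomorphism_symD by metis
  then have 1: "openin (top_of_set X) D" using U(1) openin_trans by blast
  have 2: "x \<in> D" unfolding D_def using U r(1) by (auto simp: homeomorphism_def image_iff intro!: bexI[of _ "\<psi> x"])
  have 3: "D \<subseteq> O'" unfolding D_def using r(2) U(4) by (force simp: homeomorphism_def)
  have 4: "path_connected D" unfolding D_def
    by (rule path_connected_continuous_image)
       (use U(4) rV in \<open>auto simp: homeomorphism_def intro: continuous_on_subset convex_imp_path_connected\<close>)
  from 1 2 3 4 show ?thesis by (rule that)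
qed

section \<open>Fixed points\<close>

text \<open>Sending \<open>\<gamma> s\<close> to the point \<open>(s, 0)\<close> would map an open piece of the surface injectively onto an open
  subset of the plane that lies on a line.\<close>

lemma arc_image_no_interior:
  fixes \<gamma> :: "real \<Rightarrow> 'a"
  assumes \<gamma>: "continuous_on {a..b} \<gamma>" "inj_on \<gamma> {a..b}"
    and O: "openin (top_of_set X) O'" "O' \<subseteq> \<gamma> ` {a..b}"
  shows "O' = {}"
proof (rule ccontr)
  assume ne: "O' \<noteq> {}"
  define g where "g = inv_into {a..b} \<gamma>"
  have "continuous_on (\<gamma> ` {a..b}) g"
    unfolding g_def by (rule continuous_on_inv) (use \<gamma> in auto)
  then have c: "continuous_on O' (\<lambda>y. (g y, 0::real))"
    using O(2) by (auto intro!: continuous_intros intro: continuous_on_subset)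
  have "inj_on g (\<gamma> ` {a..b})" unfolding g_def by (rule inj_on_inv_into) auto
  from inj_on_subset[OF this O(2)] have "inj_on (\<lambda>y. (g y, 0::real)) O'" by (auto simp: inj_on_def)
  then have "open ((\<lambda>y. (g y, 0::real)) ` O')"
    by (rule invariance_of_domain_from_surface[OF O(1) c])
  then have "open (snd ` (\<lambda>y. (g y, 0::real)) ` O')" by (rule open_image_snd)
  moreover have "snd ` (\<lambda>y. (g y, 0::real)) ` O' = {0}" using ne by force
  ultimately have "open {0::real}" by metis
  then show False using not_open_singleton by blast
qed

lemma flow_eq_imp_period:
  assumes "x \<in> X" "\<phi> s x = \<phi> t x" shows "\<phi> (t - s) x = x"
  using flow_shift_eq[OF assms(1) assms(1) assms(2), of "-s"] assms(1) by simp

text \<open>Cut at times closer together than the least period, the orbit falls into injective arcs.\<close>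

lemma orbit_countable_arcs:
  assumes x: "x \<in> X"
  obtains \<K> where "countable \<K>" "flow_orbit \<phi> x \<subseteq> \<Union>\<K>"
    "\<And>K. K \<in> \<K> \<Longrightarrow> closedin (top_of_set X) K \<and> top_of_set X interior_of K = {}"
proof (cases "fixed x")
  case True
  have 1: "flow_orbit \<phi> x \<subseteq> \<Union>{{x}}" using True by (auto simp: flow_orbit_def fixed_def)
  have "top_of_set X interior_of {x} = {}"
    by (rule arc_image_no_interior[of 0 0 "\<lambda>_. x"])
       (use interior_of_subset[of "top_of_set X" "{x}"] in auto)
  moreover have "closedin (top_of_set X) {x}" using x by (simp add: closedin_closed_eq closed_subset)
  ultimately show ?thesis using 1 by (intro that[of "{{x}}"]) auto
next
  case False
  then obtain e where e: "e > 0" "\<And>t. \<phi> t x = x \<Longrightarrow> 0 < t \<Longrightarrow> t \<ge> e"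
    using fixed_if_small_periods[OF x] by (meson not_less)
  define I where "I k = {of_int k * (e/2) .. (of_int k + 1) * (e/2)}" for k :: int
  have inj: "inj_on (\<lambda>t. \<phi> t x) (I k)" for k
  proof (rule linorder_inj_onI')
    fix s t assume st: "s \<in> I k" "t \<in> I k" "s < t"
    show "\<phi> s x \<noteq> \<phi> t x"
    proof
      assume "\<phi> s x = \<phi> t x"
      then have "t - s \<ge> e" using flow_eq_imp_period[OF x] e(2) st(3) by simp
      then show False using st(1,2) e(1) by (simp add: I_def field_simps)
    qed
  qed
  have cont: "continuous_on (I k) (\<lambda>t. \<phi> t x)" for k using x by (auto intro!: continuous_intros)
  let ?\<K> = "range (\<lambda>k. (\<lambda>t. \<phi> t x) ` I k)"
  show ?thesis
  proof (rule that[of ?\<K>])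
    show "flow_orbit \<phi> x \<subseteq> \<Union>?\<K>"
    proof
      fix y assume "y \<in> flow_orbit \<phi> x"
      then obtain t where t: "y = \<phi> t x" by (auto simp: flow_orbit_def)
      have "t \<in> I \<lfloor>t / (e/2)\<rfloor>"
        using floor_divide_lower[of "e/2" t] floor_divide_upper[of "e/2" t] e(1) by (simp add: I_def)
      then show "y \<in> \<Union>?\<K>" using t by blast
    qed
    fix K assume "K \<in> ?\<K>"
    then obtain k where K: "K = (\<lambda>t. \<phi> t x) ` I k" by auto
    have "compact K" unfolding K by (rule compact_continuous_image[OF cont]) (simp add: I_def)
    then have "closedin (top_of_set X) K"
      using x by (auto simp: K intro!: closed_subset compact_imp_closed)
    moreover have "top_of_set X interior_of K = {}"
      using arc_image_no_interior[OF cont[of k, unfolded I_def] inj[of k, unfolded I_def]]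
        interior_of_subset[of "top_of_set X" K] K
      by (metis I_def openin_interior_of)
    ultimately show "closedin (top_of_set X) K \<and> top_of_set X interior_of K = {}" by simp
  qed simp
qed

lemma not_orbit_thin_open:
  assumes "openin (top_of_set X) O'" "O' \<noteq> {}"
  shows "\<not> orbit_thin O'"
proof
  assume "orbit_thin O'"
  then obtain D where D: "D \<subseteq> X" "countable D" "O' \<subseteq> (\<Union>x\<in>D. flow_orbit \<phi> x)"
    unfolding orbit_thin_def by auto
  have "\<forall>x\<in>D. \<exists>\<K>. countable \<K> \<and> flow_orbit \<phi> x \<subseteq> \<Union>\<K> \<and>
    (\<forall>K\<in>\<K>. closedin (top_of_set X) K \<and> top_of_set X interior_of K = {})"
    using D(1) orbit_countable_arcs by (metis subsetD)
  then obtain \<K> where \<K>: "\<And>x. x \<in> D \<Longrightarrow> countable (\<K> x)" "\<And>x. x \<in> D \<Longrightarrow> flow_orbit \<phi> x \<subseteq> \<Union>(\<K> x)"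
    "\<And>x K. x \<in> D \<Longrightarrow> K \<in> \<K> x \<Longrightarrow> closedin (top_of_set X) K \<and> top_of_set X interior_of K = {}"
    by metis
  have "compact_space (top_of_set X)" using compact_X by (simp add: compact_space_subtopology)
  moreover have "regular_space (top_of_set X)"
    by (simp add: metrizable_imp_regular_space metrizable_space_subtopology metrizable_space_euclidean)
  ultimately have "top_of_set X interior_of \<Union>(\<Union>x\<in>D. \<K> x) = {}"
    by (intro Baire_category_alt) (use \<K> D(2) in \<open>auto simp: compact_imp_locally_compact_space\<close>)
  moreover have "O' \<subseteq> \<Union>(\<Union>x\<in>D. \<K> x)" using D(3) \<K>(2) by blast
  ultimately show False using assms interior_of_maximal by blast
qed

lemma not_measure_expansive_if_fixed_point:
  assumes "fixed p" shows "\<not> measure_expansive X \<phi>"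
proof (rule not_measure_expansiveI)
  fix \<delta> :: real assume \<delta>: "\<delta> > 0"
  have p: "p \<in> X" "\<And>t. \<phi> t p = p" using assms by (auto simp: fixed_def)
  have "openin (top_of_set X) (X \<inter> ball p \<delta>)" by auto
  then have "\<not> orbit_thin (X \<inter> ball p \<delta>)" by (rule not_orbit_thin_open) (use p \<delta> in auto)
  then have "\<not> orbit_thin (X \<inter> cball p \<delta>)"
    using orbit_thin_subset[of "X \<inter> cball p \<delta>" "X \<inter> ball p \<delta>"] ball_subset_cball[of p \<delta>] by blast
  moreover have "X \<inter> cball p \<delta> \<subseteq> Gamma_set X \<phi> \<delta> p"
    unfolding Gamma_set_def reparams_def
    using p by (auto intro!: bexI[of _ "\<lambda>_. 0"] exI[of _ "\<lambda>_. 0"])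
  moreover have "compact (X \<inter> cball p \<delta>)" using compact_X by (simp add: compact_Int_closed)
  ultimately show "\<exists>x\<in>X. \<exists>A\<subseteq>Gamma_set X \<phi> \<delta> x. compact A \<and> \<not> orbit_thin A"
    using p(1) by blast
qed

section \<open>Cross-sections and flow boxes\<close>

text \<open>Let \<open>g\<close> be the integral of the distance to \<open>x\<close> along an orbit piece of duration \<open>\<tau>\<close>, where \<open>\<phi> \<tau> x \<noteq> x\<close>.
  Moving along the flow changes \<open>g\<close> at the rate at which the distance at the end of the piece
  exceeds the distance at its beginning, and near \<open>x\<close> this is positive.\<close>

lemma increasing_function_near:
  assumes x: "x \<in> X" and nf: "\<not> fixed x"
  obtains g :: "'a \<Rightarrow> real" and e r where "e > 0" "r > 0" "continuous_on X g"
    "\<And>y. y \<in> X \<Longrightarrow> dist x y < r \<Longrightarrow> strict_mono_on {-e..e} (\<lambda>t. g (\<phi> t y))"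
proof -
  obtain \<tau> where \<tau>: "\<tau> > 0" "\<phi> \<tau> x \<noteq> x"
  proof -
    obtain t where t: "\<phi> t x \<noteq> x" using x nf by (auto simp: fixed_def)
    then have "t \<noteq> 0" using x by auto
    moreover have "\<phi> (- t) x \<noteq> x" using period_uminus[OF x, of "-t"] t by auto
    ultimately show ?thesis using t that[of t] that[of "-t"] by (cases "t > 0") auto
  qed
  define c where "c = dist (\<phi> \<tau> x) x / 3"
  have c: "c > 0" using \<tau> by (simp add: c_def)
  define g where "g y = integral {0..\<tau>} (\<lambda>s. dist (\<phi> s y) x)" for y
  have g: "continuous_on X g"
  proof -
    have "continuous_on (X \<times> {0..\<tau>}) (\<lambda>z. dist (\<phi> (snd z) (fst z)) x)"
      by (intro continuous_intros) auto
    then have "continuous_on (X \<times> cbox 0 \<tau>) (\<lambda>(y, s). dist (\<phi> s y) x)"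
      by (simp add: case_prod_unfold)
    from integral_continuous_on_param[OF this] show ?thesis by (simp add: g_def[abs_def])
  qed
  \<comment> \<open>on a neighbourhood, the integrand at the far end beats the one at the near end\<close>
  define u where "u z = dist (\<phi> (snd z + \<tau>) (fst z)) x - dist (\<phi> (snd z) (fst z)) x" for z
  have "continuous_on (X \<times> UNIV) u" unfolding u_def by (intro continuous_intros) auto
  then have "openin (top_of_set (X \<times> UNIV)) ((X \<times> UNIV) \<inter> u -` {c<..})"
    by (rule continuous_openin_preimage_gen) auto
  moreover have "(x, 0) \<in> (X \<times> UNIV) \<inter> u -` {c<..}" using x c by (simp add: u_def c_def)
  ultimately obtain \<rho> where \<rho>: "\<rho> > 0" "ball (x, 0) \<rho> \<inter> (X \<times> UNIV) \<subseteq> (X \<times> UNIV) \<inter> u -` {c<..}"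
    unfolding openin_contains_ball by blast
  have diff: "g (\<phi> t' y) - g (\<phi> t y) > 0"
    if y: "y \<in> X" "dist x y < \<rho>/2" and t: "t < t'" "\<bar>t\<bar> \<le> \<rho>/4" "\<bar>t'\<bar> \<le> \<rho>/4" for y t t'
  proof -
    define f where "f s = dist (\<phi> s y) x" for s
    have fc: "continuous_on S f" for S unfolding f_def using y by (intro continuous_intros) auto
    have fi: "f integrable_on {a..b}" for a b by (rule integrable_continuous_real[OF fc])
    have g_eq: "g (\<phi> s y) = integral {s..s+\<tau>} f" for s
    proof -
      have "g (\<phi> s y) = integral {0..\<tau>} (f \<circ> (+) s)"
        unfolding g_def f_def o_def using y by (simp add: add.commute)
      then show ?thesis by (simp add: integral_shift_Icc_real add.commute)
    qed
    define h where "h s = f (s + \<tau>) - f s" for s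
    have hc: "continuous_on S h" for S unfolding h_def
      by (intro continuous_intros continuous_on_compose2[OF fc[of UNIV]]) auto
    have "integral {t..t'} (\<lambda>s. c) \<le> integral {t..t'} h"
    proof (rule integral_le)
      fix s assume s: "s \<in> {t..t'}"
      have "dist (x, 0) (y, s) \<le> dist x y + dist 0 s" using sqrt_sum_squares_le_sum_abs[of "dist x y" s] by (simp add: dist_Pair_Pair)
      also have "\<dots> < \<rho>" using y(2) s t by (auto simp: dist_real_def)
      finally have "(y, s) \<in> ball (x, 0) \<rho> \<inter> (X \<times> UNIV)" using y by simp
      then have "u (y, s) > c" using \<rho>(2) by blast
      then show "c \<le> h s" by (simp add: u_def h_def f_def add.commute)
    qed (auto intro!: integrable_continuous_real hc)
    moreover have "integral {t..t'} h = integral {t+\<tau>..t'+\<tau>} f - integral {t..t'} f"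
    proof -
      have "(\<lambda>s. f (s + \<tau>)) integrable_on {t..t'}"
        by (intro integrable_continuous_real continuous_on_compose2[OF fc[of UNIV]] continuous_intros) auto
      then have "integral {t..t'} h = integral {t..t'} (\<lambda>s. f (s + \<tau>)) - integral {t..t'} f"
        unfolding h_def using fi by (rule Henstock_Kurzweil_Integration.integral_diff)
      then show ?thesis using integral_shift_Icc_real[of t t' f \<tau>] by (simp add: o_def add.commute)
    qed
    moreover have "integral {t+\<tau>..t'+\<tau>} f - integral {t..t'} f = integral {t'..t'+\<tau>} f - integral {t..t+\<tau>} f"
    proof -
      have "integral {t..t'} f + integral {t'..t'+\<tau>} f = integral {t..t'+\<tau>} f"
        by (rule Henstock_Kurzweil_Integration.integral_combine) (use t \<tau> fi in auto)
      moreover have "integral {t..t+\<tau>} f + integral {t+\<tau>..t'+\<tau>} f = integral {t..t'+\<tau>} f"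
        by (rule Henstock_Kurzweil_Integration.integral_combine) (use t \<tau> fi in auto)
      ultimately show ?thesis by simp
    qed
    moreover have "integral {t..t'} (\<lambda>s. c) > 0" using t c by simp
    ultimately show ?thesis unfolding g_eq by linarith
  qed
  show ?thesis
    by (rule that[of "\<rho>/4" "\<rho>/2" g])
       (use \<rho>(1) g diff in \<open>auto intro!: strict_mono_onI\<close>)
qed

text \<open>The orbit segments of duration \<open>[-e, e]\<close> through the points of \<open>S\<close> are disjoint arcs.\<close>

definition transverse :: "'a set \<Rightarrow> real \<Rightarrow> bool"
  where "transverse S e \<longleftrightarrow> S \<subseteq> X \<and> e > 0 \<and>
    (\<forall>z\<in>S. \<forall>z'\<in>S. \<forall>s s'. \<bar>s\<bar> \<le> e \<longrightarrow> \<bar>s'\<bar> \<le> e \<longrightarrow> \<phi> s z = \<phi> s' z' \<longrightarrow> s = s')"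

lemma transverseD:
  assumes "transverse S e" "z \<in> S" "z' \<in> S" "\<phi> s z = \<phi> s' z'" "\<bar>s\<bar> \<le> e" "\<bar>s'\<bar> \<le> e"
  shows "s = s'" "z = z'"
proof -
  show "s = s'" using assms unfolding transverse_def by blast
  have X: "z \<in> X" "z' \<in> X" using assms(1-3) by (auto simp: transverse_def)
  have "\<phi> (s + - s) z = \<phi> (s' + - s) z'" by (rule flow_shift_eq[OF X assms(4)])
  with X \<open>s = s'\<close> show "z = z'" by simp
qed

text \<open>The function \<open>t\<close> is the time that a point of \<open>N\<close> needs to flow to \<open>S\<close>.\<close>

definition section_projection :: "'a set \<Rightarrow> real \<Rightarrow> 'a set \<Rightarrow> ('a \<Rightarrow> real) \<Rightarrow> bool"
  where "section_projection S e N t \<longleftrightarrow> openin (top_of_set X) N \<and> continuous_on N t \<and>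
    (\<forall>y\<in>N. \<bar>t y\<bar> < e \<and> \<phi> (t y) y \<in> S)"

text \<open>The level set through \<open>x\<close> of a function that increases along the flow is a cross-section.
  The time at which an orbit crosses it is found by the intermediate value theorem, and
  depends continuously on the starting point by monotonicity.\<close>

lemma local_section:
  assumes x: "x \<in> X" and nf: "\<not> fixed x"
  obtains S e N t where "transverse S e" "section_projection S e N t" "x \<in> S" "x \<in> N"
proof -
  obtain g :: "'a \<Rightarrow> real" and e0 r where g: "e0 > 0" "r > 0" "continuous_on X g"
    "\<And>y. y \<in> X \<Longrightarrow> dist x y < r \<Longrightarrow> strict_mono_on {-e0..e0} (\<lambda>t. g (\<phi> t y))"
    using increasing_function_near[OF x nf] by metis
  \<comment> \<open>orbits that start near \<open>x\<close> stay in the ball of radius \<open>r\<close> for a short time\<close>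
  have nb: "openin (top_of_set (X \<times> UNIV)) {z \<in> X \<times> UNIV. \<phi> (snd z) (fst z) \<in> ball x r}"
  proof -
    have "openin (top_of_set (X \<times> UNIV)) ((X \<times> UNIV) \<inter> (\<lambda>z. \<phi> (snd z) (fst z)) -` ball x r)"
      by (rule continuous_openin_preimage_gen) (auto intro!: continuous_intros)
    moreover have "(X \<times> UNIV) \<inter> (\<lambda>z. \<phi> (snd z) (fst z)) -` ball x r =
        {z \<in> X \<times> UNIV. \<phi> (snd z) (fst z) \<in> ball x r}" by auto
    ultimately show ?thesis by simp
  qed
  moreover have "(x, 0) \<in> {z \<in> X \<times> UNIV. \<phi> (snd z) (fst z) \<in> ball x r}" using x g(2) by simp
  ultimately obtain \<rho> where \<rho>: "\<rho> > 0"
    "ball (x, 0) \<rho> \<inter> (X \<times> UNIV) \<subseteq> {z \<in> X \<times> UNIV. \<phi> (snd z) (fst z) \<in> ball x r}"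
    unfolding openin_contains_ball by blast
  \<comment> \<open>orbit pieces of duration \<open>[-e, e]\<close> from the ball of radius \<open>r1\<close> stay where \<open>g\<close> increases along the flow\<close>
  define r1 where "r1 = \<rho>/2"
  define e where "e = min e0 (\<rho>/4)"
  have e: "e > 0" "e \<le> e0" using g(1) \<rho>(1) by (auto simp: e_def)
  have r1: "r1 > 0" using \<rho>(1) by (simp add: r1_def)
  have stay: "dist x (\<phi> s y) < r" if "y \<in> X" "dist x y < r1" "\<bar>s\<bar> \<le> e" for y s
  proof -
    have "dist (x, 0) (y, s) \<le> dist x y + \<bar>s\<bar>"
      using sqrt_sum_squares_le_sum_abs[of "dist x y" s] by (simp add: dist_Pair_Pair)
    also have "\<dots> < \<rho>" using that by (auto simp: r1_def e_def)
    finally have "(y, s) \<in> ball (x, 0) \<rho> \<inter> (X \<times> UNIV)" using that by simp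
    then show ?thesis using \<rho>(2) by auto
  qed
  have inj: "s = s'" if "y \<in> X" "dist x y < r" "\<bar>s\<bar> \<le> e" "\<bar>s'\<bar> \<le> e" "g (\<phi> s y) = g (\<phi> s' y)" for y s s'
  proof -
    have "inj_on (\<lambda>t. g (\<phi> t y)) {-e0..e0}"
      by (rule strict_mono_on_imp_inj_on) (use g(4) that in auto)
    then show ?thesis by (rule inj_onD) (use that e in auto)
  qed
  define S where "S = {z \<in> X. dist x z < r1 \<and> g z = g x}"
  have tr: "transverse S e"
    unfolding transverse_def
  proof (intro conjI ballI allI impI)
    fix z z' s s' assume z: "z \<in> S" "z' \<in> S" "\<bar>s\<bar> \<le> e" "\<bar>s'\<bar> \<le> e" "\<phi> s z = \<phi> s' z'"
    then have X: "z \<in> X" "z' \<in> X" by (auto simp: S_def)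
    have eq: "\<phi> (-s) (\<phi> s z) = z" "\<phi> (-s') (\<phi> s z) = z'"
      using X by (simp, simp add: z(5))
    have "g (\<phi> (-s) (\<phi> s z)) = g (\<phi> (-s') (\<phi> s z))"
      unfolding eq using z by (simp add: S_def)
    moreover have "dist x (\<phi> s z) < r" by (rule stay) (use z in \<open>auto simp: S_def\<close>)
    ultimately have "- s = - s'" using inj[of "\<phi> s z" "-s" "-s'"] z(3,4) X(1) by simp
    then show "s = s'" by simp
  qed (use e in \<open>auto simp: S_def\<close>)
  \<comment> \<open>the orbits that cross the level of \<open>x\<close> during \<open>[-e, e]\<close>\<close>
  define N0 where "N0 = {y \<in> X. dist x y < r \<and> g (\<phi> (-e) y) < g x \<and> g x < g (\<phi> e y)}"
  have gf: "continuous_on X (\<lambda>y. g (\<phi> s y))" for s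
    by (rule continuous_on_compose2[OF g(3)]) (auto intro!: continuous_intros)
  have oN0: "openin (top_of_set X) N0"
  proof -
    have "openin (top_of_set X) (X \<inter> (\<lambda>y. g (\<phi> (-e) y)) -` {..<g x})"
      by (rule continuous_openin_preimage_gen[OF gf]) simp
    moreover have "openin (top_of_set X) (X \<inter> (\<lambda>y. g (\<phi> e y)) -` {g x<..})"
      by (rule continuous_openin_preimage_gen[OF gf]) simp
    moreover have "openin (top_of_set X) (X \<inter> ball x r)" by auto
    ultimately have "openin (top_of_set X) ((X \<inter> (\<lambda>y. g (\<phi> (-e) y)) -` {..<g x}) \<inter>
      (X \<inter> (\<lambda>y. g (\<phi> e y)) -` {g x<..}) \<inter> (X \<inter> ball x r))" by blast
    moreover have "(X \<inter> (\<lambda>y. g (\<phi> (-e) y)) -` {..<g x}) \<inter>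
      (X \<inter> (\<lambda>y. g (\<phi> e y)) -` {g x<..}) \<inter> (X \<inter> ball x r) = N0" by (auto simp: N0_def)
    ultimately show ?thesis by simp
  qed
  have xN0: "x \<in> N0"
  proof -
    have "strict_mono_on {-e0..e0} (\<lambda>t. g (\<phi> t x))" by (rule g(4)) (use x g(2) in auto)
    then have "g (\<phi> (-e) x) < g (\<phi> 0 x)" "g (\<phi> 0 x) < g (\<phi> e x)"
      using e by (auto elim!: strict_mono_onD)
    then show ?thesis using x g(2) by (simp add: N0_def)
  qed
  have "\<forall>y\<in>N0. \<exists>s. \<bar>s\<bar> < e \<and> g (\<phi> s y) = g x"
  proof
    fix y assume y: "y \<in> N0"
    have "\<exists>s\<ge>-e. s \<le> e \<and> g (\<phi> s y) = g x"
      by (rule IVT') (use y e in \<open>auto simp: N0_def intro!: continuous_on_compose2[OF g(3)] continuous_intros\<close>)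
    then obtain s where s: "-e \<le> s" "s \<le> e" "g (\<phi> s y) = g x" by auto
    then have "s \<noteq> e" "s \<noteq> -e" using y by (auto simp: N0_def)
    then show "\<exists>s. \<bar>s\<bar> < e \<and> g (\<phi> s y) = g x" using s by (intro exI[of _ s]) auto
  qed
  then obtain t where t: "\<And>y. y \<in> N0 \<Longrightarrow> \<bar>t y\<bar> < e" "\<And>y. y \<in> N0 \<Longrightarrow> g (\<phi> (t y) y) = g x" by metis
  have gmono: "g (\<phi> s y) < g (\<phi> s' y) \<longleftrightarrow> s < s'"
    if "y \<in> N0" "\<bar>s\<bar> \<le> e" "\<bar>s'\<bar> \<le> e" for y s s'
    by (rule strict_mono_on_less[OF g(4)]) (use that e in \<open>auto simp: N0_def\<close>)
  have N0X: "N0 \<subseteq> X" by (auto simp: N0_def)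
  have ct: "continuous_on N0 t"
    unfolding continuous_on_def
  proof (intro ballI order_tendstoI)
    fix a l assume a: "a \<in> N0"
    have lim: "((\<lambda>y. g (\<phi> s y)) \<longlongrightarrow> g (\<phi> s a)) (at a within N0)" for s
      using continuous_on_subset[OF gf N0X] a by (auto simp: continuous_on_def)
    have near: "eventually (\<lambda>y. y \<in> N0) (at a within N0)" by (simp add: eventually_at_filter)
    show "eventually (\<lambda>y. l < t y) (at a within N0)" if "l < t a"
    proof -
      define s where "s = max l (-e)"
      have s: "\<bar>s\<bar> \<le> e" "s < t a" using that t(1)[OF a] by (auto simp: s_def max_def)
      then have "g (\<phi> s a) < g x" using gmono[OF a, of s "t a"] t[OF a] by simp
      then have "eventually (\<lambda>y. g (\<phi> s y) < g x) (at a within N0)" by (rule order_tendstoD(2)[OF lim])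
      with near show ?thesis
      proof eventually_elim
        case (elim y)
        then have "s < t y" using gmono[of y s "t y"] t[of y] s by simp
        then show ?case by (simp add: s_def)
      qed
    qed
    show "eventually (\<lambda>y. t y < l) (at a within N0)" if "t a < l"
    proof -
      define s where "s = min l e"
      have s: "\<bar>s\<bar> \<le> e" "t a < s" using that t(1)[OF a] by (auto simp: s_def min_def)
      then have "g x < g (\<phi> s a)" using gmono[OF a, of "t a" s] t[OF a] by simp
      then have "eventually (\<lambda>y. g x < g (\<phi> s y)) (at a within N0)" by (rule order_tendstoD(1)[OF lim])
      with near show ?thesis
      proof eventually_elim
        case (elim y)
        then have "t y < s" using gmono[of y "t y" s] t[of y] s by simp
        then show ?case by (simp add: s_def)
      qed
    qed
  qed
  define N where "N = {y \<in> N0. dist x (\<phi> (t y) y) < r1}"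
  have "openin (top_of_set N0) (N0 \<inter> (\<lambda>y. \<phi> (t y) y) -` ball x r1)"
    by (rule continuous_openin_preimage_gen) (use ct N0X in \<open>auto intro!: continuous_intros\<close>)
  moreover have "N0 \<inter> (\<lambda>y. \<phi> (t y) y) -` ball x r1 = N" by (auto simp: N_def)
  ultimately have oN: "openin (top_of_set X) N" using oN0 openin_trans by metis
  have tx: "t x = 0" using inj[of x "t x" 0] t[OF xN0] x g(2) e by simp
  show ?thesis
  proof (rule that[OF tr])
    show "section_projection S e N t"
      unfolding section_projection_def
      using oN ct t N0X by (auto simp: N_def S_def intro: continuous_on_subset)
  qed (use x r1 xN0 tx in \<open>auto simp: S_def N_def\<close>)
qed

lemma flow_rectangle_open:
  fixes \<gamma> :: "real \<Rightarrow> 'a"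
  assumes \<gamma>: "continuous_on {a..b} \<gamma>" "\<gamma> ` {a..b} \<subseteq> X"
    and inj: "inj_on (\<lambda>(s, t). \<phi> t (\<gamma> s)) ({a..b} \<times> {-e..e})"
    and W: "open W" "W \<subseteq> {a..b} \<times> {-e..e}"
  shows "openin (top_of_set X) ((\<lambda>(s, t). \<phi> t (\<gamma> s)) ` W)"
proof (rule invariance_of_domain_into_surface[OF W(1)])
  have "continuous_on ({a..b} \<times> {-e..e}) (\<lambda>z. \<phi> (snd z) (\<gamma> (fst z)))"
    by (intro continuous_intros continuous_on_compose2[OF \<gamma>(1)])
       (use \<gamma>(2) in \<open>auto simp: image_subset_iff\<close>)
  then show "continuous_on W (\<lambda>(s, t). \<phi> t (\<gamma> s))"
    using W(2) continuous_on_subset by (fastforce simp: case_prod_unfold)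
  show "inj_on (\<lambda>(s, t). \<phi> t (\<gamma> s)) W" using inj W(2) inj_on_subset by blast
  show "(\<lambda>(s, t). \<phi> t (\<gamma> s)) ` W \<subseteq> X" using W(2) \<gamma>(2) by fastforce
qed

lemma transverse_arc_inj:
  fixes \<gamma> :: "real \<Rightarrow> 'a"
  assumes S: "transverse S e" and \<gamma>: "inj_on \<gamma> {a..b}" "\<gamma> ` {a..b} \<subseteq> S"
  shows "inj_on (\<lambda>(s, t). \<phi> t (\<gamma> s)) ({a..b} \<times> {-e..e})"
proof (rule inj_onI, clarify)
  fix s t s' t' assume *: "s \<in> {a..b}" "t \<in> {-e..e}" "s' \<in> {a..b}" "t' \<in> {-e..e}"
    "\<phi> t (\<gamma> s) = \<phi> t' (\<gamma> s')"
  then have "\<gamma> s \<in> S" "\<gamma> s' \<in> S" "\<bar>t\<bar> \<le> e" "\<bar>t'\<bar> \<le> e" using \<gamma>(2) by auto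
  then have "t = t'" "\<gamma> s = \<gamma> s'" using transverseD[OF S _ _ *(5)] by blast+
  then show "s = s' \<and> t = t'" using inj_onD[OF \<gamma>(1)] * by auto
qed

text \<open>If the cross-section near \<open>x\<close> were contained in an arc that ends at \<open>x\<close>, the coordinates along the arc
  and along the flow would map a neighbourhood of \<open>x\<close> onto an open subset of the plane that stays
  on one side of a line and meets it. The case \<open>a = b\<close> says that \<open>x\<close> is not isolated in the
  cross-section.\<close>

lemma section_not_in_half_arc:
  fixes \<gamma> :: "real \<Rightarrow> 'a"
  assumes S: "transverse S e" and N: "section_projection S e N t" and D: "openin (top_of_set X) D" "D \<subseteq> N"
    and \<gamma>: "continuous_on {a..b} \<gamma>" "inj_on \<gamma> {a..b}" "a \<le> b" 
    and x: "x \<in> D" "\<phi> (t x) x = \<gamma> a"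
  shows "\<not> (\<lambda>y. \<phi> (t y) y) ` D \<subseteq> \<gamma> ` {a..b}"
proof
  assume sub: "(\<lambda>y. \<phi> (t y) y) ` D \<subseteq> \<gamma> ` {a..b}"
  have DX: "D \<subseteq> X" using D(1) openin_imp_subset by blast
  have ct: "continuous_on D t" using N D(2) by (auto simp: section_projection_def intro: continuous_on_subset)
  define g where "g = inv_into {a..b} \<gamma>"
  have gc: "continuous_on (\<gamma> ` {a..b}) g"
    unfolding g_def by (rule continuous_on_inv) (use \<gamma> in auto)
  have ginj: "inj_on g (\<gamma> ` {a..b})" unfolding g_def by (rule inj_on_inv_into) auto
  let ?k = "\<lambda>y. (g (\<phi> (t y) y), t y)"
  have "continuous_on D ?k"
    by (intro continuous_intros continuous_on_compose2[OF gc] ct) (use sub DX in auto)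
  moreover have "inj_on ?k D"
  proof (rule inj_onI)
    fix y z assume yz: "y \<in> D" "z \<in> D" "?k y = ?k z"
    then have "\<phi> (t y) y \<in> \<gamma> ` {a..b}" "\<phi> (t z) z \<in> \<gamma> ` {a..b}" using sub by auto
    then have "\<phi> (t y) y = \<phi> (t z) z" using inj_onD[OF ginj] yz(3) by blast
    then have "\<phi> (t y + - t y) y = \<phi> (t z + - t y) z" using flow_shift_eq yz DX by blast
    moreover have "y \<in> X" "z \<in> X" using yz DX by auto
    ultimately show "y = z" using yz by simp
  qed
  ultimately have "open (?k ` D)" by (rule invariance_of_domain_from_surface[OF D(1)])
  then have "open (fst ` ?k ` D)" by (rule open_image_fst)
  moreover have "fst ` ?k ` D = g ` (\<lambda>y. \<phi> (t y) y) ` D" by (simp add: image_image)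
  moreover have "a \<in> g ` (\<lambda>y. \<phi> (t y) y) ` D"
    using x \<gamma> by (force simp: g_def image_iff intro!: bexI[of _ x])
  ultimately obtain d where d: "d > 0" "ball a d \<subseteq> g ` (\<lambda>y. \<phi> (t y) y) ` D"
    using openE by metis
  moreover have "g ` (\<lambda>y. \<phi> (t y) y) ` D \<subseteq> {a..b}"
  proof -
    have "g z \<in> {a..b}" if "z \<in> \<gamma> ` {a..b}" for z unfolding g_def by (rule inv_into_into[OF that])
    then show ?thesis using sub by blast
  qed
  ultimately have "a - d/2 \<in> {a..b}" by (auto simp: subset_iff dist_real_def)
  then show False using d(1) by simp
qed

text \<open>The chart reduces this to the existence of arcs in path connected subsets of the plane.\<close>

lemma arc_in_chart:
  assumes U: "homeomorphism U (V :: (real^2) set) \<psi> \<psi>'"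
    and A: "A \<subseteq> U" "path_connected A" "a \<in> A" "b \<in> A" "a \<noteq> b"
  obtains g where "arc g" "path_image g \<subseteq> A" "pathstart g = a" "pathfinish g = b"
proof -
  have inv: "\<psi>' (\<psi> y) = y" if "y \<in> A" for y using U that A(1) by (auto simp: homeomorphism_def)
  have AV: "\<psi> ` A \<subseteq> V" using A(1) U by (auto simp: homeomorphism_def)
  have "path_connected (\<psi> ` A)"
    by (rule path_connected_continuous_image)
       (use U A in \<open>auto simp: homeomorphism_def intro: continuous_on_subset\<close>)
  moreover have "\<psi> a \<noteq> \<psi> b" using inv A by metis
  ultimately obtain g where g: "arc g" "path_image g \<subseteq> \<psi> ` A" "pathstart g = \<psi> a" "pathfinish g = \<psi> b"
    unfolding path_connected_arcwise using A by blast
  have gV: "path_image g \<subseteq> V" using g(2) AV by blast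
  have "arc (\<psi>' \<circ> g)"
    unfolding arc_def
  proof
    show "path (\<psi>' \<circ> g)"
      by (rule path_continuous_image)
         (use g(1) U gV in \<open>auto simp: arc_def homeomorphism_def intro: continuous_on_subset\<close>)
    show "inj_on (\<psi>' \<circ> g) {0..1}"
    proof (rule comp_inj_on)
      show "inj_on g {0..1}" using g(1) by (simp add: arc_def)
      show "inj_on \<psi>' (g ` {0..1})"
        by (rule inj_on_inverseI[of _ \<psi>]) (use U gV in \<open>auto simp: homeomorphism_def path_image_def\<close>)
    qed
  qed
  moreover have "path_image (\<psi>' \<circ> g) \<subseteq> A"
    unfolding path_image_compose using g(2) inv by fastforce
  moreover have "pathstart (\<psi>' \<circ> g) = a" "pathfinish (\<psi>' \<circ> g) = b"
    using g A inv by (auto simp: pathstart_compose pathfinish_compose)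
  ultimately show ?thesis by (rule that)
qed

text \<open>The curve \<open>\<sigma>\<close> is an arc across the flow, parametrized by \<open>[-1, 1]\<close>.\<close>

definition flow_box :: "(real \<Rightarrow> 'a) \<Rightarrow> real \<Rightarrow> bool"
  where "flow_box \<sigma> e \<longleftrightarrow> 0 < e \<and> continuous_on {-1..1} \<sigma> \<and> \<sigma> ` {-1..1} \<subseteq> X \<and>
    inj_on (\<lambda>(s, t). \<phi> t (\<sigma> s)) ({-1..1} \<times> {-e..e})"

text \<open>A cross-section is locally path connected, because it is a projection of a surface, so
  it contains an arc from \<open>x\<close> to another point. This arc does not fill a neighbourhood of \<open>x\<close> in the
  cross-section, so a second arc comes in to \<open>x\<close> from elsewhere. By invariance of domain the
  interior of the first arc is open in the cross-section, so the second arc cannot reach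
  the first one before \<open>x\<close>, and both together form an arc through \<open>x\<close>.\<close>

lemma flow_box_exists:
  assumes x: "x \<in> X" and nf: "\<not> fixed x"
  obtains \<sigma> e where "flow_box \<sigma> e" "\<sigma> 0 = x"
proof -
  obtain S e N t where S: "transverse S e" and N: "section_projection S e N t" and xS: "x \<in> S" "x \<in> N"
    using local_section[OF x nf] by metis
  obtain U V \<psi> \<psi>' where U: "openin (top_of_set X) U" "x \<in> U" "open (V :: (real^2) set)"
    "homeomorphism U V \<psi> \<psi>'" using x by (rule surface_chart)
  define P where "P y = \<phi> (t y) y" for y
  have NX: "N \<subseteq> X" and oN: "openin (top_of_set X) N"
    using N openin_imp_subset by (auto simp: section_projection_def)
  have e: "e > 0" "S \<subseteq> X" using S by (auto simp: transverse_def)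
  have PS: "P ` N \<subseteq> S" using N by (auto simp: P_def section_projection_def)
  have Px: "P x = x"
  proof -
    have "\<phi> (t x) x \<in> S" "\<bar>t x\<bar> < e" using N xS by (auto simp: section_projection_def)
    then show ?thesis using transverseD(2)[OF S, of "\<phi> (t x) x" x 0 "t x"] xS x e
      by (simp add: P_def)
  qed
  have cP: "continuous_on N P"
    unfolding P_def using N NX by (auto intro!: continuous_intros simp: section_projection_def)
  have pre: "openin (top_of_set X) (N \<inter> P -` B)" if "openin (top_of_set X) B" for B
  proof (rule openin_trans[OF _ oN])
    show "openin (top_of_set N) (N \<inter> P -` B)"
      by (rule continuous_openin_preimage[OF cP _ that]) (use PS e in blast)
  qed
  obtain D1 where D1: "openin (top_of_set X) D1" "x \<in> D1" "D1 \<subseteq> N \<inter> P -` U" "path_connected D1"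
  proof -
    have "x \<in> N \<inter> P -` U" using xS U(2) Px by simp
    then show ?thesis using surface_locally_path_connected[OF pre[OF U(1)]] that by metis
  qed
  have pc: "path_connected (P ` D)" if "D \<subseteq> N" "path_connected D" for D
    by (rule path_connected_continuous_image[OF continuous_on_subset[OF cP that(1)] that(2)])
  have half: "\<not> P ` D \<subseteq> \<gamma> ` {a..b}" if "openin (top_of_set X) D" "D \<subseteq> N" "x \<in> D"
    "continuous_on {a..b} \<gamma>" "inj_on \<gamma> {a..b}" "a \<le> b" "\<gamma> a = x" for D and \<gamma> :: "real \<Rightarrow> 'a" and a b
  proof -
    have "\<phi> (t x) x = \<gamma> a" using Px that(7) by (simp add: P_def)
    from section_not_in_half_arc[OF S N that(1,2,4,5,6,3) this] show ?thesis unfolding P_def .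
  qed
  have "\<not> P ` D1 \<subseteq> (\<lambda>_. x) ` {0..0::real}" by (rule half) (use D1 in auto)
  then obtain q where q: "q \<in> P ` D1" "q \<noteq> x" by auto
  obtain g1 where g1: "arc g1" "path_image g1 \<subseteq> P ` D1" "pathstart g1 = x" "pathfinish g1 = q"
    using arc_in_chart[OF U(4), of "P ` D1" x q] pc[of D1] D1 q Px
    by (smt (verit, best) Int_iff imageI image_subset_iff subset_iff vimage_eq)
  have "openin (top_of_set X) (X - {q})"
    by (metis openin_diff closedin_closed_subset finite_imp_closed finite.simps openin_subtopology_self
        openin_delete)
  then have o2: "openin (top_of_set X) ((N \<inter> P -` U) \<inter> (N \<inter> P -` (X - {q})))"
    using pre U(1) by blast
  obtain D2 where D2: "openin (top_of_set X) D2" "x \<in> D2" "D2 \<subseteq> (N \<inter> P -` U) \<inter> (N \<inter> P -` (X - {q}))"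
    "path_connected D2"
  proof -
    have "x \<in> (N \<inter> P -` U) \<inter> (N \<inter> P -` (X - {q}))" using xS U(2) Px q(2) x by simp
    then show ?thesis using surface_locally_path_connected[OF o2] that by metis
  qed
  have c1: "continuous_on {0..1} g1" "inj_on g1 {0..1}" "g1 0 = x" "g1 1 = q"
    using g1 by (auto simp: arc_def path_def pathstart_def pathfinish_def)
  have "\<not> P ` D2 \<subseteq> g1 ` {0..1}" by (rule half) (use D2 c1 in auto)
  then obtain r where r: "r \<in> P ` D2" "r \<notin> path_image g1" by (auto simp: path_image_def)
  have rx: "r \<noteq> x" using r(2) g1(3) pathstart_in_path_image by metis
  have PD2: "P ` D2 \<subseteq> U" "x \<in> P ` D2" using D2 Px by force+
  obtain g2 where g2: "arc g2" "path_image g2 \<subseteq> P ` D2" "pathstart g2 = r" "pathfinish g2 = x"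
    using arc_in_chart[OF U(4) PD2(1) _ r(1) PD2(2) rx] pc[of D2] D2 by auto
  have c2: "continuous_on {0..1} g2" "inj_on g2 {0..1}" "g2 0 = r" "g2 1 = x"
    using g2 by (auto simp: arc_def path_def pathstart_def pathfinish_def)
  have g1S: "g1 ` {0..1} \<subseteq> S" using g1(2) D1(3) PS by (force simp: path_image_def)
  have g2S: "g2 ` {0..1} \<subseteq> S" using g2(2) D2(3) PS by (force simp: path_image_def)
  have g2q: "q \<notin> g2 ` {0..1}" using g2(2) D2(3) by (force simp: path_image_def)
  \<comment> \<open>the times at which the second arc meets the first one; the least of them is its end\<close>
  define H where "H = {s \<in> {0..1}. g2 s \<in> path_image g1}"
  have "H = {0..1} \<inter> g2 -` path_image g1" by (auto simp: H_def)
  then have "closed H"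
    using continuous_closed_preimage[OF c2(1), of "path_image g1"] g1(1)
    by (simp add: arc_imp_path closed_path_image)
  moreover have H1: "1 \<in> H" using c2(4) c1(3) by (auto simp: H_def path_image_def image_iff intro!: bexI[of _ 0])
  moreover have bdd: "bdd_below H" by (rule bdd_belowI[of _ 0]) (auto simp: H_def)
  ultimately have s1H: "Inf H \<in> H" using closed_contains_Inf[of H] by blast
  define s1 where "s1 = Inf H"
  have s1: "s1 \<in> {0..1}" "g2 s1 \<in> path_image g1" using s1H by (auto simp: H_def s1_def)
  have "s1 \<noteq> 0" using s1 r c2 by auto
  then have s1pos: "s1 > 0" using s1 by auto
  obtain v where v: "v \<in> {0..1}" "g2 s1 = g1 v" using s1(2) by (auto simp: path_image_def)
  have "v \<noteq> 1" using g2q c1 v s1 by (metis imageI)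
  have "v = 0"
  proof (rule ccontr)
    assume "v \<noteq> 0"
    define Bx where "Bx = (\<lambda>(s, t). \<phi> t (g1 s)) ` ({0<..<1} \<times> {-e<..<e})"
    have "openin (top_of_set X) Bx"
      unfolding Bx_def
      by (rule flow_rectangle_open[OF c1(1) _ transverse_arc_inj[OF S c1(2) g1S]])
         (use g1S e(2) in \<open>auto intro: open_Times\<close>)
    then have "openin (top_of_set {0..1}) ({0..1} \<inter> g2 -` Bx)"
      using continuous_openin_preimage[OF c2(1)] g2S e by (metis Pi_iff image_subset_iff subset_trans)
    moreover have "s1 \<in> {0..1} \<inter> g2 -` Bx"
    proof -
      have "g1 v = \<phi> 0 (g1 v)" using g1S v(1) e(2) by (auto simp: image_subset_iff subset_iff)
      then have "g1 v \<in> Bx" unfolding Bx_def using v(1) \<open>v \<noteq> 0\<close> \<open>v \<noteq> 1\<close> e(1)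
        by (intro image_eqI[of _ _ "(v, 0)"]) auto
      then show ?thesis using s1 v by simp
    qed
    ultimately obtain d where d: "d > 0" "ball s1 d \<inter> {0..1} \<subseteq> {0..1} \<inter> g2 -` Bx"
      unfolding openin_contains_ball by blast
    define s where "s = max (s1/2) (s1 - d/2)"
    have s: "s < s1" "s \<in> {0..1}" "dist s1 s < d"
      using s1pos d(1) s1 by (auto simp: s_def dist_real_def max_def)
    then have "g2 s \<in> Bx" using d(2) by auto
    then obtain v' t' where v': "v' \<in> {0<..<1}" "t' \<in> {-e<..<e}" "g2 s = \<phi> t' (g1 v')" by (auto simp: Bx_def)
    have "g2 s \<in> X" using g2S s(2) e(2) by blast
    then have "\<phi> 0 (g2 s) = \<phi> t' (g1 v')" by (rule trans[OF flow_0 v'(3)])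
    moreover have "g2 s \<in> S" using g2S s(2) by blast
    moreover have "g1 v' \<in> S" using g1S v'(1) by (force simp: image_subset_iff)
    ultimately have "g2 s = g1 v'"
      using transverseD(2)[OF S, of "g2 s" "g1 v'" 0 t'] v'(2) e(1) by (simp add: abs_le_iff)
    then have "s \<in> H" using s v'(1) by (auto simp: H_def path_image_def)
    then show False using cInf_lower[OF _ bdd, of s] s(1) by (simp add: s1_def)
  qed
  then have "g2 s1 = g2 1" using v c1 c2 by simp
  then have "s1 = 1" using inj_onD[OF c2(2)] s1 by auto
  then have "path_image g2 \<inter> path_image g1 \<subseteq> {pathstart g1}"
    using cInf_lower[OF _ bdd] c2(4) g1(3) unfolding s1_def H_def
    by (fastforce simp: path_image_def)
  then have arc: "arc (g2 +++ g1)" using arc_join[OF g2(1) g1(1)] g2(4) g1(3) by simp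
  define \<sigma> where "\<sigma> s = (g2 +++ g1) ((s + 1) / 2)" for s
  have S\<sigma>: "\<sigma> ` {-1..1} \<subseteq> S"
  proof -
    have "path_image (g2 +++ g1) \<subseteq> S"
      using path_image_join_subset[of g2 g1] g1S g2S by (auto simp: path_image_def)
    then have "(g2 +++ g1) u \<in> S" if "u \<in> {0..1}" for u using that by (auto simp: path_image_def)
    then show ?thesis by (auto simp: \<sigma>_def)
  qed
  have c\<sigma>: "continuous_on {-1..1} \<sigma>"
    unfolding \<sigma>_def
  proof (rule continuous_on_compose2[of "{0..1}" "g2 +++ g1"])
    show "continuous_on {0..1} (g2 +++ g1)" using arc by (simp add: arc_def path_def)
    show "continuous_on {-1..1} (\<lambda>s::real. (s + 1) / 2)" by (intro continuous_intros) auto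
  qed auto
  have i\<sigma>: "inj_on \<sigma> {-1..1}"
  proof (rule inj_onI)
    fix s s' :: real assume "s \<in> {-1..1}" "s' \<in> {-1..1}" "\<sigma> s = \<sigma> s'"
    then have "(s + 1) / 2 = (s' + 1) / 2"
      using arc by (intro inj_onD[of "g2 +++ g1" "{0..1}"]) (auto simp: arc_def \<sigma>_def)
    then show "s = s'" by simp
  qed
  have "inj_on (\<lambda>(s, t). \<phi> t (\<sigma> s)) ({-1..1} \<times> {-e..e})"
    by (rule transverse_arc_inj[OF S i\<sigma> S\<sigma>])
  then have "flow_box \<sigma> e" using S\<sigma> c\<sigma> e by (auto simp: flow_box_def)
  moreover have "\<sigma> 0 = x" using c2(4) by (simp add: \<sigma>_def joinpaths_def)
  ultimately show ?thesis by (rule that)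
qed

lemma flow_boxD:
  assumes "flow_box \<sigma> e"
  shows "e > 0" "continuous_on {-1..1} \<sigma>" "\<And>s. \<bar>s\<bar> \<le> 1 \<Longrightarrow> \<sigma> s \<in> X"
    "\<And>s s' t t'. \<bar>s\<bar> \<le> 1 \<Longrightarrow> \<bar>s'\<bar> \<le> 1 \<Longrightarrow> \<bar>t\<bar> \<le> e \<Longrightarrow> \<bar>t'\<bar> \<le> e \<Longrightarrow>
       \<phi> t (\<sigma> s) = \<phi> t' (\<sigma> s') \<Longrightarrow> s = s' \<and> t = t'"
proof -
  show "e > 0" "continuous_on {-1..1} \<sigma>" using assms by (auto simp: flow_box_def)
  show "\<sigma> s \<in> X" if "\<bar>s\<bar> \<le> 1" for s
    using that assms by (auto simp: flow_box_def abs_le_iff image_subset_iff)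
  show "s = s' \<and> t = t'" if "\<bar>s\<bar> \<le> 1" "\<bar>s'\<bar> \<le> 1" "\<bar>t\<bar> \<le> e" "\<bar>t'\<bar> \<le> e"
    "\<phi> t (\<sigma> s) = \<phi> t' (\<sigma> s')" for s s' t t'
  proof -
    have "inj_on (\<lambda>(s, t). \<phi> t (\<sigma> s)) ({-1..1} \<times> {-e..e})" using assms by (simp add: flow_box_def)
    from inj_onD[OF this, of "(s, t)" "(s', t')"] that show ?thesis by (auto simp: abs_le_iff)
  qed
qed

lemma flow_box_inj0:
  assumes "flow_box \<sigma> e" "\<bar>s\<bar> \<le> 1" "\<bar>s'\<bar> \<le> 1" "\<bar>t\<bar> \<le> e" "\<sigma> s = \<phi> t (\<sigma> s')"
  shows "s = s'" "t = 0"
proof -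
  have "\<phi> 0 (\<sigma> s) = \<phi> t (\<sigma> s')" using assms(5) flow_boxD(3)[OF assms(1,2)] by simp
  then have "s = s' \<and> 0 = t"
    using flow_boxD(4)[OF assms(1-3), of 0 t] flow_boxD(1)[OF assms(1)] assms(4) by simp
  then show "s = s'" "t = 0" by auto
qed

lemma flow_box_open:
  assumes "flow_box \<sigma> e" "open W" "W \<subseteq> {-1..1} \<times> {-e..e}"
  shows "openin (top_of_set X) ((\<lambda>(s, t). \<phi> t (\<sigma> s)) ` W)"
  using assms flow_rectangle_open[of "-1" 1 \<sigma> e W] by (simp add: flow_box_def)

lemma flow_box_smaller:
  assumes "flow_box \<sigma> e" "0 < e'" "e' \<le> e" shows "flow_box \<sigma> e'"
  using assms inj_on_subset[of "\<lambda>(s, t). \<phi> t (\<sigma> s)" "{-1..1} \<times> {-e..e}" "{-1..1} \<times> {-e'..e'}"]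
  by (fastforce simp: flow_box_def)

lemma flow_box_coordinates:
  assumes "flow_box \<sigma> e"
  obtains F R :: "'a \<Rightarrow> real" and B where
    "B = (\<lambda>(s, t). \<phi> t (\<sigma> s)) ` ({-1..1} \<times> {-e..e})" "continuous_on B F" "continuous_on B R"
    "\<And>s t. \<bar>s\<bar> \<le> 1 \<Longrightarrow> \<bar>t\<bar> \<le> e \<Longrightarrow> F (\<phi> t (\<sigma> s)) = s \<and> R (\<phi> t (\<sigma> s)) = t"
proof -
  let ?f = "\<lambda>(s, t). \<phi> t (\<sigma> s)" and ?Q = "{-1..1} \<times> {-e..e}"
  define g where "g = inv_into ?Q ?f"
  have inj: "inj_on ?f ?Q" using assms by (simp add: flow_box_def)
  have "continuous_on ?Q (\<lambda>z. \<phi> (snd z) (\<sigma> (fst z)))"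
  proof (rule continuous_on_flow)
    show "continuous_on ?Q (\<lambda>z. \<sigma> (fst z))"
      by (rule continuous_on_compose2[OF flow_boxD(2)[OF assms]]) (auto intro: continuous_intros)
  qed (use flow_boxD(3)[OF assms] in \<open>auto intro: continuous_intros simp: abs_le_iff\<close>)
  then have c: "continuous_on ?Q ?f" by (simp add: case_prod_unfold)
  have gf: "g (?f z) = z" if "z \<in> ?Q" for z
    unfolding g_def using inv_into_f_f[OF inj that] .
  have "continuous_on (?f ` ?Q) g"
    by (rule continuous_on_inv[OF c]) (use gf in \<open>auto intro: compact_Times\<close>)
  then have "continuous_on (?f ` ?Q) (\<lambda>y. fst (g y))" "continuous_on (?f ` ?Q) (\<lambda>y. snd (g y))"
    by (auto intro: continuous_intros)
  moreover have "fst (g (\<phi> t (\<sigma> s))) = s \<and> snd (g (\<phi> t (\<sigma> s))) = t" if "\<bar>s\<bar> \<le> 1" "\<bar>t\<bar> \<le> e" for s t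
    using gf[of "(s, t)"] that by (auto simp: abs_le_iff)
  ultimately show ?thesis by (rule that[OF refl])
qed

section \<open>Holonomy between cross-sections\<close>

text \<open>By the flow box, visits of one orbit to different points of the cross-section are more than \<open>e\<close> apart in time.\<close>

lemma orbit_section_countable:
  assumes box: "flow_box \<sigma> e" and x: "x \<in> X"
  shows "countable {u. \<bar>u\<bar> \<le> 1 \<and> \<sigma> u \<in> flow_orbit \<phi> x}"
proof -
  let ?A = "{u. \<bar>u\<bar> \<le> 1 \<and> \<sigma> u \<in> flow_orbit \<phi> x}"
  obtain t where t: "\<And>u. u \<in> ?A \<Longrightarrow> \<sigma> u = \<phi> (t u) x"
  proof -
    have "\<forall>u\<in>?A. \<exists>t. \<sigma> u = \<phi> t x" by (auto simp: flow_orbit_def)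
    then show ?thesis using that by metis
  qed
  have "inj_on (\<lambda>u. \<lfloor>t u / e\<rfloor>) ?A"
  proof (rule inj_onI)
    fix u v assume uv: "u \<in> ?A" "v \<in> ?A" "\<lfloor>t u / e\<rfloor> = \<lfloor>t v / e\<rfloor>"
    have e: "e > 0" by (rule flow_boxD(1)[OF box])
    have "\<bar>t u - t v\<bar> \<le> e"
      using floor_divide_lower[OF e, of "t u"] floor_divide_upper[OF e, of "t u"]
        floor_divide_lower[OF e, of "t v"] floor_divide_upper[OF e, of "t v"] uv(3)
      by (simp add: abs_le_iff algebra_simps)
    moreover have "\<sigma> u = \<phi> (t u - t v) (\<sigma> v)" using t[OF uv(1)] t[OF uv(2)] x by simp
    ultimately show "u = v" using flow_box_inj0[OF box] uv by blast
  qed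
  then show ?thesis by (rule countable_image_inj_on[rotated]) simp
qed

lemma section_not_thin:
  assumes box: "flow_box \<sigma> e" and ab: "a < b" "\<bar>a\<bar> \<le> 1" "\<bar>b\<bar> \<le> 1"
  shows "\<not> orbit_thin (\<sigma> ` {a..b})"
proof
  assume "orbit_thin (\<sigma> ` {a..b})"
  then obtain D where D: "D \<subseteq> X" "countable D" "\<sigma> ` {a..b} \<subseteq> (\<Union>x\<in>D. flow_orbit \<phi> x)"
    unfolding orbit_thin_def by auto
  have "{a..b} \<subseteq> (\<Union>x\<in>D. {u. \<bar>u\<bar> \<le> 1 \<and> \<sigma> u \<in> flow_orbit \<phi> x})"
    using D(3) ab by (fastforce simp: abs_le_iff)
  moreover have "countable (\<Union>x\<in>D. {u. \<bar>u\<bar> \<le> 1 \<and> \<sigma> u \<in> flow_orbit \<phi> x})"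
    using D orbit_section_countable[OF box] by (intro countable_UN) auto
  ultimately have "countable {a..b}" by (rule countable_subset)
  then show False using ab(1) uncountable_closed_interval by blast
qed

text \<open>The flow carries the point with parameter \<open>u\<close> on \<open>\<sigma>\<close> in time \<open>T u\<close>, which may be negative, to the
  point with parameter \<open>F u\<close> on \<open>\<sigma>'\<close>.\<close>

definition holonomy :: "(real \<Rightarrow> 'a) \<Rightarrow> (real \<Rightarrow> 'a) \<Rightarrow> real set \<Rightarrow> (real \<Rightarrow> real) \<Rightarrow> (real \<Rightarrow> real) \<Rightarrow> bool"
  where "holonomy \<sigma> \<sigma>' C T F \<longleftrightarrow> continuous_on C T \<and> continuous_on C F \<and> inj_on F C \<and>
    (\<forall>u\<in>C. \<bar>u\<bar> \<le> 1 \<and> \<bar>F u\<bar> \<le> 1 \<and> \<sigma>' (F u) = \<phi> (T u) (\<sigma> u))"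

lemma holonomy_subset: "holonomy \<sigma> \<sigma>' C T F \<Longrightarrow> D \<subseteq> C \<Longrightarrow> holonomy \<sigma> \<sigma>' D T F"
  unfolding holonomy_def by (meson continuous_on_subset inj_on_subset subset_iff)

lemma holonomy_id:
  assumes "flow_box \<sigma> e" "\<And>u. u \<in> C \<Longrightarrow> \<bar>u\<bar> \<le> 1" shows "holonomy \<sigma> \<sigma> C (\<lambda>_. 0) (\<lambda>u. u)"
  using flow_boxD(3)[OF assms(1)] assms(2) by (auto simp: holonomy_def)

lemma holonomy_comp:
  assumes box: "flow_box \<sigma> e" and 1: "holonomy \<sigma> \<sigma>' C T F" and 2: "holonomy \<sigma>' \<sigma>'' C' T' F'" and sub: "F ` C \<subseteq> C'"
  shows "holonomy \<sigma> \<sigma>'' C (\<lambda>u. T u + T' (F u)) (\<lambda>u. F' (F u))"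
  unfolding holonomy_def
proof (intro conjI ballI)
  have c: "continuous_on C F" using 1 by (simp add: holonomy_def)
  show "continuous_on C (\<lambda>u. T u + T' (F u))"
    using 1 2 sub by (intro continuous_intros continuous_on_compose2[OF _ c, of C']) (auto simp: holonomy_def)
  show "continuous_on C (\<lambda>u. F' (F u))"
    using 2 sub by (intro continuous_on_compose2[OF _ c, of C']) (auto simp: holonomy_def)
  show "inj_on (\<lambda>u. F' (F u)) C"
    using 1 2 sub comp_inj_on[of F C F'] inj_on_subset[of F' C' "F ` C"] by (auto simp: holonomy_def o_def)
  fix u assume u: "u \<in> C"
  then have "\<sigma> u \<in> X" using 1 flow_boxD(3)[OF box] by (auto simp: holonomy_def)
  moreover have "F u \<in> C'" using u sub by auto
  ultimately show "\<bar>u\<bar> \<le> 1" "\<bar>F' (F u)\<bar> \<le> 1" "\<sigma>'' (F' (F u)) = \<phi> (T u + T' (F u)) (\<sigma> u)"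
    using 1 2 u by (auto simp: holonomy_def add.commute)
qed

lemma holonomy_inv:
  assumes box: "flow_box \<sigma> e" and 1: "holonomy \<sigma> \<sigma>' C T F" and C: "compact C"
  defines "G \<equiv> inv_into C F"
  shows "holonomy \<sigma>' \<sigma> (F ` C) (\<lambda>v. - T (G v)) G"
proof -
  have inj: "inj_on F C" and cF: "continuous_on C F" and cT: "continuous_on C T" using 1 by (auto simp: holonomy_def)
  have G: "G (F u) = u" if "u \<in> C" for u unfolding G_def using inv_into_f_f[OF inj that] .
  have cG: "continuous_on (F ` C) G" by (rule continuous_on_inv[OF cF C]) (use G in auto)
  have "continuous_on (F ` C) (\<lambda>v. - T (G v))"
    by (intro continuous_intros continuous_on_compose2[OF cT cG]) (use G in auto)
  moreover have "inj_on G (F ` C)" unfolding G_def by (rule inj_on_inv_into) simp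
  moreover have "\<sigma> u = \<phi> (- T u) (\<sigma>' (F u))" if "u \<in> C" for u
    using that 1 flow_boxD(3)[OF box] by (auto simp: holonomy_def)
  ultimately show ?thesis using 1 G cG by (auto simp: holonomy_def)
qed

text \<open>Two travel times from one point to a cross-section are equal or differ by more than the height \<open>e'\<close>
  of its flow box. On a connected set the difference cannot jump from \<open>0\<close> to such a value.\<close>

lemma holonomy_unique:
  assumes box: "flow_box \<sigma> e" "flow_box \<sigma>' e'"
    and 1: "holonomy \<sigma> \<sigma>' C T F" and 2: "holonomy \<sigma> \<sigma>' C T' F'"
    and C: "connected C" "c \<in> C" "T c = T' c" and u: "u \<in> C"
  shows "T u = T' u" "F u = F' u"
proof -
  define d where "d u = T u - T' u" for u
  have small: "d v = 0 \<and> F v = F' v" if v: "v \<in> C" "\<bar>d v\<bar> \<le> e'" for v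
  proof -
    have "\<sigma> v \<in> X" using flow_boxD(3)[OF box(1)] 1 v by (auto simp: holonomy_def)
    then have "\<sigma>' (F v) = \<phi> (d v) (\<sigma>' (F' v))" using 1 2 v by (auto simp: holonomy_def d_def)
    then show ?thesis using flow_box_inj0[OF box(2), of "F v" "F' v" "d v"] 1 2 v
      by (auto simp: holonomy_def)
  qed
  have e': "e' > 0" by (rule flow_boxD(1)[OF box(2)])
  have "connected (d ` C)"
    unfolding d_def by (rule connected_continuous_image[OF _ C(1)])
      (use 1 2 in \<open>auto simp: holonomy_def intro!: continuous_intros\<close>)
  then have iv: "x \<in> d ` C" if "a \<in> d ` C" "b \<in> d ` C" "a \<le> x" "x \<le> b" for a b x
    using connectedD_interval that by metis
  have 0: "0 \<in> d ` C" using C by (auto simp: d_def image_iff intro!: bexI[of _ c])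
  have "\<bar>d u\<bar> \<le> e'"
  proof (rule ccontr)
    assume "\<not> \<bar>d u\<bar> \<le> e'"
    then have "e' \<in> d ` C \<or> - e' \<in> d ` C"
      using iv[of 0 "d u" e'] iv[of "d u" 0 "-e'"] 0 u e' by (auto simp: abs_le_iff)
    then obtain v where "v \<in> C" "\<bar>d v\<bar> = e'" using e' by auto
    then show False using small[of v] e' by auto
  qed
  then show "T u = T' u" "F u = F' u" using small[OF u] by (auto simp: d_def)
qed

text \<open>The bounds leave room: a point of the surface sees its cross-section extend by at least \<open>1/2\<close> in
  both directions, and a flow time of \<open>1\<close> corrected by less than \<open>e\<close> is still at least \<open>1/2\<close>.\<close>

definition atlas :: "(real \<Rightarrow> 'a) set \<Rightarrow> bool"
  where "atlas J \<longleftrightarrow> finite J \<and> (\<forall>\<sigma>\<in>J. \<exists>e. flow_box \<sigma> e) \<and>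
    (\<forall>x\<in>X. \<exists>\<sigma>\<in>J. \<exists>e s t. flow_box \<sigma> e \<and> e \<le> 1/4 \<and> \<bar>s\<bar> < 1/2 \<and> \<bar>t\<bar> < e \<and> x = \<phi> t (\<sigma> s))"

lemma atlas_exists:
  assumes nf: "\<And>x. x \<in> X \<Longrightarrow> \<not> fixed x"
  obtains J where "atlas J"
proof -
  have "\<forall>x\<in>X. \<exists>\<sigma> e. flow_box \<sigma> e \<and> e \<le> 1/4 \<and> \<sigma> 0 = x"
  proof
    fix x assume x: "x \<in> X"
    obtain \<sigma> e where s: "flow_box \<sigma> e" "\<sigma> 0 = x" using flow_box_exists[OF x nf[OF x]] by metis
    then have "flow_box \<sigma> (min e (1/4))" using flow_box_smaller flow_boxD(1)[OF s(1)] by simp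
    then show "\<exists>\<sigma> e. flow_box \<sigma> e \<and> e \<le> 1/4 \<and> \<sigma> 0 = x"
      using s(2) by (intro exI[of _ \<sigma>] exI[of _ "min e (1/4)"]) auto
  qed
  then obtain \<sigma> e where se: "\<And>x. x \<in> X \<Longrightarrow> flow_box (\<sigma> x) (e x)" "\<And>x. x \<in> X \<Longrightarrow> e x \<le> 1/4"
    "\<And>x. x \<in> X \<Longrightarrow> \<sigma> x 0 = x" by metis
  define O' where "O' x = (\<lambda>(s, t). \<phi> t (\<sigma> x s)) ` ({-1/2<..<1/2} \<times> {-e x<..<e x})" for x
  have op: "openin (top_of_set X) (O' x)" if "x \<in> X" for x
    unfolding O'_def by (rule flow_box_open[OF se(1)[OF that]]) (auto intro: open_Times)
  have "x \<in> O' x" if "x \<in> X" for x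
    unfolding O'_def using se(1,3)[OF that] flow_boxD(1)[OF se(1)[OF that]] that
    by (intro image_eqI[of _ _ "(0, 0)"]) auto
  then have "X \<subseteq> \<Union>(O' ` X)" by auto
  then obtain \<D> where "\<D> \<subseteq> O' ` X" "finite \<D>" "X \<subseteq> \<Union>\<D>"
    using compact_X[unfolded compact_eq_openin_cover, rule_format, of "O' ` X"] op by blast
  then obtain Y where Y: "Y \<subseteq> X" "finite Y" "X \<subseteq> \<Union>(O' ` Y)"
    using finite_subset_image[of \<D> O' X] by blast
  have "atlas (\<sigma> ` Y)"
    unfolding atlas_def
  proof (intro conjI ballI)
    fix x assume "x \<in> X"
    then obtain y where y: "y \<in> Y" "x \<in> O' y" using Y by auto
    then obtain s t where "\<bar>s\<bar> < 1/2" "\<bar>t\<bar> < e y" "x = \<phi> t (\<sigma> y s)" by (force simp: O'_def)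
    then show "\<exists>\<sigma>\<in>\<sigma> ` Y. \<exists>e s t. flow_box \<sigma> e \<and> e \<le> 1/4 \<and> \<bar>s\<bar> < 1/2 \<and> \<bar>t\<bar> < e \<and> x = \<phi> t (\<sigma> s)"
      using y(1) Y(1) se by blast
  qed (use Y se in auto)
  then show ?thesis by (rule that)
qed

section \<open>Short intervals are stretched\<close>

text \<open>The orbit pieces from \<open>\<sigma> u\<close> of duration \<open>T u\<close>, run through at proportional speeds, stay \<open>\<delta>\<close>-close.\<close>

definition tracks :: "real \<Rightarrow> (real \<Rightarrow> 'a) \<Rightarrow> real set \<Rightarrow> (real \<Rightarrow> real) \<Rightarrow> bool"
  where "tracks \<delta> \<sigma> C T \<longleftrightarrow> (\<forall>u\<in>C. \<forall>v\<in>C. \<forall>\<theta>\<in>{0..1}. dist (\<phi> (\<theta> * T u) (\<sigma> u)) (\<phi> (\<theta> * T v) (\<sigma> v)) \<le> \<delta>)"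

text \<open>One step of the transport of an interval \<open>C\<close>: it moves in the direction \<open>\<tau> = \<plusminus>1\<close> of time to the
  middle half of another cross-section of the atlas.\<close>

definition good_step :: "(real \<Rightarrow> 'a) set \<Rightarrow> real \<Rightarrow> real \<Rightarrow> (real \<Rightarrow> 'a) \<Rightarrow> real set \<Rightarrow> bool"
  where "good_step J \<delta> \<tau> \<sigma> C \<longleftrightarrow> (\<exists>\<sigma>'\<in>J. \<exists>T F. holonomy \<sigma> \<sigma>' C T F \<and>
    (\<forall>u\<in>C. \<bar>F u\<bar> < 1/2 \<and> \<tau> * T u \<ge> 1/2) \<and> tracks \<delta> \<sigma> C T)"

lemma good_step_subset:
  assumes "good_step J \<delta> \<tau> \<sigma> C" and D: "D \<subseteq> C" shows "good_step J \<delta> \<tau> \<sigma> D"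
proof -
  obtain \<sigma>' T F where "\<sigma>' \<in> J" "holonomy \<sigma> \<sigma>' C T F" "\<forall>u\<in>C. \<bar>F u\<bar> < 1/2 \<and> \<tau> * T u \<ge> 1/2" "tracks \<delta> \<sigma> C T"
    using assms(1) unfolding good_step_def by blast
  moreover from this have "holonomy \<sigma> \<sigma>' D T F" using D by (blast intro: holonomy_subset)
  moreover from calculation have "tracks \<delta> \<sigma> D T" using D by (simp add: tracks_def subset_iff)
  ultimately show ?thesis using D unfolding good_step_def
    by (intro bexI[of _ \<sigma>'] exI[of _ T] exI[of _ F]) auto
qed

text \<open>Flow for time \<open>\<tau>\<close>, land in one of the flow boxes, and use its coordinates.\<close>

lemma good_step_local:
  assumes J: "atlas J" "\<sigma> \<in> J" and \<delta>: "\<delta> > 0" and \<tau>: "\<tau> \<in> {1, -1}" and s0: "\<bar>s0\<bar> < 1"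
  obtains \<eta> where "\<eta> > 0" "good_step J \<delta> \<tau> \<sigma> (ball s0 \<eta>)"
proof -
  obtain e where box: "flow_box \<sigma> e" using J by (auto simp: atlas_def)
  note bx = flow_boxD[OF box]
  define y where "y u = \<phi> \<tau> (\<sigma> u)" for u
  have yX: "y u \<in> X" if "\<bar>u\<bar> \<le> 1" for u using bx(3)[OF that] by (simp add: y_def)
  obtain \<sigma>' e' s' t' where b': "\<sigma>' \<in> J" "flow_box \<sigma>' e'" "e' \<le> 1/4" "\<bar>s'\<bar> < 1/2" "\<bar>t'\<bar> < e'" "y s0 = \<phi> t' (\<sigma>' s')"
    using J(1) yX[of s0] s0 unfolding atlas_def by (meson less_imp_le)
  obtain F R :: "'a \<Rightarrow> real" and B where co: "B = (\<lambda>(s, t). \<phi> t (\<sigma>' s)) ` ({-1..1} \<times> {-e'..e'})"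
    "continuous_on B F" "continuous_on B R"
    "\<And>s t. \<bar>s\<bar> \<le> 1 \<Longrightarrow> \<bar>t\<bar> \<le> e' \<Longrightarrow> F (\<phi> t (\<sigma>' s)) = s \<and> R (\<phi> t (\<sigma>' s)) = t"
    by (rule flow_box_coordinates[OF b'(2)]) (rule that)
  define Co where "Co = (\<lambda>(s, t). \<phi> t (\<sigma>' s)) ` ({-1/2<..<1/2} \<times> {-e'<..<e'})"
  have oCo: "openin (top_of_set X) Co" unfolding Co_def
    by (rule flow_box_open[OF b'(2)]) (auto intro: open_Times)
  have CoB: "Co \<subseteq> B" unfolding Co_def co(1) by (rule image_mono) auto
  have Co: "z = \<phi> (R z) (\<sigma>' (F z)) \<and> \<bar>F z\<bar> < 1/2 \<and> \<bar>R z\<bar> < e'" if z: "z \<in> Co" for z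
  proof -
    obtain s t where "s \<in> {-1/2<..<1/2}" "t \<in> {-e'<..<e'}" "z = \<phi> t (\<sigma>' s)" using z by (auto simp: Co_def)
    then have st: "\<bar>s\<bar> < 1/2" "\<bar>t\<bar> < e'" "z = \<phi> t (\<sigma>' s)" by auto
    then show ?thesis using co(4)[of s t] by simp
  qed
  have cy: "continuous_on {-1..1} y"
    unfolding y_def by (rule continuous_on_flow[OF continuous_on_const bx(2)])
      (use bx(3) in \<open>auto simp: abs_le_iff\<close>)
  define W where "W = {-1<..<1} \<inter> y -` Co"
  have cy': "continuous_on {-1<..<1} y" by (rule continuous_on_subset[OF cy]) auto
  have "y \<in> {-1<..<1} \<rightarrow> X" using yX by (auto simp: abs_le_iff)
  then have "openin (top_of_set {-1<..<1}) W"
    unfolding W_def by (rule continuous_openin_preimage[OF cy' _ oCo])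
  then have oW: "open W" by (rule openin_open_trans) simp
  have "y s0 \<in> Co" unfolding Co_def using b' by (intro image_eqI[of _ _ "(s', t')"]) auto
  then have s0W: "s0 \<in> W" using s0 by (simp add: W_def abs_less_iff)
  define T where "T u = \<tau> - R (y u)" for u
  have cyW: "continuous_on W y" by (rule continuous_on_subset[OF cy]) (auto simp: W_def)
  have cT: "continuous_on W T" unfolding T_def
    by (rule continuous_on_diff[OF continuous_on_const continuous_on_compose2[OF co(3) cyW]])
       (use CoB in \<open>auto simp: W_def\<close>)
  have cF: "continuous_on W (\<lambda>u. F (y u))"
    by (rule continuous_on_compose2[OF co(2) cyW]) (use CoB in \<open>auto simp: W_def\<close>)
  have hol: "\<sigma>' (F (y u)) = \<phi> (T u) (\<sigma> u)" "\<bar>F (y u)\<bar> < 1/2" "\<bar>R (y u)\<bar> < e'" "\<bar>u\<bar> \<le> 1" if u: "u \<in> W" for u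
  proof -
    show u1: "\<bar>u\<bar> \<le> 1" using u by (auto simp: W_def)
    have *: "y u = \<phi> (R (y u)) (\<sigma>' (F (y u)))" "\<bar>F (y u)\<bar> < 1/2" "\<bar>R (y u)\<bar> < e'"
      using Co[of "y u"] u by (auto simp: W_def)
    show "\<bar>F (y u)\<bar> < 1/2" "\<bar>R (y u)\<bar> < e'" by (fact *)+
    have X': "\<sigma>' (F (y u)) \<in> X" by (rule flow_boxD(3)[OF b'(2)]) (use *(2) in simp)
    have "\<phi> (- R (y u)) (y u) = \<phi> (- R (y u)) (\<phi> (R (y u)) (\<sigma>' (F (y u))))" using *(1) by simp
    also have "\<dots> = \<sigma>' (F (y u))" using X' by simp
    finally show "\<sigma>' (F (y u)) = \<phi> (T u) (\<sigma> u)" using bx(3)[OF u1] by (simp add: y_def T_def)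
  qed
  \<comment> \<open>travel times vary here by at most \<open>e\<close>, so points with the same image lie on one orbit piece of the flow box\<close>
  have "open ((\<lambda>u. T u) -` ball (T s0) (e/2) \<inter> W)"
    using continuous_open_preimage[OF cT oW, of "ball (T s0) (e/2)"] by (simp add: Int_commute)
  moreover have "s0 \<in> (\<lambda>u. T u) -` ball (T s0) (e/2) \<inter> W" using s0W bx(1) by simp
  ultimately obtain r where r: "r > 0" "cball s0 r \<subseteq> (\<lambda>u. T u) -` ball (T s0) (e/2) \<inter> W"
    using open_contains_cball by blast
  have rW: "cball s0 r \<subseteq> W" using r by auto
  \<comment> \<open>uniform continuity of the orbit pieces gives the closeness that tracking requires\<close>
  define k where "k z = \<phi> (snd z * T (fst z)) (\<sigma> (fst z))" for z
  have "continuous_on (cball s0 r \<times> {0..1}) k"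
    unfolding k_def
  proof (intro continuous_on_flow continuous_on_mult continuous_on_snd continuous_on_id)
    show "continuous_on (cball s0 r \<times> {0..1}) (\<lambda>x. T (fst x))"
      by (rule continuous_on_compose2[OF cT]) (use rW in \<open>auto intro: continuous_intros\<close>)
    show "continuous_on (cball s0 r \<times> {0..1}) (\<lambda>x. \<sigma> (fst x))"
      by (rule continuous_on_compose2[OF bx(2)]) (use rW in \<open>auto intro: continuous_intros simp: W_def\<close>)
    show "(\<lambda>x. \<sigma> (fst x)) ` (cball s0 r \<times> {0..1}) \<subseteq> X"
      using rW hol(4) bx(3) by auto
  qed
  then have "uniformly_continuous_on (cball s0 r \<times> {0..1::real}) k"
    by (intro compact_uniformly_continuous compact_Times) auto
  then obtain d where d: "d > 0" "\<And>z z'. z \<in> cball s0 r \<times> {0..1} \<Longrightarrow> z' \<in> cball s0 r \<times> {0..1} \<Longrightarrow> dist z' z < d \<Longrightarrow> dist (k z') (k z) < \<delta>"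
    unfolding uniformly_continuous_on_def using \<delta> by metis
  define \<eta> where "\<eta> = min r (d/2)"
  have \<eta>: "\<eta> > 0" "ball s0 \<eta> \<subseteq> cball s0 r" using r d by (auto simp: \<eta>_def)
  have bW: "ball s0 \<eta> \<subseteq> W" using \<eta>(2) rW by auto
  have "holonomy \<sigma> \<sigma>' (ball s0 \<eta>) T (\<lambda>u. F (y u))"
    unfolding holonomy_def
  proof (intro conjI ballI)
    show "continuous_on (ball s0 \<eta>) T" "continuous_on (ball s0 \<eta>) (\<lambda>u. F (y u))"
      using cT cF bW continuous_on_subset by blast+
    show "inj_on (\<lambda>u. F (y u)) (ball s0 \<eta>)"
    proof (rule inj_onI)
      fix u v assume uv: "u \<in> ball s0 \<eta>" "v \<in> ball s0 \<eta>" "F (y u) = F (y v)"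
      have W: "u \<in> W" "v \<in> W" using uv bW by auto
      have X: "\<sigma> u \<in> X" "\<sigma> v \<in> X" using hol(4) W bx(3) by auto
      have "\<phi> (T u) (\<sigma> u) = \<phi> (T v) (\<sigma> v)" using hol(1)[OF W(1)] hol(1)[OF W(2)] uv(3) by simp
      then have "\<phi> (T u + - T u) (\<sigma> u) = \<phi> (T v + - T u) (\<sigma> v)" by (rule flow_shift_eq[OF X])
      then have "\<sigma> u = \<phi> (T v - T u) (\<sigma> v)" using X by simp
      moreover have "\<bar>T v - T u\<bar> \<le> e"
      proof -
        have "T u \<in> ball (T s0) (e/2)" "T v \<in> ball (T s0) (e/2)" using r(2) \<eta>(2) uv(1,2) by blast+
        then show ?thesis unfolding mem_ball dist_real_def by linarith
      qed
      ultimately show "u = v" using flow_box_inj0(1)[OF box] hol(4) W by blast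
    qed
  next
    fix u assume "u \<in> ball s0 \<eta>"
    then have "u \<in> W" using bW by auto
    then show "\<bar>u\<bar> \<le> 1" "\<bar>F (y u)\<bar> \<le> 1" "\<sigma>' (F (y u)) = \<phi> (T u) (\<sigma> u)" using hol[of u] by auto
  qed
  moreover have "\<bar>F (y u)\<bar> < 1/2 \<and> \<tau> * T u \<ge> 1/2" if "u \<in> ball s0 \<eta>" for u
  proof -
    have "u \<in> W" using that bW by auto
    then show ?thesis using hol[of u] b'(3) \<tau> by (auto simp: T_def abs_less_iff)
  qed
  moreover have "tracks \<delta> \<sigma> (ball s0 \<eta>) T"
    unfolding tracks_def
  proof (intro ballI)
    fix u v \<theta> :: real assume *: "u \<in> ball s0 \<eta>" "v \<in> ball s0 \<eta>" "\<theta> \<in> {0..1}"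
    have "dist s0 u < d/2" "dist s0 v < d/2" using * by (auto simp: \<eta>_def)
    then have "dist u v < d" unfolding dist_real_def by linarith
    then have "dist (u, \<theta>) (v, \<theta>) < d" by (simp add: dist_Pair_Pair)
    moreover have "(u, \<theta>) \<in> cball s0 r \<times> {0..1}" "(v, \<theta>) \<in> cball s0 r \<times> {0..1}" using * \<eta>(2) by auto
    ultimately have "dist (k (u, \<theta>)) (k (v, \<theta>)) < \<delta>" using d(2) by blast
    then show "dist (\<phi> (\<theta> * T u) (\<sigma> u)) (\<phi> (\<theta> * T v) (\<sigma> v)) \<le> \<delta>" by (simp add: k_def)
  qed
  ultimately have "good_step J \<delta> \<tau> \<sigma> (ball s0 \<eta>)" unfolding good_step_def using b'(1) by blast
  with \<eta>(1) show ?thesis by (rule that)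
qed

text \<open>A Lebesgue number of the covering by the intervals of the previous lemma.\<close>

lemma good_step_uniform:
  assumes J: "atlas J" and \<delta>: "\<delta> > 0"
  obtains \<kappa> where "\<kappa> > 0" "\<kappa> \<le> 1/4"
    "\<And>\<tau> \<sigma> s. \<tau> \<in> {1, -1} \<Longrightarrow> \<sigma> \<in> J \<Longrightarrow> \<bar>s\<bar> \<le> 3/4 \<Longrightarrow> good_step J \<delta> \<tau> \<sigma> (cball s \<kappa>)"
proof -
  have one: "eventually (\<lambda>\<kappa>. \<forall>s\<in>{-3/4..3/4}. good_step J \<delta> (fst p) (snd p) (cball s \<kappa>)) (at_right 0)"
    if p: "p \<in> {1, -1} \<times> J" for p
  proof -
    have "\<forall>s\<in>{-3/4..3/4::real}. \<exists>\<eta>>0. good_step J \<delta> (fst p) (snd p) (ball s \<eta>)"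
    proof
      fix s :: real assume "s \<in> {-3/4..3/4}"
      then have "\<bar>s\<bar> < 1" by auto
      then show "\<exists>\<eta>>0. good_step J \<delta> (fst p) (snd p) (ball s \<eta>)"
        using good_step_local[OF J _ \<delta>, of "snd p" "fst p" s] p
        by (metis SigmaE fst_conv snd_conv)
    qed
    then obtain \<eta> where \<eta>: "\<And>s. s \<in> {-3/4..3/4} \<Longrightarrow> \<eta> s > 0"
      "\<And>s. s \<in> {-3/4..3/4} \<Longrightarrow> good_step J \<delta> (fst p) (snd p) (ball s (\<eta> s))" by metis
    have "{-3/4..3/4} \<subseteq> \<Union>((\<lambda>s. ball s (\<eta> s)) ` {-3/4..3/4})" using \<eta>(1) by force
    then obtain \<rho> where \<rho>: "\<rho> > 0" "\<And>s. s \<in> {-3/4..3/4} \<Longrightarrow> \<exists>G\<in>(\<lambda>s. ball s (\<eta> s)) ` {-3/4..3/4}. ball s \<rho> \<subseteq> G"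
      by (rule Heine_Borel_lemma[rotated]) auto
    show ?thesis
      unfolding eventually_at_right_field
    proof (intro exI[of _ \<rho>] conjI allI impI ballI)
      fix \<kappa> s :: real assume *: "0 < \<kappa>" "\<kappa> < \<rho>" "s \<in> {-3/4..3/4}"
      then obtain s' where s': "s' \<in> {-3/4..3/4}" "ball s \<rho> \<subseteq> ball s' (\<eta> s')" using \<rho>(2)[of s] by auto
      have "cball s \<kappa> \<subseteq> ball s' (\<eta> s')" using s'(2) * by (auto simp: subset_iff)
      then show "good_step J \<delta> (fst p) (snd p) (cball s \<kappa>)" using good_step_subset \<eta>(2)[OF s'(1)] by blast
    qed (rule \<rho>)
  qed
  have "finite ({1, -1::real} \<times> J)" using J by (simp add: atlas_def)
  then have "eventually (\<lambda>\<kappa>. \<forall>p\<in>{1,-1}\<times>J. \<forall>s\<in>{-3/4..3/4}. good_step J \<delta> (fst p) (snd p) (cball s \<kappa>)) (at_right 0)"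
    using one by (intro eventually_ball_finite) auto
  moreover have "eventually (\<lambda>\<kappa>::real. 0 < \<kappa> \<and> \<kappa> < 1/4) (at_right 0)"
    unfolding eventually_at_right_field by (intro exI[of _ "1/4"]) auto
  ultimately have "eventually (\<lambda>\<kappa>. (\<forall>p\<in>{1,-1}\<times>J. \<forall>s\<in>{-3/4..3/4}. good_step J \<delta> (fst p) (snd p) (cball s \<kappa>)) \<and> 0 < \<kappa> \<and> \<kappa> < 1/4) (at_right 0)"
    by eventually_elim auto
  then obtain \<kappa> where "(\<forall>p\<in>{1,-1}\<times>J. \<forall>s\<in>{-3/4..3/4}. good_step J \<delta> (fst p) (snd p) (cball s \<kappa>)) \<and> 0 < \<kappa> \<and> \<kappa> < 1/4"
    using eventually_happens'[OF trivial_limit_at_right_real] by blast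
  then have \<kappa>: "\<kappa> > 0" "\<kappa> \<le> 1/4" and good: "\<And>p s. p \<in> {1,-1}\<times>J \<Longrightarrow> s \<in> {-3/4..3/4} \<Longrightarrow>
    good_step J \<delta> (fst p) (snd p) (cball s \<kappa>)" by auto
  have "good_step J \<delta> \<tau> \<sigma> (cball s \<kappa>)" if "\<tau> \<in> {1, -1}" "\<sigma> \<in> J" "\<bar>s\<bar> \<le> 3/4" for \<tau> \<sigma> s
  proof -
    have "s \<in> {-3/4..3/4}" unfolding atLeastAtMost_iff using that(3) by linarith
    then show ?thesis using good[of "(\<tau>, \<sigma>)" s] that by simp
  qed
  with \<kappa> show ?thesis by (rule that)
qed

text \<open>A flow that is measure-expansive has this property for some \<open>\<delta>\<close>; it will contradict recurrence.\<close>

definition thin_shadowing :: "real \<Rightarrow> bool"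
  where "thin_shadowing \<delta> \<longleftrightarrow> \<delta> > 0 \<and> (\<forall>x\<in>X. \<forall>A\<subseteq>Gamma_set X \<phi> \<delta> x. compact A \<longrightarrow> orbit_thin A)"

text \<open>Iterate good steps along the orbit of \<open>\<sigma> s0\<close>. As long as no image of the interval reaches length \<open>\<kappa>\<close>, the
  next step applies to it, so if this never happens all times in the direction \<open>\<tau>\<close> are reached.\<close>

lemma track_unless_stretched:
  assumes J: "atlas J" and \<sigma>: "\<sigma> \<in> J" and s0: "\<bar>s0\<bar> \<le> 3/4" and y: "\<bar>y\<bar> \<le> 1" "\<bar>y - s0\<bar> \<le> \<kappa>" and \<kappa>: "\<kappa> > 0"
    and step: "\<And>\<sigma> s. \<sigma> \<in> J \<Longrightarrow> \<bar>s\<bar> \<le> 3/4 \<Longrightarrow> good_step J \<delta> \<tau> \<sigma> (cball s \<kappa>)"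
    and no: "\<And>\<sigma>' T F c. \<sigma>' \<in> J \<Longrightarrow> c \<in> closed_segment s0 y \<Longrightarrow> holonomy \<sigma> \<sigma>' (closed_segment s0 c) T F \<Longrightarrow>
      \<bar>F s0\<bar> \<le> 1/2 \<Longrightarrow> \<bar>F c - F s0\<bar> \<noteq> \<kappa>"
  obtains T :: "nat \<Rightarrow> real \<Rightarrow> real" where "\<And>u. T 0 u = 0" "\<And>n. \<tau> * (T (Suc n) s0 - T n s0) \<ge> 1/2"
    "\<And>n u \<theta>. u \<in> closed_segment s0 y \<Longrightarrow> \<theta> \<in> {0..1} \<Longrightarrow>
      dist (\<phi> (T n s0 + \<theta> * (T (Suc n) s0 - T n s0)) (\<sigma> s0)) (\<phi> (T n u + \<theta> * (T (Suc n) u - T n u)) (\<sigma> u)) \<le> \<delta>"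
proof -
  let ?I = "closed_segment s0 y"
  obtain e where box: "flow_box \<sigma> e" using J \<sigma> by (auto simp: atlas_def)
  have I1: "\<bar>u\<bar> \<le> 1" if "u \<in> ?I" for u
    using that s0 y by (auto simp: closed_segment_eq_real_ivl split: if_splits)
  have s0I: "s0 \<in> ?I" by simp
  define ok where "ok st \<longleftrightarrow> (case st of (\<rho>, T, F) \<Rightarrow> \<rho> \<in> J \<and> holonomy \<sigma> \<rho> ?I T F \<and> \<bar>F s0\<bar> \<le> 3/4 \<and> F ` ?I \<subseteq> cball (F s0) \<kappa>)"
    for st :: "(real \<Rightarrow> 'a) \<times> (real \<Rightarrow> real) \<times> (real \<Rightarrow> real)"
  define nxt where "nxt st st' \<longleftrightarrow> (\<tau> * (fst (snd st') s0 - fst (snd st) s0) \<ge> 1/2) \<and>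
    (\<forall>u\<in>?I. \<forall>\<theta>\<in>{0..1}. dist (\<phi> (fst (snd st) s0 + \<theta> * (fst (snd st') s0 - fst (snd st) s0)) (\<sigma> s0))
      (\<phi> (fst (snd st) u + \<theta> * (fst (snd st') u - fst (snd st) u)) (\<sigma> u)) \<le> \<delta>)"
    for st st' :: "(real \<Rightarrow> 'a) \<times> (real \<Rightarrow> real) \<times> (real \<Rightarrow> real)"
  have start: "ok (\<sigma>, \<lambda>_. 0, \<lambda>u. u)"
    unfolding ok_def using holonomy_id[OF box I1] s0 y \<sigma>
    by (auto simp: closed_segment_eq_real_ivl dist_real_def split: if_splits)
  have "\<exists>st'. ok st' \<and> nxt st st'" if ok: "ok st" for st
  proof -
    obtain \<rho> T F where st: "st = (\<rho>, T, F)" by (cases st) auto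
    have 1: "\<rho> \<in> J" "holonomy \<sigma> \<rho> ?I T F" "\<bar>F s0\<bar> \<le> 3/4" "F ` ?I \<subseteq> cball (F s0) \<kappa>"
      using ok by (auto simp: ok_def st)
    obtain \<sigma>' T' F' where 2: "\<sigma>' \<in> J" "holonomy \<rho> \<sigma>' (cball (F s0) \<kappa>) T' F'"
      "\<And>u. u \<in> cball (F s0) \<kappa> \<Longrightarrow> \<bar>F' u\<bar> < 1/2 \<and> \<tau> * T' u \<ge> 1/2" "tracks \<delta> \<rho> (cball (F s0) \<kappa>) T'"
      using step[OF 1(1,3)] unfolding good_step_def by blast
    define T2 where "T2 u = T u + T' (F u)" for u
    define F2 where "F2 u = F' (F u)" for u
    have h2: "holonomy \<sigma> \<sigma>' ?I T2 F2"
      unfolding T2_def F2_def by (rule holonomy_comp[OF box 1(2) 2(2) 1(4)])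
    have Fs0: "F s0 \<in> cball (F s0) \<kappa>" using \<kappa> by simp
    have sub: "F2 ` ?I \<subseteq> cball (F2 s0) \<kappa>"
    proof (rule ccontr)
      assume "\<not> F2 ` ?I \<subseteq> cball (F2 s0) \<kappa>"
      then obtain u where u: "u \<in> ?I" "F2 u \<notin> cball (F2 s0) \<kappa>" by blast
      then have u: "u \<in> ?I" "\<bar>F2 u - F2 s0\<bar> > \<kappa>" by (auto simp: dist_real_def abs_minus_commute)
      have sI: "closed_segment s0 u \<subseteq> ?I" using u(1) by (simp add: subset_closed_segment)
      have "continuous_on (closed_segment s0 u) (\<lambda>u. \<bar>F2 u - F2 s0\<bar>)"
        using h2 sI by (auto simp: holonomy_def intro!: continuous_intros intro: continuous_on_subset)
      then have "closed_segment \<bar>F2 s0 - F2 s0\<bar> \<bar>F2 u - F2 s0\<bar> \<subseteq> (\<lambda>u. \<bar>F2 u - F2 s0\<bar>) ` closed_segment s0 u"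
        by (rule subset_continuous_image_segment_1)
      moreover have "\<kappa> \<in> closed_segment \<bar>F2 s0 - F2 s0\<bar> \<bar>F2 u - F2 s0\<bar>"
        using u \<kappa> by (auto simp: closed_segment_eq_real_ivl)
      ultimately obtain c where c: "c \<in> closed_segment s0 u" "\<kappa> = \<bar>F2 c - F2 s0\<bar>" by blast
      have cI: "c \<in> ?I" using c sI by auto
      have "holonomy \<sigma> \<sigma>' (closed_segment s0 c) T2 F2"
        by (rule holonomy_subset[OF h2]) (use cI in \<open>simp add: subset_closed_segment\<close>)
      moreover have "\<bar>F2 s0\<bar> \<le> 1/2" using 2(3)[OF Fs0] by (simp add: F2_def)
      ultimately show False using no[OF 2(1) cI] c(2) by metis
    qed
    have "ok (\<sigma>', T2, F2)" using 2 h2 sub 2(3)[OF Fs0] by (auto simp: ok_def F2_def)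
    moreover have "nxt st (\<sigma>', T2, F2)"
      unfolding nxt_def st
    proof (simp, intro conjI ballI)
      show "1 \<le> \<tau> * (T2 s0 - T s0) * 2" using 2(3)[OF Fs0] by (simp add: T2_def)
      fix u \<theta> :: real assume u: "u \<in> ?I" "\<theta> \<in> {0..1}"
      have shift: "\<phi> (T v + \<theta> * (T2 v - T v)) (\<sigma> v) = \<phi> (\<theta> * T' (F v)) (\<rho> (F v))" if "v \<in> ?I" for v
      proof -
        have "\<sigma> v \<in> X" using flow_boxD(3)[OF box I1[OF that]] .
        moreover have "\<rho> (F v) = \<phi> (T v) (\<sigma> v)" using 1(2) that by (simp add: holonomy_def)
        ultimately show ?thesis by (simp add: T2_def add.commute)
      qed
      have "F u \<in> cball (F s0) \<kappa>" using 1(4) u by auto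
      then have "dist (\<phi> (\<theta> * T' (F s0)) (\<rho> (F s0))) (\<phi> (\<theta> * T' (F u)) (\<rho> (F u))) \<le> \<delta>"
        using 2(4) u(2) Fs0 unfolding tracks_def by blast
      then show "dist (\<phi> (T s0 + \<theta> * (T2 s0 - T s0)) (\<sigma> s0)) (\<phi> (T u + \<theta> * (T2 u - T u)) (\<sigma> u)) \<le> \<delta>"
        unfolding shift[OF s0I] shift[OF u(1)] .
    qed
    ultimately show ?thesis by blast
  qed
  then have "\<exists>f. \<forall>n. ok (f n) \<and> (n = 0 \<longrightarrow> f n = (\<sigma>, \<lambda>_. 0, \<lambda>u. u)) \<and> nxt (f n) (f (Suc n))"
    using dependent_nat_choice[of "\<lambda>n st. ok st \<and> (n = 0 \<longrightarrow> st = (\<sigma>, \<lambda>_. 0, \<lambda>u. u))" "\<lambda>n. nxt"] start by auto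
  then obtain f where f: "f 0 = (\<sigma>, \<lambda>_. 0, \<lambda>u. u)" "\<And>n. nxt (f n) (f (Suc n))" by metis
  show ?thesis
  proof (rule that[of "\<lambda>n. fst (snd (f n))"])
    show "fst (snd (f 0)) u = 0" for u by (simp add: f)
  qed (use f(2) in \<open>auto simp: nxt_def\<close>)
qed

text \<open>Every interval with an end point \<open>s\<close> in the inner part of a cross-section has a part at that end that
  holonomy maps onto an interval of length \<open>\<kappa>\<close>.\<close>

definition stretching :: "(real \<Rightarrow> 'a) set \<Rightarrow> real \<Rightarrow> bool"
  where "stretching J \<kappa> \<longleftrightarrow> 0 < \<kappa> \<and> \<kappa> \<le> 1/4 \<and>
    (\<forall>\<sigma>\<in>J. \<forall>s y. \<bar>s\<bar> \<le> 3/4 \<longrightarrow> \<bar>y\<bar> \<le> 1 \<longrightarrow> y \<noteq> s \<longrightarrow>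
      (\<exists>\<sigma>'\<in>J. \<exists>T F. \<exists>c\<in>closed_segment s y. holonomy \<sigma> \<sigma>' (closed_segment s c) T F \<and>
        \<bar>F s\<bar> \<le> 1/2 \<and> \<bar>F c - F s\<bar> = \<kappa>))"

text \<open>An interval that is short forever in both directions of time lies in one of the sets \<open>\<Gamma>\<^sub>\<delta>\<close>,
  but is not covered by countably many orbits.\<close>

lemma intervals_stretch:
  assumes thin_shadowing: "thin_shadowing \<delta>" and J: "atlas J"
  obtains \<kappa> where "stretching J \<kappa>"
proof -
  have \<delta>: "\<delta> > 0" using thin_shadowing by (simp add: thin_shadowing_def)
  obtain \<kappa> where \<kappa>: "\<kappa> > 0" "\<kappa> \<le> 1/4"
    "\<And>\<tau> \<sigma> s. \<tau> \<in> {1, -1} \<Longrightarrow> \<sigma> \<in> J \<Longrightarrow> \<bar>s\<bar> \<le> 3/4 \<Longrightarrow> good_step J \<delta> \<tau> \<sigma> (cball s \<kappa>)"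
    using good_step_uniform[OF J \<delta>] by metis
  have "\<exists>\<sigma>'\<in>J. \<exists>T F. \<exists>c\<in>closed_segment s0 y. holonomy \<sigma> \<sigma>' (closed_segment s0 c) T F \<and>
      \<bar>F s0\<bar> \<le> 1/2 \<and> \<bar>F c - F s0\<bar> = \<kappa>"
    if \<sigma>: "\<sigma> \<in> J" and s0: "\<bar>s0\<bar> \<le> 3/4" and y: "\<bar>y\<bar> \<le> 1" "y \<noteq> s0" for \<sigma> s0 y
  proof (rule ccontr)
    assume no: "\<not> ?thesis"
    obtain e where box: "flow_box \<sigma> e" using J \<sigma> by (auto simp: atlas_def)
    \<comment> \<open>the part at \<open>s0\<close> of length at most \<open>\<kappa>\<close>, where the first step applies\<close>
    define z where "z = (if s0 \<le> y then min y (s0 + \<kappa>) else max y (s0 - \<kappa>))"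
    have z: "z \<in> closed_segment s0 y" "\<bar>z - s0\<bar> \<le> \<kappa>" "z \<noteq> s0" "\<bar>z\<bar> \<le> 1"
      using y s0 \<kappa>(1) by (auto simp: z_def closed_segment_eq_real_ivl min_def max_def split: if_splits)
    let ?I = "closed_segment s0 z"
    have sub: "?I \<subseteq> closed_segment s0 y" using z(1) by (simp add: subset_closed_segment)
    have no': "\<bar>F c - F s0\<bar> \<noteq> \<kappa>" if "\<sigma>' \<in> J" "c \<in> ?I" "holonomy \<sigma> \<sigma>' (closed_segment s0 c) T F" "\<bar>F s0\<bar> \<le> 1/2"
      for \<sigma>' T F c using no that sub by blast
    obtain P where P: "\<And>u. P 0 u = 0" "\<And>n. 1 * (P (Suc n) s0 - P n s0) \<ge> 1/2"
      "\<And>n u \<theta>. u \<in> ?I \<Longrightarrow> \<theta> \<in> {0..1} \<Longrightarrow>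
      dist (\<phi> (P n s0 + \<theta> * (P (Suc n) s0 - P n s0)) (\<sigma> s0)) (\<phi> (P n u + \<theta> * (P (Suc n) u - P n u)) (\<sigma> u)) \<le> \<delta>"
      by (rule track_unless_stretched[OF J \<sigma> s0 z(4,2) \<kappa>(1) \<kappa>(3) no', of 1]) auto
    obtain M where M: "\<And>u. M 0 u = 0" "\<And>n. (-1) * (M (Suc n) s0 - M n s0) \<ge> 1/2"
      "\<And>n u \<theta>. u \<in> ?I \<Longrightarrow> \<theta> \<in> {0..1} \<Longrightarrow>
      dist (\<phi> (M n s0 + \<theta> * (M (Suc n) s0 - M n s0)) (\<sigma> s0)) (\<phi> (M n u + \<theta> * (M (Suc n) u - M n u)) (\<sigma> u)) \<le> \<delta>"
      by (rule track_unless_stretched[OF J \<sigma> s0 z(4,2) \<kappa>(1) \<kappa>(3) no', of "-1"]) auto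
    have "\<sigma> u \<in> Gamma_set X \<phi> \<delta> (\<sigma> s0)" if u: "u \<in> ?I" for u
    proof -
      have "\<bar>u\<bar> \<le> 1" using u s0 z(4) by (auto simp: closed_segment_eq_real_ivl split: if_splits)
      then have uX: "\<sigma> u \<in> X" by (rule flow_boxD(3)[OF box])
      obtain h where h: "continuous_on UNIV h" "\<And>t. t \<le> 0 \<Longrightarrow> h t = 0"
        "\<And>t. t \<ge> 0 \<Longrightarrow> \<exists>n. \<exists>\<theta>\<in>{0..1}. t = P n s0 + \<theta> * (P (Suc n) s0 - P n s0) \<and> h t = P n u + \<theta> * (P (Suc n) u - P n u)"
        using piecewise_linear_exists[of "\<lambda>n. P n s0" "\<lambda>n. P n u"] P by auto
      obtain g where g: "continuous_on UNIV g" "\<And>t. t \<le> 0 \<Longrightarrow> g t = 0"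
        "\<And>t. t \<ge> 0 \<Longrightarrow> \<exists>n. \<exists>\<theta>\<in>{0..1}. t = - M n s0 + \<theta> * (- M (Suc n) s0 - - M n s0) \<and> g t = M n u + \<theta> * (M (Suc n) u - M n u)"
        using piecewise_linear_exists[of "\<lambda>n. - M n s0" "\<lambda>n. M n u"] M by auto
      \<comment> \<open>one summand vanishes for \<open>t \<le> 0\<close>, the other one for \<open>t \<ge> 0\<close>\<close>
      define k where "k t = h t + g (- t)" for t
      have "dist (\<phi> t (\<sigma> s0)) (\<phi> (k t) (\<sigma> u)) \<le> \<delta>" for t
      proof (cases "t \<ge> 0")
        case True
        then show ?thesis using h(3)[of t] g(2)[of "-t"] P(3)[OF u] by (auto simp: k_def)
      next
        case False
        then obtain n \<theta> where "\<theta> \<in> {0..1}" "- t = - M n s0 + \<theta> * (- M (Suc n) s0 - - M n s0)" "k t = M n u + \<theta> * (M (Suc n) u - M n u)"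
          using g(3)[of "-t"] h(2)[of t] by (auto simp: k_def)
        moreover from this have "t = M n s0 + \<theta> * (M (Suc n) s0 - M n s0)" by (simp add: algebra_simps)
        ultimately show ?thesis using M(3)[OF u] by metis
      qed
      moreover have "continuous_on UNIV k" unfolding k_def
        by (intro continuous_intros h(1) continuous_on_compose2[OF g(1)]) auto
      moreover have "k 0 = 0" using h(2) g(2) by (simp add: k_def)
      ultimately show ?thesis using uX unfolding Gamma_set_def reparams_def by blast
    qed
    then have "\<sigma> ` ?I \<subseteq> Gamma_set X \<phi> \<delta> (\<sigma> s0)" by blast
    moreover have s0X: "\<sigma> s0 \<in> X" by (rule flow_boxD(3)[OF box]) (use s0 in simp)
    moreover have "compact (\<sigma> ` ?I)"
      by (rule compact_continuous_image[OF continuous_on_subset[OF flow_boxD(2)[OF box]]])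
        (use s0 z in \<open>auto simp: closed_segment_eq_real_ivl split: if_splits\<close>)
    ultimately have "orbit_thin (\<sigma> ` ?I)" using thin_shadowing by (simp add: thin_shadowing_def)
    moreover have "?I = {min s0 z..max s0 z}" by (auto simp: closed_segment_eq_real_ivl)
    moreover have "\<not> orbit_thin (\<sigma> ` {min s0 z..max s0 z})"
      by (rule section_not_thin[OF box]) (use s0 z in auto)
    ultimately show False by simp
  qed
  then have "stretching J \<kappa>" unfolding stretching_def using \<kappa>(1,2) by blast
  then show ?thesis by (rule that)
qed

section \<open>Returning intervals force periodic orbits\<close>

lemma omega_limit_shift:
  assumes x: "x \<in> X" and y: "y \<in> omega_limit X \<phi> x"
  shows "y \<in> omega_limit X \<phi> (\<phi> a x)"
proof -
  obtain t where t: "y \<in> X" "filterlim t at_top sequentially" "(\<lambda>n. \<phi> (t n) x) \<longlonglongrightarrow> y"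
    using y by (auto simp: omega_limit_def)
  have "filterlim (\<lambda>n. - a + t n) at_top sequentially"
    by (rule filterlim_tendsto_add_at_top[OF tendsto_const t(2)])
  moreover have "(\<lambda>n. \<phi> (- a + t n) (\<phi> a x)) \<longlonglongrightarrow> y" using t(3) x by simp
  ultimately show ?thesis using t(1) unfolding omega_limit_def by blast
qed

lemma recurrent_shift:
  assumes x: "x \<in> X" "x \<in> omega_limit X \<phi> x"
  shows "\<phi> a x \<in> omega_limit X \<phi> (\<phi> a x)"
proof -
  obtain t where t: "filterlim t at_top sequentially" "(\<lambda>n. \<phi> (t n) x) \<longlonglongrightarrow> x"
    using x by (auto simp: omega_limit_def)
  have "(\<lambda>n. \<phi> a (\<phi> (t n) x)) \<longlonglongrightarrow> \<phi> a x"
    by (rule tendsto_flow[OF tendsto_const t(2)]) (use x in auto)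
  then have "(\<lambda>n. \<phi> (t n) (\<phi> a x)) \<longlonglongrightarrow> \<phi> a x" using x by (simp add: add.commute)
  then show ?thesis using t(1) x(1) unfolding omega_limit_def by blast
qed

text \<open>If an orbit passes through a convergent sequence of points with bounded waiting times, its limit
  set is contained in the orbit of the limit, which closes up after a limit of the waiting times.\<close>

lemma omega_limit_periodic_if_returns_converge:
  assumes z: "\<And>n. z n \<in> X" "\<And>n. z (Suc n) = \<phi> (\<tau> n) (z n)" "z \<longlonglongrightarrow> zz"
    and \<tau>: "m > 0" "\<And>n. m \<le> \<tau> n" "\<And>n. \<tau> n \<le> M"
    and y: "y \<in> omega_limit X \<phi> (z 0)"
  obtains p where "p > 0" "\<phi> p y = y"
proof -
  have zz: "zz \<in> X" using closed_sequentially[OF compact_imp_closed[OF compact_X]] z by blast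
  define S where "S k = (\<Sum>i<k. \<tau> i)" for k
  have SS: "S (Suc k) = S k + \<tau> k" for k by (simp add: S_def)
  have Sz: "z k = \<phi> (S k) (z 0)" for k
  proof (induction k)
    case (Suc k) then show ?case using z(1)[of 0] z(2)[of k] by (simp add: S_def add.commute)
  qed (use z(1) in \<open>simp add: S_def\<close>)
  have lo: "m * real k \<le> S k" for k
  proof (induction k)
    case (Suc k) then show ?case using \<tau>(2)[of k] unfolding SS by (simp add: algebra_simps)
  qed (simp add: S_def)
  have up: "S k \<le> M * real k" for k
  proof (induction k)
    case (Suc k) then show ?case using \<tau>(3)[of k] unfolding SS by (simp add: algebra_simps)
  qed (simp add: S_def)
  have M: "M > 0" using \<tau>(1) \<tau>(2,3)[of 0] by linarith
  obtain t where t: "filterlim t at_top sequentially" "(\<lambda>n. \<phi> (t n) (z 0)) \<longlonglongrightarrow> y"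
    using y by (auto simp: omega_limit_def)
  have "\<exists>k r. r \<in> {0..M} \<and> (s \<ge> 0 \<longrightarrow> s = S k + r)" for s
  proof (cases "s \<ge> 0")
    case True
    obtain N where "s / m < real N" using reals_Archimedean2 by blast
    then have "s < S N" using lo[of N] \<tau>(1) by (simp add: field_simps)
    moreover have "S 0 \<le> s" using True by (simp add: S_def)
    ultimately obtain k where "S k \<le> s" "s < S (Suc k)" using between_partial_sums by metis
    then show ?thesis using \<tau>(3)[of k] unfolding SS
      by (intro exI[of _ k] exI[of _ "s - S k"]) auto
  qed (use M in \<open>auto intro!: exI[of _ 0]\<close>)
  then obtain k r where kr: "\<And>s. r s \<in> {0..M}" "\<And>s. s \<ge> 0 \<Longrightarrow> s = S (k s) + r s" by metis
  obtain r0 f where f: "strict_mono f" "((\<lambda>n. r (t n)) \<circ> f) \<longlonglongrightarrow> r0"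
    using kr(1) compact_Icc[of 0 M] unfolding compact_def by (metis (no_types, lifting))
  have tf: "filterlim (\<lambda>n. t (f n)) at_top sequentially"
    using filterlim_compose[OF t(1) filterlim_subseq[OF f(1)]] .
  have kf: "filterlim (\<lambda>n. k (t (f n))) at_top sequentially"
    unfolding filterlim_at_top
  proof
    fix Z :: nat
    have "eventually (\<lambda>n. t (f n) \<ge> M * real (Suc Z)) sequentially" using tf by (auto simp: filterlim_at_top)
    then show "eventually (\<lambda>n. Z \<le> k (t (f n))) sequentially"
    proof eventually_elim
      case (elim n)
      have "t (f n) \<ge> 0" using elim M by (smt (verit) mult_nonneg_nonneg of_nat_0_le_iff)
      then have "t (f n) \<le> M * real (k (t (f n))) + M"
        using kr[of "t (f n)"] up[of "k (t (f n))"] by fastforce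
      then have "M * real (Suc Z) \<le> M * real (Suc (k (t (f n))))" using elim by (simp add: algebra_simps)
      then show ?case using M by simp
    qed
  qed
  have "(\<lambda>n. \<phi> (r (t (f n))) (z (k (t (f n))))) \<longlonglongrightarrow> \<phi> r0 zz"
    by (rule tendsto_flow) (use f(2) filterlim_compose[OF z(3) kf] z(1) zz in \<open>auto simp: o_def\<close>)
  moreover have "eventually (\<lambda>n. \<phi> (r (t (f n))) (z (k (t (f n)))) = \<phi> (t (f n)) (z 0)) sequentially"
  proof -
    have "eventually (\<lambda>n. t (f n) \<ge> 0) sequentially" using tf by (auto simp: filterlim_at_top)
    then show ?thesis
    proof eventually_elim
      case (elim n)
      have "\<phi> (r (t (f n))) (z (k (t (f n)))) = \<phi> (S (k (t (f n))) + r (t (f n))) (z 0)"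
        unfolding Sz[of "k (t (f n))"] using z(1) by (simp add: add.commute)
      then show ?case using kr(2)[OF elim] by simp
    qed
  qed
  ultimately have "(\<lambda>n. \<phi> (t (f n)) (z 0)) \<longlonglongrightarrow> \<phi> r0 zz" using tendsto_cong by fastforce
  moreover have "(\<lambda>n. \<phi> (t (f n)) (z 0)) \<longlonglongrightarrow> y"
    using LIMSEQ_subseq_LIMSEQ[OF t(2) f(1)] by (simp add: o_def)
  ultimately have y_eq: "y = \<phi> r0 zz" using LIMSEQ_unique by blast
  obtain p g where g: "strict_mono g" "(\<tau> \<circ> g) \<longlonglongrightarrow> p" "p \<in> {m..M}"
    using \<tau>(2,3) compact_Icc[of m M] unfolding compact_def by (metis atLeastAtMost_iff)
  have "(\<lambda>n. \<phi> (\<tau> (g n)) (z (g n))) \<longlonglongrightarrow> \<phi> p zz"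
    by (rule tendsto_flow) (use g(2) LIMSEQ_subseq_LIMSEQ[OF z(3) g(1)] z(1) zz in \<open>auto simp: o_def\<close>)
  then have "(\<lambda>n. z (Suc (g n))) \<longlonglongrightarrow> \<phi> p zz" using z(2) by simp
  moreover have "(\<lambda>n. z (Suc (g n))) \<longlonglongrightarrow> zz"
    using LIMSEQ_subseq_LIMSEQ[OF LIMSEQ_Suc[OF z(3)] g(1)] by (simp add: o_def)
  ultimately have "\<phi> p zz = zz" using LIMSEQ_unique by blast
  then have "\<phi> r0 (\<phi> p zz) = \<phi> r0 zz" by simp
  then have "\<phi> p y = y" using zz unfolding y_eq by (simp add: add.commute)
  moreover have "p > 0" using g(3) \<tau>(1) by auto
  ultimately show ?thesis using that by blast
qed

lemma eventually_hits_section: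
  assumes box: "flow_box \<sigma> e" and u: "p < u" "u < q" "-1 \<le> p" "q \<le> 1"
    and y: "\<And>n. y n \<in> X" "y \<longlonglongrightarrow> \<sigma> u"
  shows "eventually (\<lambda>n. \<exists>w r. p < w \<and> w < q \<and> \<bar>r\<bar> < e \<and> y n = \<phi> r (\<sigma> w)) sequentially"
proof -
  let ?B = "(\<lambda>(s, t). \<phi> t (\<sigma> s)) ` ({p<..<q} \<times> {-e<..<e})"
  have "openin (top_of_set X) ?B"
    by (rule flow_box_open[OF box]) (use u in \<open>auto intro: open_Times\<close>)
  then obtain B where B: "open B" "?B = X \<inter> B" by (auto simp: openin_open)
  have "\<sigma> u \<in> X" using flow_boxD(3)[OF box] u by simp
  then have "\<sigma> u \<in> ?B" using u flow_boxD(1)[OF box] by (intro image_eqI[of _ _ "(u, 0)"]) auto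
  then have "\<sigma> u \<in> B" using B by blast
  then have "eventually (\<lambda>n. y n \<in> B) sequentially" using topological_tendstoD[OF y(2) B(1)] by blast
  then show ?thesis
  proof eventually_elim
    case (elim n)
    then have "y n \<in> ?B" using B y(1) by blast
    then obtain w r where "p < w" "w < q" "-e < r" "r < e" "y n = \<phi> r (\<sigma> w)" by auto
    then show ?case by (intro exI[of _ w] exI[of _ r]) auto
  qed
qed

text \<open>An increasing map \<open>H\<close> of an interval into itself has monotone orbits, which converge. If \<open>H\<close>
  follows the flow forwards, the iterates of \<open>w\<close> are convergent returns of the orbit of \<open>x\<close>.

  If \<open>H\<close> follows the flow backwards, recurrence gives returns \<open>w'\<close> of \<open>\<sigma> w\<close> to the interval after arbitrarily
  long times. Flowing back from \<open>\<sigma> w'\<close> to \<open>\<sigma> w\<close> goes through many iterates of \<open>H\<close>, so \<open>\<sigma> w\<close> is within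
  bounded time of the image of every power of \<open>H\<close>. By compactness it is within bounded time
  of a point \<open>u\<close> in the intersection \<open>I\<close> of these images. Since \<open>H\<close> maps \<open>I\<close> onto itself, the preimages
  of \<open>u\<close> in \<open>I\<close> are convergent returns of the orbit.\<close>

lemma self_return_periodic:
  assumes box: "flow_box \<sigma> e" and pq: "p < q" "-1 \<le> p" "q \<le> 1"
    and hol: "holonomy \<sigma> \<sigma> {p..q} T H" and into: "H ` {p..q} \<subseteq> {p..q}" and mono: "strict_mono_on {p..q} H"
    and sgn: "(\<forall>u\<in>{p..q}. T u > 0) \<or> (\<forall>u\<in>{p..q}. T u < 0)"
    and x: "x \<in> X" "x \<in> omega_limit X \<phi> x" and w: "p < w" "w < q" "\<sigma> w = \<phi> a x"
  obtains t where "t > 0" "\<phi> t x = x"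
proof -
  have Xs: "\<sigma> u \<in> X" if "u \<in> {p..q}" for u using flow_boxD(3)[OF box] that pq by auto
  have cT: "continuous_on {p..q} T" and cH: "continuous_on {p..q} H"
    and eq: "\<And>u. u \<in> {p..q} \<Longrightarrow> \<sigma> (H u) = \<phi> (T u) (\<sigma> u)"
    using hol by (auto simp: holonomy_def)
  have c\<sigma>: "continuous_on {p..q} \<sigma>" by (rule continuous_on_subset[OF flow_boxD(2)[OF box]]) (use pq in auto)
  have cabs: "continuous_on {p..q} (\<lambda>u. \<bar>T u\<bar>)" using cT by (intro continuous_intros)
  obtain um where um: "um \<in> {p..q}" "\<And>u. u \<in> {p..q} \<Longrightarrow> \<bar>T um\<bar> \<le> \<bar>T u\<bar>"
    using continuous_attains_inf[OF compact_Icc _ cabs] pq by auto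
  obtain uM where uM: "uM \<in> {p..q}" "\<And>u. u \<in> {p..q} \<Longrightarrow> \<bar>T u\<bar> \<le> \<bar>T uM\<bar>"
    using continuous_attains_sup[OF compact_Icc _ cabs] pq by auto
  define m where "m = \<bar>T um\<bar>"
  define M where "M = \<bar>T uM\<bar>"
  have mM: "m > 0" "\<And>u. u \<in> {p..q} \<Longrightarrow> m \<le> \<bar>T u\<bar>" "\<And>u. u \<in> {p..q} \<Longrightarrow> \<bar>T u\<bar> \<le> M"
  proof -
    have "T um \<noteq> 0" using sgn um(1) by fastforce
    then show "m > 0" by (simp add: m_def)
  qed (use um uM in \<open>auto simp: m_def M_def\<close>)
  have conv: "\<exists>t>0. \<phi> t x = x"
    if v: "\<And>n. v n \<in> {p..q}" "monoseq v" and zn: "\<And>n. \<sigma> (v (Suc n)) = \<phi> (\<tau> n) (\<sigma> (v n))"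
      and \<tau>: "\<And>n. m \<le> \<tau> n" "\<And>n. \<tau> n \<le> M" and start: "\<sigma> (v 0) = \<phi> b x" for v \<tau> b
  proof -
    have "Bseq v"
    proof (rule BseqI')
      show "norm (v n) \<le> \<bar>p\<bar> + \<bar>q\<bar>" for n using v(1)[of n] by auto
    qed
    then have "convergent v" using v(2) Bseq_monoseq_convergent by blast
    then obtain l where l: "v \<longlonglongrightarrow> l" by (auto simp: convergent_def)
    have lpq: "l \<in> {p..q}" using closed_sequentially[of "{p..q}" v l] v(1) l by auto
    have "(\<lambda>n. \<sigma> (v n)) \<longlonglongrightarrow> \<sigma> l"
      by (rule continuous_on_tendsto_compose[OF c\<sigma> l lpq]) (use v(1) in auto)
    moreover have "x \<in> omega_limit X \<phi> (\<sigma> (v 0))" unfolding start by (rule omega_limit_shift[OF x])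
    ultimately obtain t where "t > 0" "\<phi> t x = x"
      using omega_limit_periodic_if_returns_converge[of "\<lambda>n. \<sigma> (v n)" \<tau> "\<sigma> l" m M x] Xs v(1) zn mM(1) \<tau> by metis
    then show ?thesis by blast
  qed
  have Hpow: "(H ^^ n) u \<in> {p..q}" if "u \<in> {p..q}" for n u
  proof (induction n)
    case (Suc n)
    then have "H ((H ^^ n) u) \<in> {p..q}" using into by blast
    then show ?case by simp
  qed (use that in simp)
  have le: "H u \<le> H v \<longleftrightarrow> u \<le> v" if "u \<in> {p..q}" "v \<in> {p..q}" for u v
    using strict_mono_on_leD[OF mono] strict_mono_onD[OF mono] that by (meson linorder_not_le)
  show ?thesis
  proof (cases "\<forall>u\<in>{p..q}. T u > 0")
    case True
    define v where "v n = (H ^^ n) w" for n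
    have vE: "v n \<in> {p..q}" for n unfolding v_def by (rule Hpow) (use w in auto)
    have vS: "v (Suc n) = H (v n)" for n by (simp add: v_def)
    have "monoseq v"
    proof (cases "v 0 \<le> v 1")
      case True
      have "v n \<le> v (Suc n)" for n
      proof (induction n)
        case (Suc n) then show ?case using le[OF vE[of n] vE[of "Suc n"]] vS by simp
      qed (use True in simp)
      then show ?thesis by (simp add: monoseq_Suc)
    next
      case False
      have "v (Suc n) \<le> v n" for n
      proof (induction n)
        case (Suc n) then show ?case using le[OF vE[of "Suc n"] vE[of n]] vS by simp
      qed (use False in simp)
      then show ?thesis by (simp add: monoseq_Suc)
    qed
    moreover have "\<sigma> (v (Suc n)) = \<phi> (T (v n)) (\<sigma> (v n))" for n using eq vE vS by simp
    moreover have "m \<le> T (v n)" "T (v n) \<le> M" for n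
    proof -
      have "T (v n) > 0" using True vE[of n] by blast
      then show "m \<le> T (v n)" "T (v n) \<le> M" using mM(2,3)[OF vE[of n]] by linarith+
    qed
    moreover have "\<sigma> (v 0) = \<phi> a x" using w by (simp add: v_def)
    ultimately show ?thesis using conv[of v "\<lambda>n. T (v n)" a] vE that by blast
  next
    case False
    then have neg: "T u < 0" if "u \<in> {p..q}" for u using sgn that by blast
    have wE: "w \<in> {p..q}" using w by auto
    \<comment> \<open>points of the image of \<open>H\<close> to the power \<open>k\<close> that reach \<open>\<sigma> w\<close> within the time \<open>[-M, 0]\<close>\<close>
    define Y where "Y k = {z \<in> ((H ^^ k) ` {p..q}) \<times> {-M..0}. \<phi> (snd z) (\<sigma> (fst z)) = \<sigma> w}" for k
    have cHk: "continuous_on {p..q} (H ^^ k)" for k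
    proof (induction k)
      case (Suc k)
      show ?case unfolding funpow.simps
        by (rule continuous_on_compose[OF Suc continuous_on_subset[OF cH]]) (use Hpow in blast)
    qed simp
    have E_anti: "(H ^^ Suc k) ` {p..q} \<subseteq> (H ^^ k) ` {p..q}" for k
      using into by (auto simp: funpow_swap1)
    then have E_anti': "(H ^^ j) ` {p..q} \<subseteq> (H ^^ k) ` {p..q}" if "k \<le> j" for j k
      using lift_Suc_antimono_le[of "\<lambda>k. (H ^^ k) ` {p..q}", OF _ that] by blast
    have Ypc: "compact (Y k)" for k
    proof -
      have cpt: "compact (((H ^^ k) ` {p..q}) \<times> {-M..0})"
        by (intro compact_Times compact_continuous_image[OF cHk]) auto
      have sub: "(H ^^ k) ` {p..q} \<subseteq> {p..q}" using Hpow by blast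
      have "continuous_on (((H ^^ k) ` {p..q}) \<times> {-M..0}) (\<lambda>z. \<phi> (snd z) (\<sigma> (fst z)))"
      proof (rule continuous_on_flow)
        show "continuous_on (((H ^^ k) ` {p..q}) \<times> {-M..0}) (\<lambda>z. \<sigma> (fst z))"
          by (rule continuous_on_compose2[OF c\<sigma>]) (use sub in \<open>auto intro: continuous_intros\<close>)
      qed (use sub Xs in \<open>auto intro: continuous_intros\<close>)
      then have "closedin (top_of_set (((H ^^ k) ` {p..q}) \<times> {-M..0})) (Y k)"
        unfolding Y_def by (rule continuous_closedin_preimage_constant)
      then show ?thesis using cpt closedin_compact by blast
    qed
    have ret: "\<sigma> w \<in> omega_limit X \<phi> (\<sigma> w)" unfolding w(3) by (rule recurrent_shift[OF x])
    have Yne: "Y k \<noteq> {}" for k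
    proof -
      obtain t where t: "filterlim t at_top sequentially" "(\<lambda>n. \<phi> (t n) (\<sigma> w)) \<longlonglongrightarrow> \<sigma> w"
        using ret by (auto simp: omega_limit_def)
      have "eventually (\<lambda>n. \<exists>w' r. p < w' \<and> w' < q \<and> \<bar>r\<bar> < e \<and> \<phi> (t n) (\<sigma> w) = \<phi> r (\<sigma> w')) sequentially"
        by (rule eventually_hits_section[OF box w(1,2) pq(2,3) _ t(2)]) (use Xs[OF wE] in auto)
      moreover have "eventually (\<lambda>n. t n \<ge> M * real (Suc k) + e) sequentially"
        using t(1) by (auto simp: filterlim_at_top)
      ultimately have "eventually (\<lambda>n. (\<exists>w' r. p < w' \<and> w' < q \<and> \<bar>r\<bar> < e \<and> \<phi> (t n) (\<sigma> w) = \<phi> r (\<sigma> w')) \<and> t n \<ge> M * real (Suc k) + e) sequentially"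
        by (rule eventually_conj)
      then obtain n where "(\<exists>w' r. p < w' \<and> w' < q \<and> \<bar>r\<bar> < e \<and> \<phi> (t n) (\<sigma> w) = \<phi> r (\<sigma> w')) \<and> t n \<ge> M * real (Suc k) + e"
        using eventually_happens'[OF sequentially_bot] by blast
      then obtain w' r where w': "p < w'" "w' < q" "\<bar>r\<bar> < e" "\<phi> (t n) (\<sigma> w) = \<phi> r (\<sigma> w')" "t n \<ge> M * real (Suc k) + e" by blast
      have w'E: "w' \<in> {p..q}" using w' by auto
      define t' where "t' = t n - r"
      have t': "t' > M * real (Suc k)" using w'(3,5) by (simp add: t'_def abs_less_iff)
      have "\<phi> (t n + - t n) (\<sigma> w) = \<phi> (r + - t n) (\<sigma> w')"
        by (rule flow_shift_eq[OF Xs[OF wE] Xs[OF w'E] w'(4)])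
      then have w_eq: "\<sigma> w = \<phi> (- t') (\<sigma> w')" using Xs[OF wE] by (simp add: t'_def)
      define S where "S j = - (\<Sum>i<j. T ((H ^^ i) w'))" for j
      have SS: "S (Suc j) = S j - T ((H ^^ j) w')" for j by (simp add: S_def)
      have Sz: "\<sigma> ((H ^^ j) w') = \<phi> (- S j) (\<sigma> w')" for j
      proof (induction j)
        case (Suc j)
        have "- S (Suc j) = T ((H ^^ j) w') - S j" using SS[of j] by simp
        then show ?case using Suc eq[OF Hpow[OF w'E, of j]] Xs[OF w'E] by simp
      qed (use Xs[OF w'E] in \<open>simp add: S_def\<close>)
      have step: "m \<le> - T ((H ^^ j) w')" "- T ((H ^^ j) w') \<le> M" for j
        using mM(2,3)[OF Hpow[OF w'E, of j]] neg[OF Hpow[OF w'E, of j]] by linarith+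
      have lo: "m * real j \<le> S j" for j
      proof (induction j)
        case (Suc j) then show ?case using step(1)[of j] unfolding SS by (simp add: algebra_simps)
      qed (simp add: S_def)
      have up: "S j \<le> M * real j" for j
      proof (induction j)
        case (Suc j) then show ?case using step(2)[of j] unfolding SS by (simp add: algebra_simps)
      qed (simp add: S_def)
      have M: "M > 0" using mM(1) step[of 0] by linarith
      obtain N where "t' / m < real N" using reals_Archimedean2 by blast
      then have "t' < S N" using lo[of N] mM(1) by (simp add: field_simps)
      moreover have "S 0 \<le> t'" using t' M by (simp add: S_def) (smt (verit) mult_nonneg_nonneg of_nat_0_le_iff)
      ultimately obtain j where j: "S j \<le> t'" "t' < S (Suc j)" using between_partial_sums by metis
      have "M * real (Suc k) < M * real (Suc j)" using t' j(2) up[of "Suc j"] by linarith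
      then have "k \<le> j" using M by simp
      then have "(H ^^ j) w' \<in> (H ^^ k) ` {p..q}" using E_anti' w'E by blast
      moreover have "S j - t' \<in> {-M..0}" using j step(2)[of j] unfolding SS by auto
      moreover have "\<phi> (S j - t') (\<sigma> ((H ^^ j) w')) = \<sigma> w" unfolding Sz w_eq using Xs[OF w'E] by simp
      ultimately have "((H ^^ j) w', S j - t') \<in> Y k" by (simp add: Y_def)
      then show ?thesis by blast
    qed
    have "Y j \<subseteq> Y k" if "k \<le> j" for j k using E_anti'[OF that] by (auto simp: Y_def)
    then have "\<Inter>(range Y) \<noteq> {}" by (intro compact_nest Ypc Yne)
    then obtain z where z: "\<And>k. z \<in> Y k" by auto
    define I where "I = (\<Inter>k. (H ^^ k) ` {p..q})"
    have "fst z \<in> (H ^^ k) ` {p..q}" for k using z[of k] unfolding Y_def mem_Collect_eq mem_Times_iff by blast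
    then have uI: "fst z \<in> I" by (simp add: I_def)
    have IE: "I \<subseteq> {p..q}" unfolding I_def by (rule INF_lower2[of 0]) auto
    have Hinj: "inj_on H {p..q}" using hol by (simp add: holonomy_def)
    have "\<exists>u'\<in>I. H u' = u" if u: "u \<in> I" for u
    proof -
      have "u \<in> (H ^^ Suc k) ` {p..q}" for k using u unfolding I_def by blast
      then have *: "\<exists>u'\<in>(H ^^ k) ` {p..q}. H u' = u" for k by force
      then obtain u0 where u0: "u0 \<in> {p..q}" "H u0 = u" using *[of 0] by auto
      have "u0 \<in> (H ^^ k) ` {p..q}" for k
      proof -
        obtain u' where u': "u' \<in> (H ^^ k) ` {p..q}" "H u' = u" using * by blast
        then have "u' \<in> {p..q}" using Hpow by blast
        then have "u' = u0" using inj_onD[OF Hinj] u' u0 by metis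
        then show ?thesis using u' by simp
      qed
      then show ?thesis using u0 by (auto simp: I_def)
    qed
    then have "\<exists>v. \<forall>n. (v n \<in> I \<and> (n = 0 \<longrightarrow> v n = fst z)) \<and> H (v (Suc n)) = v n"
      using dependent_nat_choice[of "\<lambda>n u. u \<in> I \<and> (n = 0 \<longrightarrow> u = fst z)" "\<lambda>n u u'. H u' = u"] uI by auto
    then obtain v where v: "\<And>n. v n \<in> I" "v 0 = fst z" "\<And>n. H (v (Suc n)) = v n" by metis
    have vE: "v n \<in> {p..q}" for n using v(1) IE by blast
    have "monoseq v"
    proof (cases "v 0 \<le> v 1")
      case True
      have "v n \<le> v (Suc n)" for n
      proof (induction n)
        case (Suc n) then show ?case using le[OF vE[of "Suc n"] vE[of "Suc (Suc n)"]] v(3) by simp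
      qed (use True in simp)
      then show ?thesis by (simp add: monoseq_Suc)
    next
      case False
      have "v (Suc n) \<le> v n" for n
      proof (induction n)
        case (Suc n) then show ?case using le[OF vE[of "Suc (Suc n)"] vE[of "Suc n"]] v(3) by simp
      qed (use False in simp)
      then show ?thesis by (simp add: monoseq_Suc)
    qed
    moreover have "\<sigma> (v (Suc n)) = \<phi> (- T (v (Suc n))) (\<sigma> (v n))" for n
    proof -
      have "\<sigma> (v n) = \<phi> (T (v (Suc n))) (\<sigma> (v (Suc n)))" using eq[OF vE[of "Suc n"]] v(3) by simp
      then show ?thesis using Xs[OF vE[of "Suc n"]] by simp
    qed
    moreover have "m \<le> - T (v (Suc n))" "- T (v (Suc n)) \<le> M" for n
      using mM(2,3)[OF vE[of "Suc n"]] neg[OF vE[of "Suc n"]] by linarith+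
    moreover have "\<sigma> (v 0) = \<phi> (- snd z + a) x"
    proof -
      have "\<phi> (snd z) (\<sigma> (v 0)) = \<phi> a x" using z[of 0] w(3) by (simp add: Y_def v(2))
      then have "\<phi> (snd z + - snd z) (\<sigma> (v 0)) = \<phi> (a + - snd z) x"
        by (rule flow_shift_eq[OF Xs[OF vE] x(1)])
      then show ?thesis using Xs[OF vE] by (simp add: add.commute)
    qed
    ultimately show ?thesis using conv[of v "\<lambda>n. - T (v (Suc n))" "- snd z + a"] vE that by blast
  qed
qed

section \<open>Gaps of a closed invariant set\<close>

definition invariant :: "'a set \<Rightarrow> bool"
  where "invariant K \<longleftrightarrow> K \<subseteq> X \<and> (\<forall>x\<in>X. \<forall>t. \<phi> t x \<in> K \<longleftrightarrow> x \<in> K)"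

lemma holonomy_invariant:
  assumes "flow_box \<sigma> e" "invariant K" "holonomy \<sigma> \<sigma>' C T F" "u \<in> C"
  shows "\<sigma>' (F u) \<in> K \<longleftrightarrow> \<sigma> u \<in> K"
  using assms flow_boxD(3)[OF assms(1), of u] by (auto simp: holonomy_def invariant_def)

lemma holonomy_segment_image:
  assumes "holonomy \<sigma> \<sigma>' C T F" "closed_segment a b \<subseteq> C"
  shows "F ` closed_segment a b = closed_segment (F a) (F b)"
    and "F ` open_segment a b = open_segment (F a) (F b)"
proof -
  have "continuous_on (closed_segment a b) F" "inj_on F (closed_segment a b)"
    using assms by (auto simp: holonomy_def intro: continuous_on_subset inj_on_subset)
  then show "F ` closed_segment a b = closed_segment (F a) (F b)"
    "F ` open_segment a b = open_segment (F a) (F b)"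
    by (rule continuous_injective_image_segment_1, rule continuous_injective_image_open_segment_1)
qed

lemma period_int:
  assumes "x \<in> X" "\<phi> t x = x" shows "\<phi> (of_int k * t) x = x"
proof (cases "k \<ge> 0")
  case True
  then show ?thesis using period_multiple[OF assms, of "nat k"] by simp
next
  case False
  then have "of_int k * t = - (real (nat (- k)) * t)" by simp
  then show ?thesis using period_uminus[OF assms(1) period_multiple[OF assms, of "nat (- k)"]] by simp
qed

lemma periodic_orbit_closed:
  assumes x: "x \<in> X" and t: "t \<noteq> 0" "\<phi> t x = x"
  shows "closed (flow_orbit \<phi> x)"
proof -
  have tp: "\<phi> \<bar>t\<bar> x = x" using t(2) period_uminus[OF x t(2)] by (simp add: abs_if)
  have "flow_orbit \<phi> x = (\<lambda>s. \<phi> s x) ` {0..\<bar>t\<bar>}"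
  proof (intro subset_antisym subsetI)
    fix y assume "y \<in> flow_orbit \<phi> x"
    then obtain s where s: "y = \<phi> s x" by (auto simp: flow_orbit_def)
    define k where "k = \<lfloor>s / \<bar>t\<bar>\<rfloor>"
    have "\<phi> s x = \<phi> (s - of_int k * \<bar>t\<bar>) (\<phi> (of_int k * \<bar>t\<bar>) x)" using x by simp
    also have "\<dots> = \<phi> (s - of_int k * \<bar>t\<bar>) x" by (simp only: period_int[OF x tp])
    finally have "y = \<phi> (s - of_int k * \<bar>t\<bar>) x" using s by simp
    moreover have "s - of_int k * \<bar>t\<bar> \<in> {0..\<bar>t\<bar>}"
      using floor_divide_lower[of "\<bar>t\<bar>" s] floor_divide_upper[of "\<bar>t\<bar>" s] t(1)
      by (simp add: k_def algebra_simps)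
    ultimately show "y \<in> (\<lambda>s. \<phi> s x) ` {0..\<bar>t\<bar>}" by blast
  qed (auto simp: flow_orbit_def)
  moreover have "compact ((\<lambda>s. \<phi> s x) ` {0..\<bar>t\<bar>})"
    by (rule compact_continuous_image) (use x in \<open>auto intro!: continuous_intros\<close>)
  ultimately show ?thesis by (simp add: compact_imp_closed)
qed

text \<open>Gaps of \<open>K\<close> on the cross-sections, cut off at length \<open>\<kappa>\<close>: \<open>s\<close> is the end point in \<open>K\<close>, and \<open>g = \<plusminus>\<kappa>\<close> points
  from there into the gap.\<close>

definition large_gaps :: "(real \<Rightarrow> 'a) set \<Rightarrow> real \<Rightarrow> 'a set \<Rightarrow> ((real \<Rightarrow> 'a) \<times> real \<times> real) set"
  where "large_gaps J \<kappa> K = {(\<sigma>, s, g). \<sigma> \<in> J \<and> \<bar>s\<bar> \<le> 1/2 \<and> \<bar>g\<bar> = \<kappa> \<and> \<sigma> s \<in> K \<and>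
    (\<forall>u\<in>open_segment s (s + g). \<sigma> u \<notin> K)}"

text \<open>End points of gaps that lie on the same side are at least \<open>\<kappa>\<close> apart.\<close>

lemma finite_large_gaps:
  assumes "finite J" "\<kappa> > 0" shows "finite (large_gaps J \<kappa> K)"
proof -
  define f where "f z = (fst z, \<lfloor>fst (snd z) / \<kappa>\<rfloor>, snd (snd z))" for z :: "(real \<Rightarrow> 'a) \<times> real \<times> real"
  have "inj_on f (large_gaps J \<kappa> K)"
  proof (rule inj_onI)
    fix z z' assume z: "z \<in> large_gaps J \<kappa> K" "z' \<in> large_gaps J \<kappa> K" "f z = f z'"
    obtain \<sigma> s g where z1: "z = (\<sigma>, s, g)" by (cases z) auto
    obtain s' where z2: "z' = (\<sigma>, s', g)" "\<lfloor>s / \<kappa>\<rfloor> = \<lfloor>s' / \<kappa>\<rfloor>" using z(3) unfolding f_def z1 by (cases z') auto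
    have *: "\<bar>g\<bar> = \<kappa>" "\<sigma> s \<in> K" "\<sigma> s' \<in> K" "\<forall>u\<in>open_segment s (s + g). \<sigma> u \<notin> K"
      "\<forall>u\<in>open_segment s' (s' + g). \<sigma> u \<notin> K"
      using z(1,2) by (auto simp: large_gaps_def z1 z2)
    have near: "\<bar>s - s'\<bar> < \<kappa>"
      using floor_divide_lower[OF assms(2), of s] floor_divide_upper[OF assms(2), of s]
        floor_divide_lower[OF assms(2), of s'] floor_divide_upper[OF assms(2), of s'] z2(2)
      by (simp add: abs_less_iff algebra_simps)
    have "s = s'"
    proof (rule ccontr)
      assume "s \<noteq> s'"
      then have "s' \<in> open_segment s (s + g) \<or> s \<in> open_segment s' (s' + g)"
        using near *(1) by (auto simp: open_segment_eq_real_ivl abs_if split: if_splits)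
      then show False using * by blast
    qed
    then show "z = z'" by (simp add: z1 z2)
  qed
  moreover have "f ` large_gaps J \<kappa> K \<subseteq> J \<times> {\<lfloor>(-1/2) / \<kappa>\<rfloor>..\<lfloor>(1/2) / \<kappa>\<rfloor>} \<times> {\<kappa>, -\<kappa>}"
  proof (rule image_subsetI)
    fix z assume "z \<in> large_gaps J \<kappa> K"
    then obtain \<sigma> s g where z: "z = (\<sigma>, s, g)" "\<sigma> \<in> J" "\<bar>s\<bar> \<le> 1/2" "\<bar>g\<bar> = \<kappa>" by (auto simp: large_gaps_def)
    have "-1/2 \<le> s" "s \<le> 1/2" using z(3) by linarith+
    then have "(-1/2) / \<kappa> \<le> s / \<kappa>" "s / \<kappa> \<le> (1/2) / \<kappa>" using divide_right_mono[of "-1/2" s \<kappa>] divide_right_mono[of s "1/2" \<kappa>] assms(2) by linarith+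
    then have "\<lfloor>s / \<kappa>\<rfloor> \<in> {\<lfloor>(-1/2) / \<kappa>\<rfloor>..\<lfloor>(1/2) / \<kappa>\<rfloor>}"
      unfolding atLeastAtMost_iff by (intro conjI floor_mono)
    moreover have "g \<in> {\<kappa>, -\<kappa>}" using z(4) by (auto simp: abs_if split: if_splits)
    ultimately show "f z \<in> J \<times> {\<lfloor>(-1/2) / \<kappa>\<rfloor>..\<lfloor>(1/2) / \<kappa>\<rfloor>} \<times> {\<kappa>, -\<kappa>}" using z(2) by (simp add: f_def z(1))
  qed
  then have "finite (f ` large_gaps J \<kappa> K)" by (rule finite_subset) (use assms(1) in auto)
  ultimately show ?thesis using finite_imageD by blast
qed

text \<open>A gap that starts at \<open>\<sigma> a\<close> is stretched by holonomy to a large gap, because \<open>K\<close> is invariant. This also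
  holds for shorter and shorter initial parts of it. As there are finitely many large gaps,
  two different parts, \<open>[a, c n]\<close> and \<open>[a, c m]\<close>, are stretched to the same one. If the travel times of \<open>\<sigma> a\<close>
  agreed, both holonomies would agree on the shorter part by uniqueness, and injectivity would
  give \<open>c n = c m\<close>. So \<open>\<sigma> a\<close> reaches the end point of the large gap at two different times.\<close>

lemma gap_endpoint_periodic:
  assumes J: "atlas J" and gr: "stretching J \<kappa>" and K: "invariant K"
    and \<sigma>: "\<sigma> \<in> J" and ab: "\<bar>a\<bar> \<le> 3/4" "\<bar>b\<bar> \<le> 1" "a \<noteq> b" and gap: "\<sigma> a \<in> K" "\<forall>u\<in>open_segment a b. \<sigma> u \<notin> K"
  shows "\<exists>t. t \<noteq> 0 \<and> \<phi> t (\<sigma> a) = \<sigma> a"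
    and "\<exists>(\<sigma>', s, g)\<in>large_gaps J \<kappa> K. \<exists>r. \<phi> r (\<sigma> a) = \<sigma>' s"
proof -
  obtain e where box: "flow_box \<sigma> e" using J \<sigma> by (auto simp: atlas_def)
  have aX: "\<sigma> a \<in> X" by (rule flow_boxD(3)[OF box]) (use ab in simp)
  have \<kappa>: "\<kappa> > 0" using gr by (simp add: stretching_def)
  define ok where "ok st \<longleftrightarrow> (case st of (\<sigma>', T, F, c) \<Rightarrow> \<sigma>' \<in> J \<and> c \<in> closed_segment a b \<and> c \<noteq> a \<and>
    holonomy \<sigma> \<sigma>' (closed_segment a c) T F \<and> (\<sigma>', F a, F c - F a) \<in> large_gaps J \<kappa> K)"
    for st :: "(real \<Rightarrow> 'a) \<times> (real \<Rightarrow> real) \<times> (real \<Rightarrow> real) \<times> real"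
  have ex: "\<exists>\<sigma>' T F c. ok (\<sigma>', T, F, c) \<and> c \<in> closed_segment a b'" if b': "b' \<in> closed_segment a b" "b' \<noteq> a" for b'
  proof -
    have "\<bar>b'\<bar> \<le> 1" using b'(1) ab by (auto simp: closed_segment_eq_real_ivl split: if_splits)
    then obtain \<sigma>' T F c where g: "\<sigma>' \<in> J" "c \<in> closed_segment a b'" "holonomy \<sigma> \<sigma>' (closed_segment a c) T F"
      "\<bar>F a\<bar> \<le> 1/2" "\<bar>F c - F a\<bar> = \<kappa>"
      using gr \<sigma> ab(1) b'(2) unfolding stretching_def by blast
    have cab: "c \<in> closed_segment a b" using g(2) b'(1) subset_closed_segment[of a b' a b] by auto
    have "\<sigma>' (F a) \<in> K" using holonomy_invariant[OF box K g(3), of a] gap(1) by simp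
    moreover have "\<sigma>' v \<notin> K" if v: "v \<in> open_segment (F a) (F c)" for v
    proof -
      obtain u where u: "u \<in> open_segment a c" "v = F u" using v holonomy_segment_image(2)[OF g(3) order_refl] by auto
      have "u \<in> open_segment a b" using u(1) cab subset_open_segment[of a c a b]
        by (auto simp: open_segment_eq_real_ivl closed_segment_eq_real_ivl split: if_splits)
      moreover have "u \<in> closed_segment a c" using u(1) segment_open_subset_closed by blast
      ultimately show ?thesis using holonomy_invariant[OF box K g(3)] gap(2) u(2) by blast
    qed
    moreover have "c \<noteq> a" using g(5) \<kappa> by auto
    ultimately have "ok (\<sigma>', T, F, c)" using g cab by (auto simp: ok_def large_gaps_def)
    then show ?thesis using g(2) by blast
  qed
  have "\<exists>st. ok st" using ex[of b] ab(3) by auto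
  moreover have "\<exists>st'. ok st' \<and> snd (snd (snd st')) \<in> closed_segment a ((a + snd (snd (snd st))) / 2)" if "ok st" for st
  proof -
    define c where "c = snd (snd (snd st))"
    have c: "c \<in> closed_segment a b" "c \<noteq> a" using that by (auto simp: ok_def c_def split: prod.splits)
    then have "(a + c) / 2 \<in> closed_segment a b" "(a + c) / 2 \<noteq> a"
      by (auto simp: closed_segment_eq_real_ivl split: if_splits)
    then obtain \<sigma>' T F c' where "ok (\<sigma>', T, F, c')" "c' \<in> closed_segment a ((a + c) / 2)" using ex by blast
    then show ?thesis unfolding c_def[symmetric] by (intro exI[of _ "(\<sigma>', T, F, c')"]) simp
  qed
  ultimately have "\<exists>f. \<forall>n. ok (f n) \<and> snd (snd (snd (f (Suc n)))) \<in> closed_segment a ((a + snd (snd (snd (f n)))) / 2)"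
    using dependent_nat_choice[of "\<lambda>_. ok" "\<lambda>_ st st'. snd (snd (snd st')) \<in> closed_segment a ((a + snd (snd (snd st))) / 2)"] by blast
  then obtain f where f: "\<And>n. ok (f n)" "\<And>n. snd (snd (snd (f (Suc n)))) \<in> closed_segment a ((a + snd (snd (snd (f n)))) / 2)" by blast
  define \<rho> where "\<rho> n = fst (f n)" for n
  define T where "T n = fst (snd (f n))" for n
  define F where "F n = fst (snd (snd (f n)))" for n
  define c where "c n = snd (snd (snd (f n)))" for n
  have fo: "\<rho> n \<in> J" "c n \<noteq> a" "holonomy \<sigma> (\<rho> n) (closed_segment a (c n)) (T n) (F n)"
    "(\<rho> n, F n a, F n (c n) - F n a) \<in> large_gaps J \<kappa> K" for n
    using f(1)[of n] by (auto simp: ok_def \<rho>_def T_def F_def c_def split: prod.splits)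
  \<comment> \<open>halving makes the parts shrink strictly\<close>
  have c_half: "c m \<in> closed_segment a ((a + c n) / 2)" if "n < m" for n m
    using that
  proof (induction m)
    case (Suc m)
    have s: "c (Suc m) \<in> closed_segment a ((a + c m) / 2)" using f(2)[of m] by (simp add: c_def)
    show ?case
    proof (cases "n = m")
      case False
      then have "c m \<in> closed_segment a ((a + c n) / 2)" using Suc by simp
      then show ?thesis using s by (auto simp: closed_segment_eq_real_ivl split: if_splits)
    qed (use s in simp)
  qed simp
  let ?P = "\<lambda>n. (\<rho> n, F n a, F n (c n) - F n a)"
  have "finite (range ?P)"
    by (rule finite_subset[OF _ finite_large_gaps[of J \<kappa> K]]) (use fo(4) J \<kappa> in \<open>auto simp: atlas_def\<close>)
  then have "\<not> inj ?P" using finite_imageD by blast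
  then obtain i j where "i \<noteq> j" "?P i = ?P j" by (auto simp: inj_def)
  then obtain n m where nm: "n < m" "?P n = ?P m" by (metis linorder_neqE_nat)
  have reach: "\<phi> (T n a) (\<sigma> a) = \<rho> n (F n a)" for n using fo(3)[of n] by (auto simp: holonomy_def)
  have "T n a \<noteq> T m a"
  proof
    assume eq: "T n a = T m a"
    obtain e' where box': "flow_box (\<rho> n) e'" using J fo(1)[of n] by (auto simp: atlas_def)
    have cm: "c m \<in> closed_segment a (c n)" "c m \<noteq> c n" using c_half[OF nm(1)] fo(2)[of n] fo(2)[of m]
      by (auto simp: closed_segment_eq_real_ivl split: if_splits)
    have sub: "closed_segment a (c m) \<subseteq> closed_segment a (c n)" using cm(1) by (simp add: subset_closed_segment)
    have "holonomy \<sigma> (\<rho> n) (closed_segment a (c m)) (T n) (F n)" by (rule holonomy_subset[OF fo(3) sub])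
    moreover have "holonomy \<sigma> (\<rho> n) (closed_segment a (c m)) (T m) (F m)" using fo(3)[of m] nm(2) by simp
    ultimately have "F n (c m) = F m (c m)"
      using holonomy_unique(2)[OF box box', of "closed_segment a (c m)" "T n" "F n" "T m" "F m" a "c m"] eq
      by simp
    then have "F n (c m) = F n (c n)" using nm(2) by simp
    moreover have "inj_on (F n) (closed_segment a (c n))" using fo(3)[of n] by (simp add: holonomy_def)
    ultimately have "c m = c n" using cm(1) by (auto dest: inj_onD)
    then show False using cm(2) by simp
  qed
  moreover have "\<phi> (T n a) (\<sigma> a) = \<phi> (T m a) (\<sigma> a)" using reach[of n] reach[of m] nm(2) by simp
  then have "\<phi> (T m a - T n a) (\<sigma> a) = \<sigma> a" by (rule flow_eq_imp_period[OF aX])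
  ultimately show "\<exists>t. t \<noteq> 0 \<and> \<phi> t (\<sigma> a) = \<sigma> a" by (intro exI[of _ "T m a - T n a"]) simp
  show "\<exists>(\<sigma>', s, g)\<in>large_gaps J \<kappa> K. \<exists>r. \<phi> r (\<sigma> a) = \<sigma>' s"
    using fo(4)[of n] reach[of n] by blast
qed

text \<open>The finitely many periodic orbits through the end points of large gaps form a closed set, which
  contains the end points of all gaps and hence their limit \<open>\<sigma> s\<close>.\<close>

lemma periodic_if_accumulated_by_gaps:
  assumes J: "atlas J" and gr: "stretching J \<kappa>" and K: "invariant K" "closed K"
    and \<sigma>: "\<sigma> \<in> J" and s: "\<bar>s\<bar> < 1/2" "\<sigma> s \<in> K"
    and gaps: "\<And>\<eta>. \<eta> > 0 \<Longrightarrow> \<exists>u. s < u \<and> u < s + \<eta> \<and> \<sigma> u \<notin> K"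
  shows "\<exists>t. t \<noteq> 0 \<and> \<phi> t (\<sigma> s) = \<sigma> s"
proof -
  obtain e where box: "flow_box \<sigma> e" using J \<sigma> by (auto simp: atlas_def)
  have \<kappa>: "\<kappa> > 0" using gr by (simp add: stretching_def)
  define Z where "Z = {z \<in> X. (\<exists>(\<sigma>', s', g)\<in>large_gaps J \<kappa> K. z = \<sigma>' s') \<and> (\<exists>t. t \<noteq> 0 \<and> \<phi> t z = z)}"
  have "Z \<subseteq> (\<lambda>(\<sigma>', s', g). \<sigma>' s') ` large_gaps J \<kappa> K"
    by (auto simp: Z_def intro: rev_image_eqI)
  then have finZ: "finite Z" using finite_large_gaps[of J \<kappa> K] \<kappa> J by (auto simp: atlas_def intro: finite_subset)
  define Y where "Y = (\<Union>z\<in>Z. flow_orbit \<phi> z)"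
  have "closed Y" unfolding Y_def
    by (rule closed_UN[OF finZ]) (use periodic_orbit_closed in \<open>auto simp: Z_def\<close>)
  have per: "\<exists>t. t \<noteq> 0 \<and> \<phi> t y = y" if yY: "y \<in> Y" for y
  proof -
    obtain z r where z: "z \<in> Z" "y = \<phi> r z" using yY by (auto simp: Y_def flow_orbit_def)
    then obtain t where t: "t \<noteq> 0" "\<phi> t z = z" "z \<in> X" by (auto simp: Z_def)
    have "\<phi> t y = \<phi> r (\<phi> t z)" using t(3) z(2) by (simp add: add.commute)
    then show ?thesis using t z by auto
  qed
  have "\<exists>a. s \<le> a \<and> a < s + inverse (real (Suc n)) \<and> a < 3/4 \<and> \<sigma> a \<in> Y" for n
  proof -
    obtain u where u: "s < u" "u < s + min (1/4) (inverse (real (Suc n)))" "\<sigma> u \<notin> K"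
      using gaps[of "min (1/4) (inverse (real (Suc n)))"] by auto
    \<comment> \<open>the last point of \<open>K\<close> before \<open>u\<close> is the end point of a gap\<close>
    define A where "A = {v \<in> {s..u}. \<sigma> v \<in> K}"
    have "continuous_on {s..u} \<sigma>"
      by (rule continuous_on_subset[OF flow_boxD(2)[OF box]]) (use s u in auto)
    then have "closed ({s..u} \<inter> \<sigma> -` K)" by (rule continuous_closed_preimage) (use K in auto)
    moreover have "{s..u} \<inter> \<sigma> -` K = A" by (auto simp: A_def)
    ultimately have cA: "closed A" by simp
    have bdd: "bdd_above A" by (rule bdd_aboveI[of _ u]) (auto simp: A_def)
    have "s \<in> A" using s u by (simp add: A_def)
    then have "Sup A \<in> A" using closed_contains_Sup[OF _ bdd cA] by blast
    define a where "a = Sup A"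
    have a: "s \<le> a" "a \<le> u" "\<sigma> a \<in> K" using \<open>Sup A \<in> A\<close> by (auto simp: A_def a_def)
    have "a \<noteq> u" using a(3) u(3) by auto
    then have au: "a < u" using a(2) by simp
    have "\<sigma> v \<notin> K" if "v \<in> open_segment a u" for v
    proof
      assume "\<sigma> v \<in> K"
      then have "v \<in> A" using that au a(1) by (auto simp: A_def open_segment_eq_real_ivl)
      then have "v \<le> a" unfolding a_def by (rule cSup_upper[OF _ bdd])
      then show False using that au by (auto simp: open_segment_eq_real_ivl)
    qed
    then have gap: "\<forall>v\<in>open_segment a u. \<sigma> v \<notin> K" by blast
    have a34: "\<bar>a\<bar> \<le> 3/4" "\<bar>u\<bar> \<le> 1" using s(1) a u by (auto simp: abs_le_iff abs_less_iff)
    obtain \<sigma>' s' g r where lg: "(\<sigma>', s', g) \<in> large_gaps J \<kappa> K" "\<phi> r (\<sigma> a) = \<sigma>' s'"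
      using gap_endpoint_periodic(2)[OF J gr K(1) \<sigma> a34 \<open>a \<noteq> u\<close> a(3) gap] by blast
    obtain t where t: "t \<noteq> 0" "\<phi> t (\<sigma> a) = \<sigma> a"
      using gap_endpoint_periodic(1)[OF J gr K(1) \<sigma> a34 \<open>a \<noteq> u\<close> a(3) gap] by blast
    have aX: "\<sigma> a \<in> X" by (rule flow_boxD(3)[OF box]) (use a34 in simp)
    have "\<phi> t (\<sigma>' s') = \<phi> r (\<phi> t (\<sigma> a))" using aX lg(2)[symmetric] by (simp add: add.commute)
    then have "\<phi> t (\<sigma>' s') = \<sigma>' s'" using t lg by simp
    moreover have "\<sigma>' s' \<in> X" using flow_in[OF aX, of r] lg(2) by simp
    ultimately have "\<sigma>' s' \<in> Z" using lg(1) t(1) by (auto simp: Z_def)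
    moreover have "\<sigma> a = \<phi> (- r) (\<sigma>' s')" using aX lg(2)[symmetric] by simp
    ultimately have "\<sigma> a \<in> Y" by (auto simp: Y_def flow_orbit_def)
    then show ?thesis using a u au s(1) by (intro exI[of _ a]) auto
  qed
  then obtain a where a: "\<And>n. s \<le> a n" "\<And>n. a n < s + inverse (real (Suc n))" "\<And>n. a n < 3/4" "\<And>n. \<sigma> (a n) \<in> Y" by metis
  have lim: "(\<lambda>n. s + inverse (real (Suc n))) \<longlonglongrightarrow> s"
    using tendsto_add[OF tendsto_const LIMSEQ_inverse_real_of_nat, of s] by simp
  have "a \<longlonglongrightarrow> s"
    by (rule tendsto_sandwich[OF _ _ tendsto_const lim]) (use a in \<open>auto intro!: always_eventually less_imp_le\<close>)
  moreover have "s \<in> {-1..1}" using s(1) unfolding atLeastAtMost_iff by linarith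
  moreover have "a n \<in> {-1..1}" for n using a(1,3)[of n] s(1) by (auto simp: abs_less_iff)
  ultimately have "(\<lambda>n. \<sigma> (a n)) \<longlonglongrightarrow> \<sigma> s"
    using continuous_on_tendsto_compose[OF flow_boxD(2)[OF box], of a s] by simp
  then have "\<sigma> s \<in> Y" by (rule closed_sequentially[OF \<open>closed Y\<close> a(4)])
  then show ?thesis by (rule per)
qed

section \<open>Intervals inside an orbit closure\<close>

text \<open>The subinterval \<open>[c, d]\<close> is required to be proper so that an interval that covers itself does so by a
  holonomy other than the identity.\<close>

definition covers :: "(real \<Rightarrow> 'a) \<times> real \<times> real \<Rightarrow> (real \<Rightarrow> 'a) \<times> real \<times> real \<Rightarrow> bool"
  where "covers E E' \<longleftrightarrow> (case (E, E') of ((\<sigma>, p, q), (\<sigma>', p', q')) \<Rightarrow>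
    \<exists>c d T F. p \<le> c \<and> c \<le> d \<and> d \<le> q \<and> (c, d) \<noteq> (p, q) \<and>
      holonomy \<sigma> \<sigma>' {c..d} T F \<and> F ` {c..d} = {p'..q'})"

lemma covers_trans:
  assumes J: "\<exists>e. flow_box (fst E) e" and 1: "covers E E'" and 2: "covers E' E''"
  shows "covers E E''"
proof -
  obtain \<sigma> p q where E: "E = (\<sigma>, p, q)" by (cases E) auto
  obtain \<sigma>' p' q' where E': "E' = (\<sigma>', p', q')" by (cases E') auto
  obtain \<sigma>'' p'' q'' where E'': "E'' = (\<sigma>'', p'', q'')" by (cases E'') auto
  obtain e where box: "flow_box \<sigma> e" using J E by auto
  obtain c d T F where a: "p \<le> c" "c \<le> d" "d \<le> q" "(c, d) \<noteq> (p, q)" "holonomy \<sigma> \<sigma>' {c..d} T F" "F ` {c..d} = {p'..q'}"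
    using 1 by (auto simp: covers_def E E')
  obtain c' d' T' F' where b: "p' \<le> c'" "c' \<le> d'" "d' \<le> q'" "holonomy \<sigma>' \<sigma>'' {c'..d'} T' F'" "F' ` {c'..d'} = {p''..q''}"
    using 2 by (auto simp: covers_def E' E'')
  have "c' \<in> F ` {c..d}" "d' \<in> F ` {c..d}" using a(6) b by auto
  then obtain u v where uv: "u \<in> {c..d}" "v \<in> {c..d}" "F u = c'" "F v = d'" by blast
  have sub: "closed_segment u v \<subseteq> {c..d}" using uv by (auto simp: closed_segment_eq_real_ivl split: if_splits)
  have seg: "closed_segment u v = {min u v..max u v}" by (auto simp: closed_segment_eq_real_ivl)
  have img: "F ` closed_segment u v = {c'..d'}"
    using holonomy_segment_image(1)[OF a(5) sub] uv b(2) by (simp add: closed_segment_eq_real_ivl)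
  have "holonomy \<sigma> \<sigma>'' {min u v..max u v} (\<lambda>u. T u + T' (F u)) (\<lambda>u. F' (F u))"
    by (rule holonomy_comp[OF box holonomy_subset[OF a(5)] b(4)]) (use sub img seg in auto)
  moreover have "(\<lambda>u. F' (F u)) ` {min u v..max u v} = {p''..q''}"
    using img b(5) seg by (metis image_image)
  moreover have "p \<le> min u v" "min u v \<le> max u v" "max u v \<le> q" "(min u v, max u v) \<noteq> (p, q)"
    using uv a by auto
  ultimately show ?thesis unfolding covers_def E E'' by blast
qed

text \<open>The inverse \<open>G\<close> of the stretching map sends the interval into itself. Its travel time has no zero,
  since otherwise uniqueness would make \<open>G\<close> the identity, and so has constant sign. The square
  of \<open>G\<close> is increasing.\<close>

lemma covers_refl_periodic:
  assumes box: "flow_box \<sigma> e" and pq: "p < q" "-1 \<le> p" "q \<le> 1" and cov: "covers (\<sigma>, p, q) (\<sigma>, p, q)"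
    and x: "x \<in> X" "x \<in> omega_limit X \<phi> x" and w: "p < w" "w < q" "\<sigma> w = \<phi> a x"
  obtains t where "t > 0" "\<phi> t x = x"
proof -
  obtain c d T F where C: "p \<le> c" "c \<le> d" "d \<le> q" "(c, d) \<noteq> (p, q)" "holonomy \<sigma> \<sigma> {c..d} T F" "F ` {c..d} = {p..q}"
    using cov by (auto simp: covers_def)
  define G where "G = inv_into {c..d} F"
  define T' where "T' v = - T (G v)" for v
  have G: "holonomy \<sigma> \<sigma> {p..q} T' G"
    using holonomy_inv[OF box C(5)] C(6) by (simp add: G_def T'_def[abs_def])
  have Gcd: "G ` {p..q} = {c..d}"
    using inv_into_image_cancel[of F "{c..d}" "{c..d}"] C(5,6) by (simp add: G_def holonomy_def)
  then have into: "G ` {p..q} \<subseteq> {p..q}" using C by auto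
  have hid: "holonomy \<sigma> \<sigma> {p..q} (\<lambda>_. 0) (\<lambda>u. u)" by (rule holonomy_id[OF box]) (use pq in auto)
  have "T' u \<noteq> 0" if u: "u \<in> {p..q}" for u
  proof
    assume "T' u = 0"
    then have "G v = v" if "v \<in> {p..q}" for v
      using holonomy_unique(2)[OF box box G hid, of u v] u that \<open>T' u = 0\<close> by simp
    then have "G ` {p..q} = {p..q}" by simp
    then show False using Gcd C(2,4) by (simp add: Icc_eq_Icc)
  qed
  moreover have "connected (T' ` {p..q})"
    by (rule connected_continuous_image) (use G in \<open>auto simp: holonomy_def\<close>)
  ultimately have sgn: "(\<forall>u\<in>{p..q}. T' u > 0) \<or> (\<forall>u\<in>{p..q}. T' u < 0)"
    using connectedD_interval[of "T' ` {p..q}" _ _ 0] by (smt (verit) imageE imageI)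
  define H where "H u = G (G u)" for u
  define T2 where "T2 u = T' u + T' (G u)" for u
  have H: "holonomy \<sigma> \<sigma> {p..q} T2 H"
    unfolding H_def[abs_def] T2_def[abs_def] by (rule holonomy_comp[OF box G G into])
  have Gmem: "G u \<in> {p..q}" if "u \<in> {p..q}" for u using into that by blast
  have "H ` {p..q} \<subseteq> {p..q}" using Gmem by (auto simp: H_def)
  moreover have "strict_mono_on {p..q} H"
  proof -
    have "strict_mono_on {p..q} G \<or> strict_antimono_on {p..q} G"
      using injective_eq_monotone_map[of "{p..q}" G] G by (auto simp: holonomy_def is_interval_cc)
    then show ?thesis
    proof
      assume m: "strict_mono_on {p..q} G"
      show ?thesis unfolding H_def
        by (rule strict_mono_onI) (use Gmem strict_mono_onD[OF m] in blast)
    next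
      assume m: "strict_antimono_on {p..q} G"
      show ?thesis unfolding H_def
        by (rule strict_mono_onI) (use Gmem monotone_onD[OF m] in blast)
    qed
  qed
  moreover have "(\<forall>u\<in>{p..q}. T2 u > 0) \<or> (\<forall>u\<in>{p..q}. T2 u < 0)"
    using sgn Gmem unfolding T2_def by (meson add_neg_neg add_pos_pos)
  ultimately show ?thesis
    using self_return_periodic[OF box pq H _ _ _ x w] that by blast
qed

text \<open>An interval of length \<open>\<kappa>\<close> contains a cell of the grid of width \<open>\<kappa>/2\<close>.\<close>

lemma covers_grid_step:
  assumes J: "atlas J" and gr: "stretching J \<kappa>" and \<sigma>: "\<sigma> \<in> J" and pq: "p < q" "-3/4 \<le> p" "q \<le> 3/4"
  obtains \<sigma>' and i :: int where "\<sigma>' \<in> J" "-3/4 \<le> i * (\<kappa>/2)" "(i + 1) * (\<kappa>/2) \<le> 3/4"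
    "covers (\<sigma>, p, q) (\<sigma>', i * (\<kappa>/2), (i + 1) * (\<kappa>/2))"
proof -
  have \<kappa>: "\<kappa> > 0" "\<kappa> \<le> 1/4" using gr by (auto simp: stretching_def)
  obtain \<sigma>' T F c where g: "\<sigma>' \<in> J" "c \<in> closed_segment p ((p + q) / 2)" "holonomy \<sigma> \<sigma>' (closed_segment p c) T F"
    "\<bar>F p\<bar> \<le> 1/2" "\<bar>F c - F p\<bar> = \<kappa>"
  proof -
    have "\<bar>p\<bar> \<le> 3/4" "\<bar>(p + q) / 2\<bar> \<le> 1" "(p + q) / 2 \<noteq> p" using pq by auto
    then show ?thesis using gr \<sigma> that unfolding stretching_def by blast
  qed
  have c: "p \<le> c" "c < q" using g(2) pq by (auto simp: closed_segment_eq_real_ivl)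
  \<comment> \<open>the first grid point above the lower end of the stretched interval starts a cell inside it\<close>
  define lo where "lo = min (F p) (F c)"
  define i where "i = \<lceil>lo / (\<kappa>/2)\<rceil>"
  have "lo / (\<kappa>/2) \<le> of_int i" "of_int i < lo / (\<kappa>/2) + 1" unfolding i_def by linarith+
  then have i: "lo \<le> of_int i * (\<kappa>/2)" "of_int i * (\<kappa>/2) < lo + \<kappa>/2"
    using \<kappa>(1) by (simp_all add: field_simps)
  define p' where "p' = of_int i * (\<kappa>/2)"
  define q' where "q' = (of_int i + 1) * (\<kappa>/2)"
  have pq': "lo \<le> p'" "p' < q'" "q' \<le> lo + \<kappa>" using i \<kappa>(1) by (auto simp: p'_def q'_def algebra_simps)
  have cs: "closed_segment (F p) (F c) = {lo..lo + \<kappa>}"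
    using g(5) by (auto simp: closed_segment_eq_real_ivl lo_def abs_if split: if_splits)
  have "p' \<in> F ` closed_segment p c" "q' \<in> F ` closed_segment p c"
    unfolding holonomy_segment_image(1)[OF g(3) order_refl] cs using pq' by auto
  then obtain u v where uv: "u \<in> closed_segment p c" "v \<in> closed_segment p c" "F u = p'" "F v = q'" by blast
  have uv': "u \<in> {p..c}" "v \<in> {p..c}" using uv(1,2) c(1) by (auto simp: closed_segment_eq_real_ivl)
  have sub: "closed_segment u v \<subseteq> closed_segment p c" using uv(1,2) by (simp add: subset_closed_segment)
  have seg: "closed_segment u v = {min u v..max u v}" by (auto simp: closed_segment_eq_real_ivl)
  have "F ` {min u v..max u v} = {p'..q'}"
    using holonomy_segment_image(1)[OF g(3) sub] uv(3,4) pq'(2) seg by (simp add: closed_segment_eq_real_ivl)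
  moreover have "holonomy \<sigma> \<sigma>' {min u v..max u v} T F" using holonomy_subset[OF g(3) sub] seg by simp
  moreover have "p \<le> min u v" "min u v \<le> max u v" "max u v \<le> q" "(min u v, max u v) \<noteq> (p, q)"
    using uv' c by auto
  ultimately have "covers (\<sigma>, p, q) (\<sigma>', p', q')" unfolding covers_def by blast
  moreover have "-3/4 \<le> lo" "lo + \<kappa> \<le> 3/4" using g(4,5) \<kappa>(2) by (auto simp: lo_def min_def abs_le_iff abs_if split: if_splits)
  then have "-3/4 \<le> p'" "q' \<le> 3/4" using pq' by linarith+
  ultimately show ?thesis using that[of \<sigma>' i] g(1) by (simp add: p'_def q'_def)
qed

text \<open>Among infinitely many successive grid cells two coincide, and covering is transitive.\<close>

lemma self_covering_interval:
  assumes J: "atlas J" and gr: "stretching J \<kappa>" and K: "invariant K"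
    and \<sigma>: "\<sigma> \<in> J" and pq: "p < q" "-3/4 \<le> p" "q \<le> 3/4" and sub: "\<sigma> ` {p..q} \<subseteq> K"
  obtains \<rho> p' q' where "\<rho> \<in> J" "p' < q'" "-3/4 \<le> p'" "q' \<le> 3/4" "\<rho> ` {p'..q'} \<subseteq> K"
    "covers (\<rho>, p', q') (\<rho>, p', q')"
proof -
  have \<kappa>: "\<kappa> > 0" using gr by (auto simp: stretching_def)
  define cell where "cell z = (fst z, of_int (snd z) * (\<kappa>/2), (of_int (snd z) + 1) * (\<kappa>/2))"
    for z :: "(real \<Rightarrow> 'a) \<times> int"
  define ok where "ok E \<longleftrightarrow> (case E of (\<rho>, p', q') \<Rightarrow> \<rho> \<in> J \<and> p' < q' \<and> -3/4 \<le> p' \<and> q' \<le> 3/4 \<and> \<rho> ` {p'..q'} \<subseteq> K)"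
    for E :: "(real \<Rightarrow> 'a) \<times> real \<times> real"
  have next_cell: "\<exists>z. ok (cell z) \<and> covers E (cell z)" if E: "ok E" for E
  proof -
    obtain \<rho> p' q' where E': "E = (\<rho>, p', q')" by (cases E) auto
    have o: "\<rho> \<in> J" "p' < q'" "-3/4 \<le> p'" "q' \<le> 3/4" "\<rho> ` {p'..q'} \<subseteq> K" using E by (auto simp: ok_def E')
    obtain \<sigma>' and i :: int where s: "\<sigma>' \<in> J" "-3/4 \<le> i * (\<kappa>/2)" "(i + 1) * (\<kappa>/2) \<le> 3/4"
      "covers (\<rho>, p', q') (\<sigma>', i * (\<kappa>/2), (i + 1) * (\<kappa>/2))"
      using covers_grid_step[OF J gr o(1-4)] by metis
    obtain c d T F where C: "p' \<le> c" "d \<le> q'" "holonomy \<rho> \<sigma>' {c..d} T F"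
      "F ` {c..d} = {i * (\<kappa>/2)..(i + 1) * (\<kappa>/2)}" using s(4) by (auto simp: covers_def)
    obtain e where box: "flow_box \<rho> e" using J o(1) by (auto simp: atlas_def)
    have "\<sigma>' (F u) \<in> K" if u: "u \<in> {c..d}" for u
    proof -
      have "\<rho> u \<in> K" using o(5) u C(1,2) by (force simp: image_subset_iff)
      then show ?thesis using holonomy_invariant[OF box K C(3) u] by simp
    qed
    then have "\<sigma>' ` {i * (\<kappa>/2)..(i + 1) * (\<kappa>/2)} \<subseteq> K" unfolding C(4)[symmetric] by blast
    then have "ok (cell (\<sigma>', i))" using s \<kappa> by (simp add: ok_def cell_def algebra_simps)
    moreover have "covers E (cell (\<sigma>', i))" using s(4) by (simp add: E' cell_def)
    ultimately show ?thesis by blast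
  qed
  have "ok (\<sigma>, p, q)" using assms by (simp add: ok_def)
  then obtain z0 where "ok (cell z0)" using next_cell by blast
  then have "\<exists>z. \<forall>n. ok (cell (z n)) \<and> covers (cell (z n)) (cell (z (Suc n)))"
    using dependent_nat_choice[of "\<lambda>_ z. ok (cell z)" "\<lambda>_ z z'. covers (cell z) (cell z')"] next_cell by blast
  then obtain z where z: "\<And>n. ok (cell (z n))" "\<And>n. covers (cell (z n)) (cell (z (Suc n)))" by blast
  have box: "\<exists>e. flow_box (fst (cell (z n))) e" for n
    using z(1)[of n] J by (auto simp: ok_def atlas_def split: prod.splits)
  have chain: "covers (cell (z n)) (cell (z m))" if "n < m" for n m
    using that
  proof (induction m)
    case (Suc m)
    then show ?case using z(2)[of m] covers_trans[OF box, of n "cell (z m)"] by (cases "n = m") auto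
  qed simp
  have "range z \<subseteq> J \<times> {- \<lceil>3 / (2 * \<kappa>)\<rceil>..\<lceil>3 / (2 * \<kappa>)\<rceil>}"
  proof (rule image_subsetI)
    fix n
    obtain \<rho> i where zn: "z n = (\<rho>, i)" by (cases "z n") auto
    have o: "\<rho> \<in> J" "-3/4 \<le> of_int i * (\<kappa>/2)" "(of_int i + 1) * (\<kappa>/2) \<le> 3/4"
      using z(1)[of n] unfolding ok_def cell_def zn by auto
    then have "of_int i * (\<kappa>/2) \<le> 3/4" using \<kappa> by (simp add: algebra_simps)
    note o = o(1,2) this
    have "- (3 / (2 * \<kappa>)) \<le> of_int i" "of_int i \<le> 3 / (2 * \<kappa>)" using o(2,3) \<kappa> by (simp_all add: field_simps)
    then have "- \<lceil>3 / (2 * \<kappa>)\<rceil> \<le> i" "i \<le> \<lceil>3 / (2 * \<kappa>)\<rceil>" by linarith+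
    then show "z n \<in> J \<times> {- \<lceil>3 / (2 * \<kappa>)\<rceil>..\<lceil>3 / (2 * \<kappa>)\<rceil>}" using o(1) by (simp add: zn)
  qed
  then have "finite (range z)" by (rule finite_subset) (use J in \<open>auto simp: atlas_def\<close>)
  then have "\<not> inj z" using finite_imageD by blast
  then obtain i j where "i \<noteq> j" "z i = z j" by (auto simp: inj_def)
  then obtain n m where nm: "n < m" "z n = z m" by (metis linorder_neqE_nat)
  then have "covers (cell (z n)) (cell (z n))" using chain by metis
  then show ?thesis using z(1)[of n] that by (auto simp: ok_def split: prod.splits)
qed

lemma orbit_closure_invariant:
  assumes x: "x \<in> X" shows "invariant (closure (flow_orbit \<phi> x))"
proof -
  let ?K = "closure (flow_orbit \<phi> x)"
  have KX: "?K \<subseteq> X"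
    by (rule closure_minimal) (use x compact_X in \<open>auto simp: flow_orbit_def compact_imp_closed\<close>)
  have fwd: "\<phi> t y \<in> ?K" if y: "y \<in> ?K" for t y
  proof -
    obtain z where z: "\<And>n. z n \<in> flow_orbit \<phi> x" "z \<longlonglongrightarrow> y" using y unfolding closure_sequential by blast
    have zX: "z n \<in> X" for n using z(1)[of n] x by (auto simp: flow_orbit_def)
    have "(\<lambda>n. \<phi> t (z n)) \<longlonglongrightarrow> \<phi> t y"
      by (rule tendsto_flow[OF tendsto_const z(2)]) (use zX y KX in auto)
    moreover have "\<phi> t (z n) \<in> flow_orbit \<phi> x" for n using z(1)[of n] x by (auto simp: flow_orbit_def)
    ultimately show ?thesis unfolding closure_sequential
      by (intro exI[of _ "\<lambda>n. \<phi> t (z n)"] conjI allI)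
  qed
  have bwd: "y \<in> ?K" if "y \<in> X" "\<phi> t y \<in> ?K" for t y using fwd[OF that(2), of "-t"] that(1) by simp
  show ?thesis unfolding invariant_def using KX fwd bwd by blast
qed

text \<open>The recurrent point is moved along its orbit to a point \<open>\<sigma> s\<close> of a cross-section, and the two cases are
  distinguished by the behaviour of its orbit closure to the right of \<open>s\<close>.\<close>

lemma no_recurrence_if_thin_shadowing:
  assumes nf: "\<And>x. x \<in> X \<Longrightarrow> \<not> fixed x" and thin_shadowing: "thin_shadowing \<delta>" and x0: "nontrivial_recurrence X \<phi> x0"
  shows False
proof -
  obtain J where J: "atlas J" using atlas_exists[OF nf] by metis
  obtain \<kappa> where gr: "stretching J \<kappa>" using intervals_stretch[OF thin_shadowing J] by metis
  have x0': "x0 \<in> X" "\<not> periodic_point \<phi> x0" "x0 \<in> omega_limit X \<phi> x0"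
    using x0 by (auto simp: nontrivial_recurrence_def)
  obtain \<sigma> e s t where b: "\<sigma> \<in> J" "flow_box \<sigma> e" "\<bar>s\<bar> < 1/2" "x0 = \<phi> t (\<sigma> s)"
    using J x0'(1) unfolding atlas_def by blast
  define x where "x = \<sigma> s"
  have xX: "x \<in> X" unfolding x_def by (rule flow_boxD(3)[OF b(2)]) (use b(3) in simp)
  have xx0: "x = \<phi> (- t) x0" using xX b(4) by (simp add: x_def)
  have rec: "x \<in> omega_limit X \<phi> x" unfolding xx0 by (rule recurrent_shift[OF x0'(1,3)])
  have aper: "\<phi> r x \<noteq> x" if "r \<noteq> 0" for r
  proof
    assume "\<phi> r x = x"
    then have "\<phi> t (\<phi> r x) = \<phi> t x" by simp
    then have "\<phi> r x0 = x0" using xX b(4) unfolding x_def[symmetric] by (simp add: add.commute)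
    then show False using periodic_point_if_period[OF x0'(1) nf[OF x0'(1)] _ that] x0'(2) by blast
  qed
  define K where "K = closure (flow_orbit \<phi> x)"
  have K: "invariant K" "closed K" unfolding K_def using orbit_closure_invariant[OF xX] by auto
  have xK: "x \<in> K" unfolding K_def
    using xX closure_subset[of "flow_orbit \<phi> x"] by (force simp: flow_orbit_def image_iff intro: exI[of _ 0])
  have "\<exists>\<eta>>0. \<forall>u. s < u \<longrightarrow> u < s + \<eta> \<longrightarrow> \<sigma> u \<in> K"
  proof (rule ccontr)
    assume "\<not> ?thesis"
    then have "\<exists>u. s < u \<and> u < s + \<eta> \<and> \<sigma> u \<notin> K" if "\<eta> > 0" for \<eta> using that by blast
    then have "\<exists>t. t \<noteq> 0 \<and> \<phi> t (\<sigma> s) = \<sigma> s"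
      by (intro periodic_if_accumulated_by_gaps[OF J gr K b(1,3)]) (use xK in \<open>auto simp: x_def\<close>)
    then show False using aper by (auto simp: x_def)
  qed
  then obtain \<eta> where \<eta>: "\<eta> > 0" "\<And>u. s < u \<Longrightarrow> u < s + \<eta> \<Longrightarrow> \<sigma> u \<in> K" by blast
  define q where "q = s + min (1/4) \<eta> / 2"
  have q: "s < q" "-3/4 \<le> s" "q \<le> 3/4" using \<eta>(1) b(3) by (auto simp: q_def min_def abs_less_iff)
  have "q < s + \<eta>" using \<eta>(1) by (auto simp: q_def min_def)
  then have sub: "\<sigma> ` {s..q} \<subseteq> K" using \<eta>(2) xK by (force simp: x_def le_less)
  obtain \<rho> p' q' where E: "\<rho> \<in> J" "p' < q'" "-3/4 \<le> p'" "q' \<le> 3/4" "\<rho> ` {p'..q'} \<subseteq> K"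
    "covers (\<rho>, p', q') (\<rho>, p', q')"
    using self_covering_interval[OF J gr K(1) b(1) q sub] by metis
  obtain e' where box: "flow_box \<rho> e'" using J E(1) by (auto simp: atlas_def)
  have b1: "-1 \<le> p'" "q' \<le> 1" using E(3,4) by auto
  define u where "u = (p' + q') / 2"
  have u: "p' < u" "u < q'" using E(2) by (auto simp: u_def)
  then have "\<rho> u \<in> K" using E(5) by auto
  then obtain y where y: "\<And>n. y n \<in> flow_orbit \<phi> x" "y \<longlonglongrightarrow> \<rho> u" unfolding K_def closure_sequential by blast
  have yX: "y n \<in> X" for n using y(1)[of n] xX by (auto simp: flow_orbit_def)
  have "eventually (\<lambda>n. \<exists>w r. p' < w \<and> w < q' \<and> \<bar>r\<bar> < e' \<and> y n = \<phi> r (\<rho> w)) sequentially"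
    by (rule eventually_hits_section[OF box u b1 yX y(2)])
  then obtain n w r where w: "p' < w" "w < q'" "y n = \<phi> r (\<rho> w)"
    using eventually_happens'[OF sequentially_bot] by blast
  obtain a where a: "y n = \<phi> a x" using y(1)[of n] by (auto simp: flow_orbit_def)
  have "\<rho> w \<in> X" by (rule flow_boxD(3)[OF box]) (use w b1 in auto)
  then have "\<rho> w = \<phi> (- r) (y n)" using w(3) by simp
  then have "\<rho> w = \<phi> (- r + a) x" using xX a by simp
  then obtain t where "t > 0" "\<phi> t x = x"
    using covers_refl_periodic[OF box E(2) b1 E(6) xX rec w(1,2)] by metis
  then show False using aper[of t] by simp
qed

lemma not_measure_expansive_if_recurrence:
  assumes "nontrivial_recurrence X \<phi> x0" shows "\<not> measure_expansive X \<phi>"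
proof (cases "\<exists>p. fixed p")
  case True
  then show ?thesis using not_measure_expansive_if_fixed_point by blast
next
  case False
  have "\<not> thin_shadowing \<delta>" for \<delta> using no_recurrence_if_thin_shadowing[OF _ _ assms] False by blast
  then show ?thesis by (intro not_measure_expansiveI) (auto simp: thin_shadowing_def)
qed

end

theorem theorem2p5:
  fixes X :: "'a::metric_space set" and \<phi> :: "real \<Rightarrow> 'a \<Rightarrow> 'a"
  assumes "closed_surface X"
    and "continuous_flow_on X \<phi>"
    and "\<exists>x\<^sub>0. nontrivial_recurrence X \<phi> x\<^sub>0"
  shows "\<not> measure_expansive X \<phi>"
proof -
  interpret surface_flow X \<phi> using assms by unfold_locales
  show ?thesis using assms(3) not_measure_expansive_if_recurrence by blast
qed

end
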